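(* Let $k \ge 4$ and let $T_0 : X \to X$ be a $C^k$ expanding map of the circle $X = \mathbb{R}/\mathbb{Z}$, with invariant density $\rho_0$. Let $\rho^{(1)} \in C^{k-2}(X,\mathbb{R})$ satisfy $\int_X \rho^{(1)}(x)\,dx = 0$. Then there exists $\epsilon \in C^{k-1}(X,\mathbb{R})$ that realises $\rho^{(1)}$, i.e. for every differentiable family $(T_\delta)_{\delta\in(-\eta,\eta)}$ of $C^3$ expanding maps through $T_0$ with first order term $\epsilon$, the invariant densities $\rho_\delta$ of $T_\delta$ satisfy $$\lim_{\delta\to 0}\left\| \frac{\rho_\delta-\rho_0}{\delta} - \rho^{(1)}\right\|_{L^1(X)} = 0 .$$ Moreover, there is an infinite dimensional affine subspace of $C^{k-1}(X,\mathbb{R})$ all of whose elements $\epsilon$ realise $\rho^{(1)}$ in this sense.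
   Context: An expanding map of the circle $X=\mathbb{R}/\mathbb{Z}$ is an orientation preserving $C^1$ map $T:X\to X$ of degree $d\ge 2$ with $\inf_{x\in X} T'(x) > 1$. The transfer operator of $T$ is $\mathcal{L}_T w(x) = \sum_{T(y)=x} w(y)/T'(y)$, acting on $L^1(X,\mathbb{R})$. An invariant density of $T$ is a probability density $\rho$ (nonnegative, $\int_X\rho\,dx=1$) with $\mathcal{L}_T\rho=\rho$; it is known that a $C^k$ expanding map ($k\ge2$) has a unique invariant density, and it is of class $C^{k-1}$. A differentiable family of $C^3$ expanding maps through $T_0$ with first order term $\epsilon\in C^3(X,\mathbb{R})$ is a family $(T_\delta)_{\delta\in(-\eta,\eta)}$, $\eta>0$, of $C^3$ expanding maps of $X$, equal to $T_0$ at $\delta=0$, such that $T_\delta = T_0+\delta\epsilon+o_{C^3}(\delta)$ (modulo 1), i.e. $\|(T_\delta-T_0)/\delta-\epsilon\|_{C^3}\to 0$ as $\delta\to0$, where $\|f\|_{C^3}=\sup|f|+\sup|f'|+\sup|f''|+\sup|f'''|$. For instance $T_\delta=T_0+\delta\epsilon \pmod 1$ is such a family for small $|\delta|$. *)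

theory Defs
  imports "HOL-Analysis.Analysis" "HOL-Library.Function_Algebras"
begin

section \<open>Real-valued functions as a real vector space\<close>

instantiation "fun" :: (type, real_vector) real_vector
begin

definition scaleR_fun :: "real \<Rightarrow> ('a \<Rightarrow> 'b) \<Rightarrow> 'a \<Rightarrow> 'b" where
  "scaleR_fun c f = (\<lambda>x. c *\<^sub>R f x)"

instance
  by standard (auto simp: scaleR_fun_def plus_fun_def fun_eq_iff scaleR_add_right scaleR_add_left)

end

text \<open>In the library, \<^term>\<open>aff_dim\<close> is restricted to Euclidean spaces.\<close>

definition infinite_dim_affine :: "'a::real_vector set \<Rightarrow> bool" where
  "infinite_dim_affine A \<longleftrightarrow> affine A \<and> \<not> (\<exists>S. finite S \<and> A \<subseteq> affine hull S)"


section \<open>The circle\<close>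

quotient_type circle = real / "\<lambda>x y :: real. x - y \<in> \<int>"
  morphisms rep_circle circ
proof (intro equivpI reflpI sympI transpI)
  show "x - y \<in> \<int> \<Longrightarrow> y - x \<in> \<int>" for x y :: real
    using Ints_minus[of "x - y"] by simp
  show "x - y \<in> \<int> \<Longrightarrow> y - z \<in> \<int> \<Longrightarrow> x - z \<in> \<int>" for x y z :: real
    using Ints_add[of "x - y" "y - z"] by simp
qed auto

instantiation circle :: ab_group_add
begin

lift_definition zero_circle :: circle is "0 :: real" .

lift_definition plus_circle :: "circle \<Rightarrow> circle \<Rightarrow> circle" is "(+) :: real \<Rightarrow> _"
  by (metis Ints_add add_diff_add)

lift_definition uminus_circle :: "circle \<Rightarrow> circle" is "uminus :: real \<Rightarrow> _"
  by (metis Ints_minus minus_diff_minus)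

lift_definition minus_circle :: "circle \<Rightarrow> circle \<Rightarrow> circle" is "(-) :: real \<Rightarrow> _"
proof -
  fix a b c d :: real
  assume "a - b \<in> \<int>" "c - d \<in> \<int>"
  then have "(a - b) - (c - d) \<in> \<int>" by (rule Ints_diff)
  then show "a - c - (b - d) \<in> \<int>" by (simp add: algebra_simps)
qed

instance
  by standard (transfer; simp)+

end

text \<open>
  Normalised Lebesgue measure on the circle: \<open>A\<close> is measurable iff its preimage in the
  real line is Lebesgue measurable, and \<open>A\<close> has the Lebesgue measure of that preimage
  within the fundamental domain \<open>{0..<1}\<close>.
\<close>

definition circle_lebesgue :: "circle measure" where
  "circle_lebesgue =
     distr (lebesgue_on {0..<1}) (sigma UNIV {A. circ -` A \<in> sets lebesgue}) circ"


section \<open>Regularity of functions on the circle\<close>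

definition Ck :: "nat \<Rightarrow> (real \<Rightarrow> real) set" where
  "Ck k = {f. (\<forall>j<k. \<forall>t. (deriv ^^ j) f differentiable (at t)) \<and>
              continuous_on UNIV ((deriv ^^ k) f)}"

definition Ck_circle :: "nat \<Rightarrow> (circle \<Rightarrow> real) set" where
  "Ck_circle k = {f. (\<lambda>t. f (circ t)) \<in> Ck k}"

text \<open>
  The suprema are those of the conditionally complete lattice of the reals, so this is only
  meaningful for \<open>f \<in> Ck_circle k\<close> (whose derivatives are bounded by periodicity).
\<close>

definition Ck_norm :: "nat \<Rightarrow> (circle \<Rightarrow> real) \<Rightarrow> real" where
  "Ck_norm k f = (\<Sum>j\<le>k. SUP t. \<bar>(deriv ^^ j) (\<lambda>t. f (circ t)) t\<bar>)"


section \<open>Expanding maps\<close>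

definition is_lift :: "(circle \<Rightarrow> circle) \<Rightarrow> (real \<Rightarrow> real) \<Rightarrow> bool" where
  "is_lift T F \<longleftrightarrow> continuous_on UNIV F \<and> (\<forall>t. T (circ t) = circ (F t))"

text \<open>
  Two lifts of the same map differ by an integer constant, so the derivative does not depend
  on the lift chosen, nor on the representative \<open>t\<close>.
\<close>

definition circle_deriv :: "(circle \<Rightarrow> circle) \<Rightarrow> circle \<Rightarrow> real" where
  "circle_deriv T x =
     (THE D. \<exists>F t. is_lift T F \<and> circ t = x \<and> (F has_real_derivative D) (at t))"

definition expanding_map :: "nat \<Rightarrow> (circle \<Rightarrow> circle) \<Rightarrow> bool" where
  "expanding_map k T \<longleftrightarrow>
     k \<ge> 1 \<and>
     (\<exists>F (d::int). is_lift T F \<and> F \<in> Ck k \<and> d \<ge> 2 \<and> (\<forall>t. F (t + 1) = F t + of_int d)) \<and>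
     (\<forall>x. circle_deriv T x > 0) \<and>
     (INF x. circle_deriv T x) > 1"

definition transfer_op :: "(circle \<Rightarrow> circle) \<Rightarrow> (circle \<Rightarrow> real) \<Rightarrow> circle \<Rightarrow> real" where
  "transfer_op T w x = (\<Sum>y | T y = x. w y / circle_deriv T y)"

definition invariant_density :: "(circle \<Rightarrow> circle) \<Rightarrow> (circle \<Rightarrow> real) \<Rightarrow> bool" where
  "invariant_density T \<rho> \<longleftrightarrow>
     integrable circle_lebesgue \<rho> \<and>
     (AE x in circle_lebesgue. 0 \<le> \<rho> x) \<and>
     (LINT x|circle_lebesgue. \<rho> x) = 1 \<and>
     (AE x in circle_lebesgue. transfer_op T \<rho> x = \<rho> x)"


section \<open>Differentiable families and linear response\<close>

text \<open>
  \<open>h \<delta>\<close> is the real-valued displacement \<open>T\<^sub>\<delta> - T\<^sub>0\<close> (modulo 1); it is determined only up to an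
  integer constant, and only matters for \<open>\<delta>\<close> close to \<open>0\<close>.
\<close>

definition differentiable_family ::
    "real \<Rightarrow> (circle \<Rightarrow> circle) \<Rightarrow> (circle \<Rightarrow> real) \<Rightarrow> (real \<Rightarrow> circle \<Rightarrow> circle) \<Rightarrow> bool" where
  "differentiable_family \<eta> T0 \<epsilon> T \<longleftrightarrow>
     \<eta> > 0 \<and> T 0 = T0 \<and> \<epsilon> \<in> Ck_circle 3 \<and>
     (\<forall>\<delta>\<in>{-\<eta><..<\<eta>}. expanding_map 3 (T \<delta>)) \<and>
     (\<exists>h :: real \<Rightarrow> circle \<Rightarrow> real.
        (\<forall>\<^sub>F \<delta> in at 0. h \<delta> \<in> Ck_circle 3 \<and> (\<forall>x. T \<delta> x = T0 x + circ (h \<delta> x))) \<and>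
        ((\<lambda>\<delta>. Ck_norm 3 (\<lambda>x. h \<delta> x / \<delta> - \<epsilon> x)) \<longlongrightarrow> 0) (at 0))"

text \<open>
  Invariant densities are only determined almost everywhere, hence the quantification over all
  choices of \<open>\<rho> \<delta>\<close>.
\<close>

definition realises ::
    "(circle \<Rightarrow> circle) \<Rightarrow> (circle \<Rightarrow> real) \<Rightarrow> (circle \<Rightarrow> real) \<Rightarrow> (circle \<Rightarrow> real) \<Rightarrow> bool" where
  "realises T0 \<rho>0 \<rho>1 \<epsilon> \<longleftrightarrow>
     (\<forall>\<eta> T \<rho>. differentiable_family \<eta> T0 \<epsilon> T \<longrightarrow>
        (\<forall>\<delta>\<in>{-\<eta><..<\<eta>}. invariant_density (T \<delta>) (\<rho> \<delta>)) \<longrightarrow>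
        ((\<lambda>\<delta>. LINT x|circle_lebesgue. \<bar>(\<rho> \<delta> x - \<rho>0 x) / \<delta> - \<rho>1 x\<bar>) \<longlongrightarrow> 0) (at 0))"

end

theory Submission
  imports Defs
begin

text \<open>
  Everything happens on the real line, with 1-periodic functions and a lift \<open>F\<close> of the map with
  inverse \<open>G\<close>; then \<open>L w = S (w / F')\<close> with \<open>S w x = (\<Sum>j<d. w (G (x + j)))\<close>, and \<open>(S w)' = S (w' / F')\<close>.

  \<open>L\<close> maps the cone of densities with \<open>\<bar>f'\<bar> \<le> a f\<close> strictly inside itself, so two such densities can be
  coupled: \<open>L f - L g = \<theta> (f\<^sub>1 - g\<^sub>1)\<close> with \<open>f\<^sub>1\<close>, \<open>g\<^sub>1\<close> in the cone and \<open>\<theta> < 1\<close> depending only on the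
  expansion and the distortion. Hence \<open>L\<close> decays exponentially on \<open>C\<^sup>1\<close> functions of mean zero,
  uniformly near \<open>T\<^sub>0\<close>, and an approximate solution \<open>R\<close> of \<open>L R = R\<close> is close to the invariant density
  in \<open>L\<^sup>1\<close>. Applied to \<open>R = \<rho>\<^sub>0 + \<delta> \<rho>\<^sub>1\<close>, whose defect is \<open>o(\<delta>)\<close> uniformly and \<open>O(\<delta>)\<close> in \<open>C\<^sup>1\<close> as soon as
  \<open>(L (\<epsilon> \<rho>\<^sub>0))' = L \<rho>\<^sub>1 - \<rho>\<^sub>1\<close>, this gives the response \<open>\<rho>\<^sub>1\<close>.

  The equation for \<open>\<epsilon>\<close> integrates to \<open>L (\<epsilon> \<rho>\<^sub>0) = \<Gamma>\<close>, which is solved by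
  \<open>\<epsilon> = F' (\<Gamma> \<circ> F) / (d \<rho>\<^sub>0)\<close>, up to the infinite-dimensional space of all
  \<open>F' (\<chi> \<circ> F) / \<rho>\<^sub>0\<close> where \<open>\<chi>\<close> is \<open>d\<close>-periodic and the sum of \<open>\<chi> (x + j)\<close> over \<open>j < d\<close> vanishes. For
  \<open>\<epsilon>\<close> to be \<open>C\<^sup>k\<^sup>-\<^sup>1\<close>, \<open>\<rho>\<^sub>0\<close> has to be: the derivatives of the iterates \<open>L\<^sup>n 1\<close> obey recursions with the
  weights \<open>1 / F'^p\<close>, \<open>p \<ge> 2\<close>, which contract the supremum norm weighted by \<open>\<rho>\<^sub>0\<close>.
\<close>

section \<open>Functions of class \<open>C\<^sup>k\<close> and periodic functions\<close>

text \<open>If \<open>u\<close> is the perturbed density minus \<open>R\<close> and \<open>e\<close>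
  is the defect of \<open>R\<close>, then \<open>u = L u + e\<close> almost everywhere for the
  perturbed \<open>L\<close>, so \<open>u\<close> is the sum of all \<open>L^n e\<close>. Neither
  bound on \<open>e\<close> is enough alone: the uniform o(\<delta>) bound cannot be summed over
  infinitely many \<open>n\<close>, and the \<open>C^1\<close> bound with exponential decay yields
  only O(\<delta>). The series is therefore cut at \<open>N\<close>: the head costs \<open>N\<close>
  times o(\<delta>), the tail O(\<delta>) times a power of the decay rate. \<open>N\<close> has to
  be fixed before \<delta>, which forces a decay rate common to all small \<delta>; hence every
  constant is a function of \<open>lam\<close> and \<open>D\<close> alone, and perturbed lifts share
  one slightly worse pair. In the regularity proof the weight \<open>1 / F'\<close> itself does not
  contract, since \<open>L\<close> fixes the density. Contraction starts with the first derivative,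
  and the convergence of the iterates themselves has to come from the coupling. The given invariant
  density is only an integrable function; the case \<open>e = 0\<close> of the same estimate
  identifies it almost everywhere with the smooth one.\<close>

lemma Ck_0: "f \<in> Ck 0 \<longleftrightarrow> continuous_on UNIV f"
  by (simp add: Ck_def)

text \<open>The innermost derivative is peeled off, so that regularity proofs become inductions on
  \<open>k\<close> with \<open>f\<close> arbitrary.\<close>

lemma Ck_Suc: "f \<in> Ck (Suc k) \<longleftrightarrow> (\<forall>t. f differentiable (at t)) \<and> deriv f \<in> Ck k"
proof -
  have "(\<forall>j<Suc k. \<forall>t. (deriv ^^ j) f differentiable (at t)) \<longleftrightarrow>
      (\<forall>t. f differentiable (at t)) \<and> (\<forall>j<k. \<forall>t. (deriv ^^ j) (deriv f) differentiable (at t))"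
    by (auto simp: less_Suc_eq_0_disj funpow_Suc_right simp del: funpow.simps(2))
  then show ?thesis
    by (auto simp: Ck_def funpow_Suc_right simp del: funpow.simps(2))
qed

lemma Ck_SucI:
  assumes "\<And>t. (f has_real_derivative f' t) (at t)" "f' \<in> Ck k"
  shows "f \<in> Ck (Suc k)"
proof -
  have "deriv f = f'" using assms(1) by (auto intro!: DERIV_imp_deriv)
  then show ?thesis
    using assms by (auto simp: Ck_Suc real_differentiable_def)
qed

lemma Ck_Suc_deriv:
  assumes "f \<in> Ck (Suc k)"
  shows "(f has_real_derivative deriv f t) (at t)" "deriv f \<in> Ck k"
  using assms by (auto simp: Ck_Suc DERIV_deriv_iff_real_differentiable)

lemma Ck_antimono_Suc: "f \<in> Ck (Suc k) \<Longrightarrow> f \<in> Ck k"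
proof (induction k arbitrary: f)
  case 0
  then show ?case
    by (auto simp: Ck_Suc Ck_0 continuous_on_eq_continuous_at differentiable_imp_continuous_within)
next
  case (Suc k)
  then show ?case by (simp add: Ck_Suc)
qed

lemma Ck_antimono: "f \<in> Ck m \<Longrightarrow> k \<le> m \<Longrightarrow> f \<in> Ck k"
  by (induction m) (auto simp: le_Suc_eq dest: Ck_antimono_Suc)

lemma Ck_DERIV: "f \<in> Ck k \<Longrightarrow> 1 \<le> k \<Longrightarrow> (f has_real_derivative deriv f t) (at t)"
  by (cases k) (auto dest: Ck_Suc_deriv)

lemma Ck_deriv: "f \<in> Ck k \<Longrightarrow> Suc j \<le> k \<Longrightarrow> deriv f \<in> Ck j"
  using Ck_antimono Ck_Suc_deriv(2) by blast

lemma Ck_continuous: "f \<in> Ck k \<Longrightarrow> continuous_on A f"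
  using Ck_antimono[of f k 0] continuous_on_subset by (auto simp: Ck_0)

lemma Ck_const [simp]: "(\<lambda>_. c) \<in> Ck k"
proof (induction k arbitrary: c)
  case (Suc k)
  show ?case by (rule Ck_SucI[of _ "\<lambda>_. 0"]) (auto simp: Suc)
qed (simp add: Ck_0)

lemma Ck_id [simp]: "(\<lambda>t. t) \<in> Ck k"
proof (cases k)
  case (Suc k)
  show ?thesis unfolding Suc by (rule Ck_SucI[of _ "\<lambda>_. 1"]) auto
qed (simp add: Ck_0)

lemma Ck_add: "f \<in> Ck k \<Longrightarrow> g \<in> Ck k \<Longrightarrow> (\<lambda>t. f t + g t) \<in> Ck k"
proof (induction k arbitrary: f g)
  case 0
  then show ?case by (auto simp: Ck_0 intro!: continuous_intros)
next
  case (Suc k)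
  show ?case
    by (rule Ck_SucI[of _ "\<lambda>t. deriv f t + deriv g t"])
       (use Suc in \<open>auto intro!: derivative_eq_intros dest: Ck_Suc_deriv\<close>)
qed

lemma Ck_mult: "f \<in> Ck k \<Longrightarrow> g \<in> Ck k \<Longrightarrow> (\<lambda>t. f t * g t) \<in> Ck k"
proof (induction k arbitrary: f g)
  case 0
  then show ?case by (auto simp: Ck_0 intro!: continuous_intros)
next
  case (Suc k)
  show ?case
    by (rule Ck_SucI[of _ "\<lambda>t. deriv f t * g t + f t * deriv g t"])
       (use Suc in \<open>auto intro!: derivative_eq_intros Ck_add Suc.IH dest: Ck_Suc_deriv Ck_antimono_Suc\<close>)
qed

lemma Ck_minus: "f \<in> Ck k \<Longrightarrow> (\<lambda>t. - f t) \<in> Ck k"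
  using Ck_mult[of "\<lambda>_. -1" k f] by simp

lemma Ck_diff: "f \<in> Ck k \<Longrightarrow> g \<in> Ck k \<Longrightarrow> (\<lambda>t. f t - g t) \<in> Ck k"
  using Ck_add[OF _ Ck_minus, of f k g] by simp

lemma Ck_power: "f \<in> Ck k \<Longrightarrow> (\<lambda>t. f t ^ n) \<in> Ck k"
  by (induction n) (auto intro: Ck_mult)

lemma Ck_inverse: "f \<in> Ck k \<Longrightarrow> (\<And>t. f t \<noteq> 0) \<Longrightarrow> (\<lambda>t. 1 / f t) \<in> Ck k"
proof (induction k)
  case 0
  then show ?case by (auto simp: Ck_0 intro!: continuous_intros)
next
  case (Suc k)
  have IH: "(\<lambda>t. 1 / f t) \<in> Ck k"
    using Suc by (auto dest: Ck_antimono_Suc)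
  show ?case
  proof (rule Ck_SucI)
    \<comment> \<open>The derivative is written as a product involving \<open>1 / f t\<close>
      itself, so that the induction hypothesis for \<open>1 / f\<close> applies to it.\<close>
    show "((\<lambda>t. 1 / f t) has_real_derivative - deriv f t * (1 / f t * (1 / f t))) (at t)" for t
      using Suc.prems Ck_Suc_deriv(1)[OF Suc.prems(1)] by (auto intro!: derivative_eq_intros)
    show "(\<lambda>t. - deriv f t * (1 / f t * (1 / f t))) \<in> Ck k"
      using Suc.prems(1) by (intro Ck_mult Ck_minus IH Ck_Suc_deriv)
  qed
qed

lemma Ck_divide: "f \<in> Ck k \<Longrightarrow> g \<in> Ck k \<Longrightarrow> (\<And>t. g t \<noteq> 0) \<Longrightarrow> (\<lambda>t. f t / g t) \<in> Ck k"
  using Ck_mult[OF _ Ck_inverse, of f k g] by simp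

lemma Ck_compose: "f \<in> Ck k \<Longrightarrow> g \<in> Ck k \<Longrightarrow> (\<lambda>t. f (g t)) \<in> Ck k"
proof (induction k arbitrary: f)
  case 0
  then show ?case by (auto simp: Ck_0 intro: continuous_on_compose2)
next
  case (Suc k)
  show ?case
  proof (rule Ck_SucI)
    show "((\<lambda>t. f (g t)) has_real_derivative deriv f (g t) * deriv g t) (at t)" for t
      using Suc.prems by (intro DERIV_chain2 Ck_Suc_deriv)
    show "(\<lambda>t. deriv f (g t) * deriv g t) \<in> Ck k"
      by (rule Ck_mult[OF Suc.IH[OF Ck_Suc_deriv(2)[OF Suc.prems(1)] Ck_antimono_Suc[OF Suc.prems(2)]]
          Ck_Suc_deriv(2)[OF Suc.prems(2)]])
  qed
qed

lemma Ck_sin_cos: "sin \<in> Ck k" "cos \<in> Ck k"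
proof (induction k)
  case (Suc k)
  show "sin \<in> Ck (Suc k)" by (rule Ck_SucI[of _ cos]) (auto simp: Suc)
  show "cos \<in> Ck (Suc k)"
    by (rule Ck_SucI[of _ "\<lambda>t. - sin t"]) (auto simp: Suc intro!: derivative_eq_intros Ck_minus)
qed (simp_all add: Ck_0 continuous_on_sin continuous_on_cos)

section \<open>Periodic functions of a real variable\<close>

definition periodic :: "(real \<Rightarrow> 'a) \<Rightarrow> bool" where
  "periodic f \<longleftrightarrow> (\<forall>t. f (t + 1) = f t)"

lemma periodicD: "periodic f \<Longrightarrow> f (t + 1) = f t"
  by (simp add: periodic_def)

lemma periodic_of_nat: "periodic f \<Longrightarrow> f (t + real n) = f t"
proof (induction n)
  case (Suc n)
  then show ?case using periodicD[of f "t + real n"] by (simp add: ac_simps)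
qed simp

lemma periodic_of_int:
  assumes "periodic f" shows "f (t + of_int n) = f t"
proof (cases "n \<ge> 0")
  case True
  then show ?thesis using periodic_of_nat[OF assms, of t "nat n"] by simp
next
  case False
  then show ?thesis using periodic_of_nat[OF assms, of "t + of_int n" "nat (- n)"] by simp
qed

lemma periodic_frac: "periodic f \<Longrightarrow> f t = f (frac t)"
  using periodic_of_int[of f "frac t" "\<lfloor>t\<rfloor>"] by (simp add: frac_def)

lemma periodic_deriv_of_shift:
  fixes f :: "real \<Rightarrow> real"
  assumes "\<And>t. f (t + 1) = f t + c" shows "periodic (deriv f)"
proof -
  have "(f has_real_derivative D) (at (t + 1)) \<longleftrightarrow> (f has_real_derivative D) (at t)" for D t
  proof -
    have "(f has_real_derivative D) (at (t + 1)) \<longleftrightarrow> ((\<lambda>x. f x + c) has_real_derivative D) (at t)"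
      using DERIV_shift[of f D t 1] by (simp add: assms)
    also have "\<dots> \<longleftrightarrow> (f has_real_derivative D) (at t)"
      using DERIV_add[of "\<lambda>x. f x + c" D t UNIV "\<lambda>_. - c" 0] DERIV_add[of f D t UNIV "\<lambda>_. c" 0] by auto
    finally show ?thesis .
  qed
  then show ?thesis by (simp add: periodic_def deriv_def)
qed

lemma periodic_deriv: "periodic f \<Longrightarrow> periodic (deriv f)" for f :: "real \<Rightarrow> real"
  using periodic_deriv_of_shift[of f 0] by (simp add: periodic_def)

lemma periodic_bounded:
  fixes f :: "real \<Rightarrow> real"
  assumes "periodic f" "continuous_on UNIV f"
  obtains M where "M > 0" "\<And>t. \<bar>f t\<bar> \<le> M"
proof -
  have "compact (f ` {0..1})"
    using assms(2) by (intro compact_continuous_image) (auto intro: continuous_on_subset)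
  then obtain M where M: "\<And>t. t \<in> {0..1} \<Longrightarrow> \<bar>f t\<bar> \<le> M"
    using compact_imp_bounded bounded_iff by (metis imageI real_norm_def)
  have "\<bar>f t\<bar> \<le> max M 1" for t
    using M[of "frac t"] periodic_frac[OF assms(1), of t] frac_lt_1[of t] by simp
  then show ?thesis by (intro that[of "max M 1"]) auto
qed

lemma periodic_Lipschitz:
  fixes f :: "real \<Rightarrow> real"
  assumes "periodic f" "f \<in> Ck 1"
  obtains M where "M > 0" "\<And>s t. \<bar>f s - f t\<bar> \<le> M * \<bar>s - t\<bar>"
proof -
  obtain M where M: "M > 0" "\<And>t. \<bar>deriv f t\<bar> \<le> M"
    using periodic_bounded[OF periodic_deriv[OF assms(1)]] Ck_continuous[OF Ck_deriv[OF assms(2), of 0]]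
    by auto
  have "\<bar>f s - f t\<bar> \<le> M * \<bar>s - t\<bar>" for s t
    using field_differentiable_bound[of UNIV f "deriv f" M s t] M(2) Ck_DERIV[OF assms(2)] by auto
  then show ?thesis using M(1) that by blast
qed

section \<open>Density of smooth periodic functions in \<open>L\<^sup>1\<close>\<close>

lemma antiderivative_UNIV:
  fixes g :: "real \<Rightarrow> real"
  assumes "continuous_on UNIV g"
  obtains \<Gamma> where "\<And>x. (\<Gamma> has_real_derivative g x) (at x)"
proof -
  have "\<exists>F. \<forall>x::real. -\<infinity> < ereal x \<longrightarrow> ereal x < \<infinity> \<longrightarrow> (F has_vector_derivative g x) (at x)"
    by (rule einterval_antiderivative)
       (use assms in \<open>auto simp: continuous_on_eq_continuous_at\<close>)
  then show ?thesis
    using that by (auto simp: has_real_derivative_iff_has_vector_derivative)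
qed

lemma antiderivative_periodic_shift:
  fixes g :: "real \<Rightarrow> real"
  assumes "\<And>x. (\<Gamma> has_real_derivative g x) (at x)" "periodic g"
  shows "\<Gamma> (x + 1) - \<Gamma> x = \<Gamma> 1 - \<Gamma> 0"
proof -
  have "((\<lambda>x. \<Gamma> (x + 1) - \<Gamma> x) has_real_derivative 0) (at x)" for x
    using assms(1)[of "x + 1"] assms(1)[of x] periodicD[OF assms(2), of x]
      DERIV_at_within_shift[of \<Gamma> "g x" 1 x UNIV]
    by (auto intro!: derivative_eq_intros simp: add.commute)
  then show ?thesis using DERIV_isconst_all[of "\<lambda>x. \<Gamma> (x + 1) - \<Gamma> x" x 0] by simp
qed

lemma absolutely_integrable_periodic_shift:
  fixes f :: "real \<Rightarrow> real"
  assumes "periodic f" "f absolutely_integrable_on {a..b}"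
  shows "f absolutely_integrable_on {a + of_int n..b + of_int n}"
    and "integral {a + of_int n..b + of_int n} f = integral {a..b} f"
proof -
  have im: "(\<lambda>x. x - of_int n) ` {a + of_int n..b + of_int n} = {a..b}"
    by (auto simp: image_iff intro!: bexI[where x="_ + of_int n"])
  have per: "f (x - of_int n) = f x" for x
    using periodic_of_int[OF assms(1), of x "- n"] by simp
  have "(\<lambda>x. \<bar>1\<bar> * f (x - of_int n)) absolutely_integrable_on {a + of_int n..b + of_int n} \<and>
      integral {a + of_int n..b + of_int n} (\<lambda>x. \<bar>1\<bar> * f (x - of_int n)) = integral {a..b} f"
    by (subst has_absolute_integral_change_of_variables_1')
       (auto intro!: derivative_eq_intros simp: inj_on_def im assms)
  then show "f absolutely_integrable_on {a + of_int n..b + of_int n}"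
    and "integral {a + of_int n..b + of_int n} f = integral {a..b} f"
    by (auto simp: per)
qed

text \<open>With \<open>n\<close> the integer part of \<open>a\<close>, the piece of
  \<open>[a, a + 1]\<close> to the right of \<open>n + 1\<close> is moved back by 1, which completes
  \<open>[n, n + 1]\<close>.\<close>

lemma periodic_integral_unit_interval:
  fixes f :: "real \<Rightarrow> real"
  assumes "periodic f" "f absolutely_integrable_on {0..1}"
  shows "f absolutely_integrable_on {a..a + 1}"
    and "integral {a..a + 1} f = integral {0..1} f"
proof -
  define n :: real where "n = of_int \<lfloor>a\<rfloor>"
  have n: "n \<le> a" "a \<le> n + 1" by (auto simp: n_def)
  have i1: "f absolutely_integrable_on {n..n + 1}" "integral {n..n + 1} f = integral {0..1} f"
    using absolutely_integrable_periodic_shift[OF assms, of "\<lfloor>a\<rfloor>"] by (auto simp: n_def add.commute)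
  have i2: "f absolutely_integrable_on {n + 1..n + 2}"
    using absolutely_integrable_periodic_shift[OF assms, of "\<lfloor>a\<rfloor> + 1"]
    by (simp add: n_def algebra_simps)
  have "f absolutely_integrable_on ({n..n + 1} \<union> {n + 1..n + 2})"
    using i1 i2 by (intro absolutely_integrable_Un) auto
  moreover have "{n..n + 1} \<union> {n + 1..n + 2} = {n..n + 2}" by auto
  ultimately have i3: "f absolutely_integrable_on {n..n + 2}" by simp
  have sub: "f absolutely_integrable_on {u..v}" if "n \<le> u" "v \<le> n + 2" for u v
    using i3 that by (auto intro: set_integrable_subset)
  show "f absolutely_integrable_on {a..a + 1}"
    using n by (intro sub) auto
  note int = set_lebesgue_integral_eq_integral(1)[OF sub]
  have sh: "integral {n + 1..a + 1} f = integral {n..a} f"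
    using absolutely_integrable_periodic_shift(2)[OF assms(1) sub[of n a], of 1] n by simp
  have "integral {a..a + 1} f = integral {a..n + 1} f + integral {n + 1..a + 1} f"
    using n by (subst Henstock_Kurzweil_Integration.integral_combine)
      (auto intro!: int)
  also have "\<dots> = integral {n..a} f + integral {a..n + 1} f"
    by (simp add: sh)
  also have "\<dots> = integral {n..n + 1} f"
    using n by (subst Henstock_Kurzweil_Integration.integral_combine)
      (auto intro!: int)
  finally show "integral {a..a + 1} f = integral {0..1} f" by (simp add: i1)
qed

text \<open>On each closed \<open>[n, n + 1]\<close> the extension is a translate of
  \<open>f\<close>; the right end point is where \<open>f 0 = f 1\<close> enters. Two neighbouring
  intervals glued together contain a neighbourhood of any point.\<close>

lemma continuous_periodic_extension:
  fixes f :: "real \<Rightarrow> real"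
  assumes "continuous_on {0..1} f" "f 0 = f 1"
  shows "continuous_on UNIV (\<lambda>t. f (frac t))" "periodic (\<lambda>t. f (frac t))"
proof -
  show "periodic (\<lambda>t. f (frac t))" by (simp add: periodic_def frac_1_eq)
  have cont: "continuous_on {of_int n..of_int n + 1} (\<lambda>t. f (frac t))" for n :: int
  proof -
    have "continuous_on {of_int n..of_int n + 1} (\<lambda>t. f (t - of_int n))"
      by (rule continuous_on_compose2[OF assms(1)]) (auto intro!: continuous_intros)
    moreover have "f (t - of_int n) = f (frac t)" if "t \<in> {of_int n..of_int n + 1}" for t
    proof (cases "t = of_int n + 1")
      case True
      then have "frac t = 0" by (simp add: frac_def)
      with True show ?thesis using assms(2) by simp
    next
      case False
      then have "\<lfloor>t\<rfloor> = n" using that by (simp add: floor_eq_iff)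
      then show ?thesis by (simp add: frac_def)
    qed
    ultimately show ?thesis by (subst (asm) continuous_on_cong) auto
  qed
  have "isCont (\<lambda>t. f (frac t)) t" for t
  proof -
    define n where "n = \<lfloor>t\<rfloor>"
    have "continuous_on ({of_int (n - 1)..of_int (n - 1) + 1} \<union> {of_int n..of_int n + 1}) (\<lambda>t. f (frac t))"
      by (intro continuous_on_closed_Un cont) auto
    then have "continuous_on {of_int n - 1<..<of_int n + 1} (\<lambda>t. f (frac t))"
      by (rule continuous_on_subset) auto
    moreover have "t \<in> {of_int n - 1<..<of_int n + 1}"
      using floor_correct[of t] unfolding n_def greaterThanLessThan_iff by linarith
    ultimately show ?thesis by (simp add: continuous_on_eq_continuous_at)
  qed
  then show "continuous_on UNIV (\<lambda>t. f (frac t))" by (simp add: continuous_on_eq_continuous_at)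
qed

lemma integrable_lebesgue_on_iff:
  "integrable (lebesgue_on {a..b}) f \<longleftrightarrow> f absolutely_integrable_on {a..b}" for f :: "real \<Rightarrow> real"
  by (simp add: set_integrable_def integrable_restrict_space)

lemma L1_approx_bounded_continuous:
  fixes f :: "real \<Rightarrow> real"
  assumes f: "f \<in> borel_measurable (lebesgue_on {0..1})" and bound: "\<And>x. \<bar>f x\<bar> \<le> M" and "e > 0"
  obtains g where "continuous_on UNIV g" "periodic g" "(LINT x|lebesgue_on {0..1}. \<bar>f x - g x\<bar>) < e"
proof -
  have "f measurable_on {0..1}"
    using f by (simp add: measurable_on_iff_borel_measurable)
  then obtain N h where N: "negligible N" and h: "\<And>n. continuous_on UNIV (h n)"
    and lim: "\<And>x. x \<notin> N \<Longrightarrow> (\<lambda>n. h n x) \<longlonglongrightarrow> (if x \<in> {0..1} then f x else 0)"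
    unfolding measurable_on_def by blast
  \<comment> \<open>The cutoff vanishes at 0 and 1, so the product extends periodically, and it is
    eventually 1 at each interior point. Clamping \<open>h n\<close> to \<open>[-M, M]\<close>
    supplies the dominating constant.\<close>
  define \<tau> where "\<tau> n x = max 0 (min 1 (real n * min x (1 - x)))" for n x
  define c where "c n x = \<tau> n x * max (- M) (min M (h n x))" for n x
  define g where "g n x = c n (frac x)" for n x
  have M0: "M \<ge> 0" using bound[of 0] by linarith
  have ccont: "continuous_on A (c n)" for n A
    unfolding c_def \<tau>_def
    by (intro continuous_intros continuous_on_subset[OF h]) auto
  have c01: "c n 0 = 0" "c n 1 = 0" for n by (auto simp: c_def \<tau>_def)
  have gcont: "continuous_on UNIV (g n)" "periodic (g n)" for n
    unfolding g_def using continuous_periodic_extension[OF ccont, of n] c01 by auto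
  have gc: "g n x = c n x" if "x \<in> {0..1}" for n x
    using that c01[of n] by (cases "x = 1") (auto simp: g_def frac_eq)
  let ?L = "lebesgue_on {0..1::real}"
  have AE_N: "AE x in ?L. x \<notin> N \<union> {0, 1}"
  proof -
    have "AE x in lebesgue. x \<notin> N \<union> {0, 1}"
      by (rule AE_not_in) (use N in \<open>auto simp: negligible_iff_null_sets[symmetric] negligible_Un\<close>)
    then show ?thesis by (subst AE_restrict_space_iff) auto
  qed
  have "(\<lambda>n. LINT x|?L. \<bar>f x - c n x\<bar>) \<longlonglongrightarrow> (LINT x|?L. 0)"
  proof (rule integral_dominated_convergence[where w="\<lambda>_. 2 * M"])
    show "AE x in ?L. (\<lambda>n. \<bar>f x - c n x\<bar>) \<longlonglongrightarrow> 0"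
      using AE_N
    proof (rule AE_mp, intro AE_I2 impI)
      fix x assume x: "x \<in> space ?L" "x \<notin> N \<union> {0, 1}"
      then have x01: "0 < x" "x < 1" by auto
      have "(\<lambda>n. h n x) \<longlonglongrightarrow> f x" using lim[of x] x x01 by auto
      then have "(\<lambda>n. max (- M) (min M (h n x))) \<longlonglongrightarrow> max (- M) (min M (f x))"
        by (intro tendsto_intros)
      moreover have "max (- M) (min M (f x)) = f x" using bound[of x] by auto
      moreover have "(\<lambda>n. \<tau> n x) \<longlonglongrightarrow> 1"
      proof (rule tendsto_eventually)
        obtain n0 :: nat where n0: "1 / min x (1 - x) < real n0" using reals_Archimedean2 by blast
        show "\<forall>\<^sub>F n in sequentially. \<tau> n x = 1"
          using eventually_ge_at_top[of n0]
        proof eventually_elim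
          case (elim n)
          have "1 / min x (1 - x) \<le> real n" using n0 elim by linarith
          then have "1 \<le> real n * min x (1 - x)" using x01 by (simp add: field_simps)
          then show ?case by (simp add: \<tau>_def)
        qed
      qed
      ultimately have "(\<lambda>n. c n x) \<longlonglongrightarrow> 1 * f x" unfolding c_def by (intro tendsto_mult) auto
      then show "(\<lambda>n. \<bar>f x - c n x\<bar>) \<longlonglongrightarrow> 0"
        using tendsto_rabs_zero[OF LIM_zero, of "\<lambda>n. c n x" "f x"] by (simp add: abs_minus_commute)
    qed
    show "AE x in ?L. norm \<bar>f x - c n x\<bar> \<le> 2 * M" for n
    proof (rule AE_I2)
      fix x
      have "\<bar>c n x\<bar> \<le> 1 * M" unfolding c_def abs_mult
        using M0 by (intro mult_mono) (auto simp: \<tau>_def)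
      then show "norm \<bar>f x - c n x\<bar> \<le> 2 * M" using bound[of x] by auto
    qed
    show "(\<lambda>x. \<bar>f x - c n x\<bar>) \<in> borel_measurable ?L" for n
      by (intro borel_measurable_abs borel_measurable_diff f continuous_imp_measurable_on_sets_lebesgue ccont) auto
  qed auto
  then have "\<forall>\<^sub>F n in sequentially. (LINT x|?L. \<bar>f x - c n x\<bar>) < e"
    using \<open>e > 0\<close> by (auto dest: order_tendstoD(2))
  then obtain n where "(LINT x|?L. \<bar>f x - c n x\<bar>) < e" by (auto simp: eventually_sequentially)
  moreover have "(LINT x|?L. \<bar>f x - g n x\<bar>) = (LINT x|?L. \<bar>f x - c n x\<bar>)"
    by (intro Bochner_Integration.integral_cong) (auto simp: gc)
  ultimately show ?thesis using that gcont by metis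
qed

lemma L1_approx_continuous:
  fixes f :: "real \<Rightarrow> real"
  assumes f: "integrable (lebesgue_on {0..1}) f" and "e > 0"
  obtains g where "continuous_on UNIV g" "periodic g" "(LINT x|lebesgue_on {0..1}. \<bar>f x - g x\<bar>) < e"
proof -
  let ?L = "lebesgue_on {0..1::real}"
  \<comment> \<open>Truncation at height \<open>n\<close> reduces to bounded functions.\<close>
  define c where "c n x = max (- real n) (min (real n) (f x))" for n x
  have cm: "c n \<in> borel_measurable ?L" for n
    using f unfolding c_def by (intro borel_measurable_max borel_measurable_min) auto
  have "(\<lambda>n. LINT x|?L. \<bar>f x - c n x\<bar>) \<longlonglongrightarrow> (LINT x|?L. 0)"
  proof (rule integral_dominated_convergence[where w="\<lambda>x. \<bar>f x\<bar>"])
    show "AE x in ?L. (\<lambda>n. \<bar>f x - c n x\<bar>) \<longlonglongrightarrow> 0"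
    proof (intro AE_I2 tendsto_eventually)
      fix x
      obtain n0 :: nat where n0: "\<bar>f x\<bar> < real n0" using reals_Archimedean2 by blast
      show "\<forall>\<^sub>F n in sequentially. \<bar>f x - c n x\<bar> = 0"
        using eventually_ge_at_top[of n0] by eventually_elim (use n0 in \<open>auto simp: c_def\<close>)
    qed
    show "(\<lambda>x. \<bar>f x - c n x\<bar>) \<in> borel_measurable ?L" for n
      using f cm by (intro borel_measurable_abs borel_measurable_diff) auto
    show "AE x in ?L. norm \<bar>f x - c n x\<bar> \<le> \<bar>f x\<bar>" for n
      by (intro AE_I2) (auto simp: c_def max_def min_def)
  qed (use f in auto)
  then have "\<forall>\<^sub>F n in sequentially. (LINT x|?L. \<bar>f x - c n x\<bar>) < e / 2"
    using \<open>e > 0\<close> by (intro order_tendstoD(2)) auto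
  then obtain n where n: "(LINT x|?L. \<bar>f x - c n x\<bar>) < e / 2" by (auto simp: eventually_sequentially)
  have cb: "\<bar>c n x\<bar> \<le> real n" for x by (auto simp: c_def)
  obtain g where g: "continuous_on UNIV g" "periodic g" "(LINT x|?L. \<bar>c n x - g x\<bar>) < e / 2"
    using L1_approx_bounded_continuous[OF cm cb, of "e / 2"] \<open>e > 0\<close> by auto
  have ci: "integrable ?L (c n)"
    using f by (rule Bochner_Integration.integrable_bound) (use cm in \<open>auto simp: c_def\<close>)
  have gi: "integrable ?L g"
    using continuous_imp_integrable_real[of 0 1 g] g(1) by (auto intro: continuous_on_subset)
  have "(LINT x|?L. \<bar>f x - g x\<bar>) \<le> (LINT x|?L. \<bar>f x - c n x\<bar> + \<bar>c n x - g x\<bar>)"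
    using f ci gi by (intro integral_mono) auto
  also have "\<dots> = (LINT x|?L. \<bar>f x - c n x\<bar>) + (LINT x|?L. \<bar>c n x - g x\<bar>)"
    using f ci gi by (intro Bochner_Integration.integral_add) auto
  finally show ?thesis using that[OF g(1,2)] n g(3) by linarith
qed

lemma L1_approx_C1:
  fixes f :: "real \<Rightarrow> real"
  assumes f: "integrable (lebesgue_on {0..1}) f" and "e > 0"
  obtains g where "g \<in> Ck 1" "periodic g" "(LINT x|lebesgue_on {0..1}. \<bar>f x - g x\<bar>) < e"
proof -
  let ?L = "lebesgue_on {0..1::real}"
  obtain g where g: "continuous_on UNIV g" "periodic g" "(LINT x|?L. \<bar>f x - g x\<bar>) < e / 2"
    using L1_approx_continuous[OF f, of "e / 2"] \<open>e > 0\<close> by auto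
  \<comment> \<open>The interval reaches up to 2 because averages over \<open>[x, x + h]\<close>
    with \<open>h \<le> 1\<close> look beyond 1.\<close>
  have "uniformly_continuous_on {0..2} g"
    using g(1) by (intro compact_uniformly_continuous) (auto intro: continuous_on_subset)
  then obtain \<delta> where \<delta>: "\<delta> > 0"
    "\<And>x y. x \<in> {0..2} \<Longrightarrow> y \<in> {0..2} \<Longrightarrow> \<bar>x - y\<bar> < \<delta> \<Longrightarrow> \<bar>g x - g y\<bar> < e / 2"
    unfolding uniformly_continuous_on_def dist_real_def using \<open>e > 0\<close> by (metis half_gt_zero)
  define h where "h = min 1 (\<delta> / 2)"
  have h: "0 < h" "h \<le> 1" "h < \<delta>" using \<delta>(1) by (auto simp: h_def min_def)
  obtain \<Gamma> where \<Gamma>: "\<And>x. (\<Gamma> has_real_derivative g x) (at x)"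
    using antiderivative_UNIV[OF g(1)] by blast
  \<comment> \<open>Moving average of \<open>g\<close> over \<open>[x, x + h]\<close>: it is
    \<open>C^1\<close>, remains periodic, and by the mean value theorem equals \<open>g z\<close>
    for some \<open>z\<close> in that window.\<close>
  define v where "v x = (\<Gamma> (x + h) - \<Gamma> x) / h" for x
  have v_per: "periodic v"
    using antiderivative_periodic_shift[OF \<Gamma> g(2)] unfolding periodic_def v_def
    by (smt (verit) add.assoc add.commute)
  have v_C1: "v \<in> Ck 1"
    unfolding One_nat_def
  proof (rule Ck_SucI[of _ "\<lambda>x. (g (x + h) - g x) / h"])
    show "(v has_real_derivative (g (x + h) - g x) / h) (at x)" for x
      unfolding v_def using \<Gamma>[of x] DERIV_at_within_shift[of \<Gamma> "g (x + h)" h x UNIV] \<Gamma>[of "x + h"] h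
      by (auto intro!: derivative_eq_intros simp: add.commute)
    show "(\<lambda>x. (g (x + h) - g x) / h) \<in> Ck 0"
      unfolding Ck_0 using h
      by (auto intro!: continuous_intros continuous_on_compose2[OF g(1)])
  qed
  have close: "\<bar>g x - v x\<bar> \<le> e / 2" if "x \<in> {0..1}" for x
  proof -
    obtain z where z: "x < z" "z < x + h" "\<Gamma> (x + h) - \<Gamma> x = (x + h - x) * g z"
      using MVT2[of x "x + h" \<Gamma> g] \<Gamma> h by auto
    then have "v x = g z" using h by (simp add: v_def)
    then show ?thesis using \<delta>(2)[of x z] z h that by fastforce
  qed
  have gi: "integrable ?L u" if "continuous_on UNIV u" for u :: "real \<Rightarrow> real"
    using continuous_imp_integrable_real[of 0 1 u] that by (auto intro: continuous_on_subset)
  note vc = Ck_continuous[OF v_C1]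
  have "(LINT x|?L. \<bar>f x - v x\<bar>) \<le> (LINT x|?L. \<bar>f x - g x\<bar> + e / 2)"
    using f gi[OF g(1)] gi[OF vc]
  proof (intro integral_mono)
    show "integrable ?L (\<lambda>x. \<bar>f x - g x\<bar> + e / 2)"
      using f gi[OF g(1)] gi[of "\<lambda>_. e / 2"] by (intro Bochner_Integration.integrable_add) auto
    show "\<bar>f x - v x\<bar> \<le> \<bar>f x - g x\<bar> + e / 2" if "x \<in> space ?L" for x
      using close[of x] that abs_triangle_ineq[of "f x - g x" "g x - v x"] by simp
  qed auto
  also have "\<dots> = (LINT x|?L. \<bar>f x - g x\<bar>) + e / 2"
    using f gi[OF g(1)] gi[of "\<lambda>_. e / 2"]
    by (subst Bochner_Integration.integral_add) (auto simp: measure_restrict_space)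
  finally show ?thesis using that[OF v_C1 v_per] g(3) by linarith
qed

section \<open>The transfer operator of a lift\<close>

abbreviation circ_int :: "(real \<Rightarrow> real) \<Rightarrow> real" where
  "circ_int f \<equiv> LINT x|lebesgue_on {0..1}. f x"

abbreviation L1_norm :: "(real \<Rightarrow> real) \<Rightarrow> real" where
  "L1_norm f \<equiv> circ_int (\<lambda>x. \<bar>f x\<bar>)"

definition L1_periodic :: "(real \<Rightarrow> real) set" where
  "L1_periodic = {f. periodic f \<and> integrable (lebesgue_on {0..1}) f}"

lemma L1_periodic_lin:
  "f \<in> L1_periodic \<Longrightarrow> g \<in> L1_periodic \<Longrightarrow> (\<lambda>x. \<alpha> * f x + \<beta> * g x) \<in> L1_periodic"
  by (auto simp: L1_periodic_def periodic_def)

lemma L1_periodic_diff: "f \<in> L1_periodic \<Longrightarrow> g \<in> L1_periodic \<Longrightarrow> (\<lambda>x. f x - g x) \<in> L1_periodic"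
  by (auto simp: L1_periodic_def periodic_def)

lemma L1_periodic_abs: "f \<in> L1_periodic \<Longrightarrow> (\<lambda>x. \<bar>f x\<bar>) \<in> L1_periodic"
  by (auto simp: L1_periodic_def periodic_def)

lemma L1_periodic_integrable: "f \<in> L1_periodic \<Longrightarrow> integrable (lebesgue_on {0..1}) f"
  by (simp add: L1_periodic_def)

lemma continuous_L1_periodic: "continuous_on UNIV f \<Longrightarrow> periodic f \<Longrightarrow> f \<in> L1_periodic"
  using continuous_imp_integrable_real[of 0 1 f] continuous_on_subset[of UNIV f "{0..1}"]
  by (auto simp: L1_periodic_def)

lemma Ck_L1_periodic: "f \<in> Ck k \<Longrightarrow> periodic f \<Longrightarrow> f \<in> L1_periodic"
  using Ck_continuous continuous_L1_periodic by blast

lemma measure_unit_interval [simp]: "measure (lebesgue_on {0..1::real}) {0..1} = 1"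
  by (simp add: measure_restrict_space)

lemma circ_int_const [simp]: "circ_int (\<lambda>_. k) = k"
  by simp

lemma const_L1_periodic [simp]: "(\<lambda>_. k) \<in> L1_periodic"
  by (rule continuous_L1_periodic) (auto simp: periodic_def)

lemma circ_int_mono:
  "f \<in> L1_periodic \<Longrightarrow> g \<in> L1_periodic \<Longrightarrow> (\<And>x. f x \<le> g x) \<Longrightarrow> circ_int f \<le> circ_int g"
  by (rule integral_mono) (auto simp: L1_periodic_def)

lemma circ_int_abs_bound:
  assumes "f \<in> L1_periodic" "\<And>x. \<bar>f x\<bar> \<le> M"
  shows "L1_norm f \<le> M"
  using circ_int_mono[OF L1_periodic_abs[OF assms(1)] const_L1_periodic[of M]] assms(2) by simp

text \<open>Positive densities whose logarithm is Lipschitz with constant \<open>a\<close>, phrased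
  without division.\<close>

definition density_cone :: "real \<Rightarrow> (real \<Rightarrow> real) set" where
  "density_cone a = {f. f \<in> Ck 1 \<and> periodic f \<and> (\<forall>t. f t > 0) \<and> (\<forall>t. \<bar>deriv f t\<bar> \<le> a * f t) \<and> circ_int f = 1}"

text \<open>\<open>exp (a * t) * f t\<close> is nondecreasing. Periodicity moves \<open>y\<close> to
  within distance 1 to the left of \<open>x\<close>, so at most a factor \<open>exp a\<close> is
  lost.\<close>

lemma cone_ratio:
  assumes "f \<in> Ck 1" "periodic f" "\<And>t. \<bar>deriv f t\<bar> \<le> a * f t" "a \<ge> 0" "\<And>t. f t \<ge> 0"
  shows "f y \<le> exp a * f x"
proof -
  define y' where "y' = y + of_int \<lfloor>x - y\<rfloor>"
  have y': "y' \<le> x" "x \<le> y' + 1" unfolding y'_def by linarith+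
  have "exp (a * y') * f y' \<le> exp (a * x) * f x"
  proof (rule DERIV_nonneg_imp_nondecreasing[OF y'(1)])
    fix t
    have "((\<lambda>t. exp (a * t) * f t) has_real_derivative exp (a * t) * (a * f t + deriv f t)) (at t)"
      using Ck_DERIV[OF assms(1), of t] by (auto intro!: derivative_eq_intros simp: algebra_simps)
    moreover have "exp (a * t) * (a * f t + deriv f t) \<ge> 0"
      using assms(3)[of t] by (intro mult_nonneg_nonneg) auto
    ultimately show "\<exists>d. ((\<lambda>t. exp (a * t) * f t) has_real_derivative d) (at t) \<and> 0 \<le> d" by blast
  qed
  then have "exp (- (a * y')) * (exp (a * y') * f y') \<le> exp (- (a * y')) * (exp (a * x) * f x)"
    by (rule mult_left_mono) simp
  then have "f y' \<le> exp (a * (x - y')) * f x"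
    by (simp add: right_diff_distrib flip: mult.assoc exp_add)
  also have "\<dots> \<le> exp a * f x"
    using y' assms(4,5) by (intro mult_right_mono) (auto simp: mult_left_le)
  finally show ?thesis using periodic_of_int[OF assms(2), of y] by (simp add: y'_def)
qed

text \<open>One of the two arguments in \<open>cone_ratio\<close> is integrated out, the mean being
  1.\<close>

lemma cone_bounds:
  assumes "f \<in> density_cone a" "a \<ge> 0"
  shows "exp (- a) \<le> f x" "f x \<le> exp a"
proof -
  have f: "f \<in> L1_periodic" "circ_int f = 1" and r: "f y \<le> exp a * f x" for x y
    using assms cone_ratio[of f a] by (auto simp: density_cone_def less_imp_le intro: Ck_L1_periodic)
  have "circ_int f \<le> circ_int (\<lambda>_. exp a * f x)"
    using r[of _ x] by (intro circ_int_mono f) auto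
  then show "exp (- a) \<le> f x" by (simp add: f exp_minus field_simps)
  have "circ_int (\<lambda>_. f x) \<le> circ_int (\<lambda>y. exp a * f y)"
    using r[of x] L1_periodic_lin[OF f(1) f(1), of "exp a" 0] by (intro circ_int_mono) auto
  then show "f x \<le> exp a" by (simp add: f)
qed

text \<open>\<open>L\<close> turns the cone parameter \<open>a\<close> into
  \<open>(a + D) / lam\<close>, whose fixed point is \<open>D / (lam - 1)\<close>. Adding 1 puts the
  parameter above it, so that the image lies strictly inside.\<close>

definition cone_const :: "real \<Rightarrow> real \<Rightarrow> real" where
  "cone_const lam D = D / (lam - 1) + 1"

text \<open>\<open>1 - decay\<close> is the mass that two densities share after one step: the
  relative gap between the cone parameters \<open>a\<close> and \<open>(a + D) / lam\<close>, times
  the lower bound \<open>exp (- a)\<close> valid on the cone.\<close>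

definition decay :: "real \<Rightarrow> real \<Rightarrow> real" where
  "decay lam D = 1 - (1 - (cone_const lam D + D) / lam / cone_const lam D) * exp (- cone_const lam D)"

text \<open>The first factor is the scale at which a mean-zero perturbation of 1 stays in the cone;
  \<open>exp a\<close> bounds the difference of two densities of the cone.\<close>

definition decay_const :: "real \<Rightarrow> real \<Rightarrow> real" where
  "decay_const lam D = (1 + 1 / cone_const lam D) * exp (cone_const lam D)"

text \<open>\<open>lam\<close> and \<open>D\<close> are parameters and need not be optimal, so one
  pair can serve a whole family of lifts. Distortion is measured relative to \<open>F'\<close>
  because then the term \<open>f F'' / F'^2\<close> in the derivative of \<open>f / F'\<close> is at
  most \<open>D\<close> times \<open>f / F'\<close>.\<close>

locale expanding_lift =
  fixes F :: "real \<Rightarrow> real" and d :: nat and lam D :: real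
  assumes F_C2: "F \<in> Ck 2"
    and F_shift: "F (t + 1) = F t + real d"
    and d_pos: "d > 0"
    and lam: "lam > 1"
    and F'_ge: "lam \<le> deriv F t"
    and distortion: "\<bar>deriv (deriv F) t\<bar> \<le> D * deriv F t"
begin

definition G where "G = inv F"

text \<open>The points \<open>G (x + j)\<close> with \<open>j < d\<close> represent the
  \<open>d\<close> preimages on the circle; \<open>S\<close> sums over them without weight.\<close>

definition S :: "(real \<Rightarrow> real) \<Rightarrow> real \<Rightarrow> real" where
  "S w x = (\<Sum>j<d. w (G (x + real j)))"

definition L :: "(real \<Rightarrow> real) \<Rightarrow> real \<Rightarrow> real" where
  "L w = S (\<lambda>t. w t / deriv F t)"

lemma F'_pos: "deriv F t > 0" and F'_gt_1: "deriv F t > 1" and F'_neq_0: "deriv F t \<noteq> 0"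
  using lam F'_ge[of t] by linarith+

lemma D_nonneg: "D \<ge> 0"
  using distortion[of 0] F'_pos[of 0] by (smt (verit) mult_less_0_iff)

lemma F_deriv: "(F has_real_derivative deriv F t) (at t)"
  using Ck_DERIV[OF F_C2] by simp

lemma F'_C1: "deriv F \<in> Ck 1"
  using Ck_deriv[OF F_C2] by simp

lemma F'_deriv: "(deriv F has_real_derivative deriv (deriv F) t) (at t)"
  using Ck_DERIV[OF F'_C1] by simp

lemma F'_periodic: "periodic (deriv F)"
  by (rule periodic_deriv_of_shift[of F, OF F_shift])

lemma F_expand_less: "s \<le> t \<Longrightarrow> t - s \<le> F t - F s"
proof (cases "s < t")
  case True
  then obtain z where "F t - F s = (t - s) * deriv F z"
    using MVT2[of s t F "deriv F"] F_deriv by auto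
  then show ?thesis using True F'_gt_1[of z] by (simp add: mult_le_cancel_left1)
qed simp

lemma F_expand: "\<bar>s - t\<bar> \<le> \<bar>F s - F t\<bar>"
  using F_expand_less[of s t] F_expand_less[of t s] by linarith

lemma F_mono: "strict_mono F"
  using F_expand_less by (intro strict_monoI) (smt (verit))

lemma F_shift_int: "F (t + of_int n) = F t + of_int n * real d"
proof -
  have "F (t + of_int n) - of_int n * real d = F t"
  proof (induction n rule: int_induct[where k=0])
    case (step1 i)
    then show ?case using F_shift[of "t + of_int i"] by (simp add: algebra_simps)
  next
    case (step2 i)
    then show ?case using F_shift[of "t + of_int i - 1"] by (simp add: algebra_simps)
  qed simp
  then show ?thesis by simp
qed

lemma F_surj: "surj F"
proof -
  have "\<exists>t. F t = x" for x
  proof -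
    define n where "n = \<lceil>\<bar>x - F 0\<bar>\<rceil>"
    have n: "n \<ge> 0" "\<bar>x - F 0\<bar> \<le> of_int n" unfolding n_def by linarith+
    have "of_int n \<le> of_int n * real d" using n d_pos by (simp add: mult_le_cancel_left1)
    then have "F (of_int (- n)) \<le> x" "x \<le> F (of_int n)"
      using F_shift_int[of 0 n] F_shift_int[of 0 "- n"] n by auto
    moreover have "continuous_on {of_int (- n)..of_int n} F" using Ck_continuous[OF F_C2] .
    ultimately show ?thesis using IVT'[of F "of_int (- n)" x "of_int n"] n by auto
  qed
  then show ?thesis by (metis surj_def)
qed

lemma F_G [simp]: "F (G x) = x"
  using F_surj by (simp add: G_def surj_f_inv_f)

lemma G_F [simp]: "G (F t) = t"
  using F_mono by (simp add: G_def strict_mono_imp_inj_on)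

lemma G_eq_iff: "G x = t \<longleftrightarrow> x = F t" by auto

lemma G_lip: "\<bar>G x - G y\<bar> \<le> \<bar>x - y\<bar>"
  using F_expand[of "G x" "G y"] by simp

lemma G_mono: "x \<le> y \<Longrightarrow> G x \<le> G y"
  using F_mono by (metis F_G not_le strict_mono_less)

lemma G_cont: "isCont G x"
  unfolding continuous_at_eps_delta dist_real_def using G_lip by (meson le_less_trans)

lemma G_deriv: "(G has_real_derivative 1 / deriv F (G x)) (at x)"
  using DERIV_inverse_function[of F "deriv F (G x)" G x "x - 1" "x + 1"] F_deriv F'_neq_0 G_cont
  by (simp add: inverse_eq_divide)

lemma G_shift: "G (x + real d) = G x + 1"
  by (simp add: G_eq_iff F_shift)

lemma S_mono: "(\<And>t. v t \<le> w t) \<Longrightarrow> S v x \<le> S w x"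
  by (simp add: S_def sum_mono)

lemma S_abs: "\<bar>S w x\<bar> \<le> S (\<lambda>t. \<bar>w t\<bar>) x"
  by (simp add: S_def sum_abs)

lemma S_lin: "S (\<lambda>t. \<alpha> * v t + \<beta> * w t) x = \<alpha> * S v x + \<beta> * S w x"
  by (simp add: S_def sum.distrib sum_distrib_left)

lemma S_bound: "(\<And>t. \<bar>w t\<bar> \<le> M) \<Longrightarrow> \<bar>S w x\<bar> \<le> real d * M"
  using S_abs[of w x] S_mono[of "\<lambda>t. \<bar>w t\<bar>" "\<lambda>_. M" x] by (simp add: S_def[of "\<lambda>_. M"])

text \<open>Adding 1 to \<open>x\<close> rotates the branches: branch \<open>j\<close> becomes
  branch \<open>j + 1\<close>, and branch \<open>d\<close> is branch 0 moved by a full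
  period.\<close>

lemma S_periodic:
  assumes "periodic w" shows "periodic (S w)"
proof -
  have "S w (x + 1) = S w x" for x
  proof -
    define h where "h j = w (G (x + real j))" for j
    have "S w (x + 1) = (\<Sum>j<d. h (Suc j))" by (simp add: S_def h_def ac_simps)
    also have "\<dots> = (\<Sum>j<Suc d. h j) - h 0" by (simp only: sum.lessThan_Suc_shift)
    also have "h d = h 0" using G_shift[of x] periodicD[OF assms] by (simp add: h_def)
    then have "(\<Sum>j<Suc d. h j) - h 0 = S w x" by (simp add: S_def h_def)
    finally show ?thesis .
  qed
  then show ?thesis by (simp add: periodic_def)
qed

lemma S_deriv:
  assumes "w \<in> Ck 1"
  shows "(S w has_real_derivative S (\<lambda>t. deriv w t / deriv F t) x) (at x)"
  unfolding S_def
proof (rule DERIV_sum)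
  fix j
  have "((\<lambda>x. w (G (x + real j))) has_real_derivative
      deriv w (G (x + real j)) * (1 / deriv F (G (x + real j)))) (at x)"
    using G_deriv[of "x + real j"]
    by (intro DERIV_chain2[OF Ck_DERIV[OF assms]]) (auto simp: DERIV_shift add.commute)
  then show "((\<lambda>x. w (G (x + real j))) has_real_derivative
      deriv w (G (x + real j)) / deriv F (G (x + real j))) (at x)" by simp
qed

text \<open>The induction closes because the derivative is again of the form \<open>S\<close>, of a
  function one order less smooth.\<close>

lemma S_Ck: "F \<in> Ck k \<Longrightarrow> w \<in> Ck k \<Longrightarrow> S w \<in> Ck k"
proof (induction k arbitrary: w)
  case 0
  then show ?case unfolding Ck_0 S_def
    by (intro continuous_intros continuous_on_compose2[OF 0(2)[unfolded Ck_0]]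
          continuous_at_imp_continuous_on ballI isCont_o2[OF _ G_cont]) auto
next
  case (Suc k)
  show ?case
  proof (rule Ck_SucI)
    show "(S w has_real_derivative S (\<lambda>t. deriv w t / deriv F t) x) (at x)" for x
      using Ck_antimono[OF Suc.prems(2), of 1] by (intro S_deriv) simp
    show "S (\<lambda>t. deriv w t / deriv F t) \<in> Ck k"
      using Suc.prems by (intro Suc.IH Ck_divide Ck_Suc_deriv(2) Ck_antimono_Suc[OF Suc.prems(1)] F'_neq_0)
  qed
qed

lemma L_abs: "\<bar>L w x\<bar> \<le> L (\<lambda>t. \<bar>w t\<bar>) x"
  using S_abs[of "\<lambda>t. w t / deriv F t" x] F'_pos by (simp add: L_def abs_divide abs_of_pos)

lemma L_lin: "L (\<lambda>t. \<alpha> * v t + \<beta> * w t) x = \<alpha> * L v x + \<beta> * L w x"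
  unfolding L_def S_lin[symmetric] by (simp add: add_divide_distrib)

lemma L_diff: "L (\<lambda>t. v t - w t) x = L v x - L w x"
  using L_lin[of 1 v "-1" w x] by simp

lemma L_periodic: "periodic w \<Longrightarrow> periodic (L w)"
  unfolding L_def using F'_periodic by (intro S_periodic) (auto simp: periodic_def)

lemma L_Ck: "F \<in> Ck (Suc k) \<Longrightarrow> w \<in> Ck k \<Longrightarrow> L w \<in> Ck k"
  unfolding L_def by (intro S_Ck Ck_divide Ck_Suc_deriv(2) F'_neq_0) (auto dest: Ck_antimono_Suc)

lemma L_C1: "w \<in> Ck 1 \<Longrightarrow> L w \<in> Ck 1"
  using L_Ck[of 1 w] F_C2 by (simp add: numeral_2_eq_2)

lemma quotient_deriv:
  assumes "w \<in> Ck 1"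
  shows "((\<lambda>t. w t / deriv F t) has_real_derivative
     deriv w t / deriv F t - w t * deriv (deriv F) t / (deriv F t)\<^sup>2) (at t)"
  using Ck_DERIV[OF assms, of t] F'_deriv[of t] F'_neq_0[of t]
  by (auto intro!: derivative_eq_intros simp: field_simps power2_eq_square)

lemma L_deriv:
  assumes "w \<in> Ck 1"
  shows "(L w has_real_derivative
    S (\<lambda>t. (deriv w t / deriv F t - w t * deriv (deriv F) t / (deriv F t)\<^sup>2) / deriv F t) x) (at x)"
proof -
  have "deriv (\<lambda>t. w t / deriv F t) =
      (\<lambda>t. deriv w t / deriv F t - w t * deriv (deriv F) t / (deriv F t)\<^sup>2)"
    using quotient_deriv[OF assms] by (auto intro!: DERIV_imp_deriv)
  then show ?thesis
    using S_deriv[of "\<lambda>t. w t / deriv F t" x] Ck_divide[OF assms F'_C1 F'_neq_0] by (simp add: L_def)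
qed

text \<open>Substitution in branch \<open>j\<close> turns its summand into the integral of
  \<open>w\<close> over \<open>[G j, G (j + 1)]\<close>. These intervals add up to
  \<open>[G 0, G 0 + 1]\<close>, one full period. Working with absolute integrability makes this
  available for every integrable \<open>w\<close>.\<close>

lemma L_integral:
  assumes w: "w \<in> L1_periodic"
  shows "L w \<in> L1_periodic" "circ_int (L w) = circ_int w"
proof -
  have per: "periodic w" and wi: "w absolutely_integrable_on {0..1}"
    using w by (auto simp: L1_periodic_def integrable_lebesgue_on_iff)
  have G0: "G (real d) = G 0 + 1" using G_shift[of 0] by simp
  have wi': "w absolutely_integrable_on {G 0..G 0 + 1}"
    "integral {G 0..G 0 + 1} w = integral {0..1} w"
    using periodic_integral_unit_interval[OF per wi] by auto
  have sub: "w absolutely_integrable_on {G u..G v}" if "0 \<le> u" "v \<le> real d" for u v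
    using wi'(1) G_mono[OF that(1)] G_mono[OF that(2)] unfolding G0
    by (auto intro: set_integrable_subset)
  have piece: "(\<lambda>x. w (G (x + real j)) / deriv F (G (x + real j))) absolutely_integrable_on {0..1}"
    "integral {0..1} (\<lambda>x. w (G (x + real j)) / deriv F (G (x + real j))) =
      integral {G (real j)..G (real (Suc j))} w" if "j < d" for j
  proof -
    have im: "(\<lambda>x. G (x + real j)) ` {0..1} = {G (real j)..G (real (Suc j))}"
    proof (intro equalityI subsetI)
      fix y assume y: "y \<in> {G (real j)..G (real (Suc j))}"
      then have "real j \<le> F y" "F y \<le> real (Suc j)"
        using F_mono[THEN strict_mono_mono, THEN monoD, of "G (real j)" y]
          F_mono[THEN strict_mono_mono, THEN monoD, of y "G (real (Suc j))"] by auto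
      then show "y \<in> (\<lambda>x. G (x + real j)) ` {0..1}"
        by (intro image_eqI[of _ _ "F y - real j"]) auto
    qed (auto intro!: G_mono)
    have "(\<lambda>x. \<bar>1 / deriv F (G (x + real j))\<bar> * w (G (x + real j))) absolutely_integrable_on {0..1} \<and>
      integral {0..1} (\<lambda>x. \<bar>1 / deriv F (G (x + real j))\<bar> * w (G (x + real j))) =
      integral {G (real j)..G (real (Suc j))} w"
    proof (subst has_absolute_integral_change_of_variables_1'[where g="\<lambda>x. G (x + real j)"])
      show "((\<lambda>x. G (x + real j)) has_real_derivative 1 / deriv F (G (x + real j))) (at x within {0..1})" for x
        using G_deriv[of "x + real j"] by (auto simp: DERIV_shift add.commute intro: has_field_derivative_at_within)
      show "inj_on (\<lambda>x. G (x + real j)) {0..1}"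
        by (auto simp: inj_on_def G_eq_iff)
    qed (use that in \<open>auto simp: im intro!: sub\<close>)
    then show "(\<lambda>x. w (G (x + real j)) / deriv F (G (x + real j))) absolutely_integrable_on {0..1}"
      "integral {0..1} (\<lambda>x. w (G (x + real j)) / deriv F (G (x + real j))) =
        integral {G (real j)..G (real (Suc j))} w"
      using F'_pos by (auto simp: abs_of_pos)
  qed
  have tele: "(\<Sum>j<m. integral {G (real j)..G (real (Suc j))} w) = integral {G 0..G (real m)} w"
    if "m \<le> d" for m
    using that
  proof (induction m)
    case (Suc m)
    have "(\<Sum>j<Suc m. integral {G (real j)..G (real (Suc j))} w) =
        integral {G 0..G (real m)} w + integral {G (real m)..G (real (Suc m))} w"
      using Suc by simp
    also have "\<dots> = integral {G 0..G (real (Suc m))} w"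
      using Suc.prems
      by (intro Henstock_Kurzweil_Integration.integral_combine G_mono
            set_lebesgue_integral_eq_integral(1)[OF sub]) auto
    finally show ?case .
  qed simp
  have ai: "L w absolutely_integrable_on {0..1}"
    unfolding L_def S_def using piece(1) by (intro absolutely_integrable_sum) auto
  then show "L w \<in> L1_periodic"
    using L_periodic[OF per] by (simp add: L1_periodic_def integrable_lebesgue_on_iff)
  have "integral {0..1} (L w) = (\<Sum>j<d. integral {G (real j)..G (real (Suc j))} w)"
    unfolding L_def S_def using piece
    by (subst integral_sum) (auto intro: set_lebesgue_integral_eq_integral(1))
  also have "\<dots> = integral {0..1} w" using tele[of d] wi'(2) by (simp add: G0)
  finally show "circ_int (L w) = circ_int w"
    using ai wi by (simp add: lebesgue_integral_eq_integral integrable_lebesgue_on_iff)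
qed

end

section \<open>Exponential decay by coupling\<close>

context expanding_lift
begin

abbreviation a where "a \<equiv> cone_const lam D"
abbreviation \<theta> where "\<theta> \<equiv> decay lam D"

lemma a_pos: "a > 0"
  using D_nonneg lam by (simp add: cone_const_def add_nonneg_pos)

lemma a_contract: "(a + D) / lam = a - (lam - 1) / lam"
  using lam by (simp add: cone_const_def field_simps)

lemma cone_gap: "0 < 1 - (a + D) / lam / a" "1 - (a + D) / lam / a < 1"
proof -
  have "(a + D) / lam < a" using lam unfolding a_contract by simp
  then have "(a + D) / lam / a < 1" using a_pos by (subst pos_divide_less_eq) auto
  then show "0 < 1 - (a + D) / lam / a" by simp
  have "0 < (a + D) / lam / a" using a_pos D_nonneg lam by simp
  then show "1 - (a + D) / lam / a < 1" by simp
qed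

lemma decay_less_1: "\<theta> < 1"
  using cone_gap by (simp add: decay_def)

lemma exp_a_less: "exp (- a) < 1"
  using a_pos by simp

lemma decay_pos: "0 < \<theta>"
proof -
  have "(1 - (a + D) / lam / a) * exp (- a) < 1 * 1"
    using cone_gap exp_a_less by (intro mult_strict_mono) auto
  then show ?thesis by (simp add: decay_def)
qed

lemma decay_const_pos: "decay_const lam D > 0"
  using a_pos by (simp add: decay_const_def add_pos_pos)

text \<open>In \<open>(f / F')' / F'\<close> the inner quotient rule gives at most
  \<open>(a + D) f / F'\<close>, the \<open>D\<close> coming from distortion; the outer
  \<open>1 / F'\<close> then gains the factor \<open>1 / lam\<close>.\<close>

lemma L_cone:
  assumes "f \<in> density_cone a"
  shows "L f \<in> Ck 1" "periodic (L f)" "L f x > 0" "circ_int (L f) = 1"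
    "\<bar>deriv (L f) x\<bar> \<le> (a + D) / lam * L f x"
proof -
  have f: "f \<in> Ck 1" "periodic f" "f t > 0" "\<bar>deriv f t\<bar> \<le> a * f t" "circ_int f = 1" for t
    using assms by (auto simp: density_cone_def)
  show "L f \<in> Ck 1" "periodic (L f)" "circ_int (L f) = 1"
    using f L_C1 L_periodic L_integral(2)[OF Ck_L1_periodic[OF f(1,2)]] by auto
  show "L f x > 0"
    unfolding L_def S_def using f(3) F'_pos d_pos by (intro sum_pos) auto
  have "\<bar>(deriv f t / deriv F t - f t * deriv (deriv F) t / (deriv F t)\<^sup>2) / deriv F t\<bar> \<le>
      (a + D) / lam * (f t / deriv F t)" for t
  proof -
    have "\<bar>f t * deriv (deriv F) t / (deriv F t)\<^sup>2\<bar> \<le> f t * (D * deriv F t) / (deriv F t)\<^sup>2"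
      using f(3)[of t] distortion[of t] by (simp add: abs_mult abs_divide divide_right_mono)
    also have "\<dots> = D * (f t / deriv F t)"
      using F'_neq_0[of t] by (simp add: power2_eq_square)
    finally have 1: "\<bar>f t * deriv (deriv F) t / (deriv F t)\<^sup>2\<bar> \<le> D * (f t / deriv F t)" .
    have 2: "\<bar>deriv f t / deriv F t\<bar> \<le> a * (f t / deriv F t)"
      using f(4)[of t] F'_pos[of t] by (simp add: abs_divide divide_right_mono)
    have "\<bar>deriv f t / deriv F t - f t * deriv (deriv F) t / (deriv F t)\<^sup>2\<bar> \<le> (a + D) * (f t / deriv F t)"
      using 1 2 by (simp only: distrib_right)
    then have "\<bar>(deriv f t / deriv F t - f t * deriv (deriv F) t / (deriv F t)\<^sup>2) / deriv F t\<bar> \<le>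
        (a + D) * (f t / deriv F t) / deriv F t"
      using F'_pos[of t] by (subst abs_divide) (simp only: abs_of_pos, simp only: divide_right_mono less_imp_le)
    also have "\<dots> \<le> (a + D) * (f t / deriv F t) / lam"
      using F'_ge[of t] lam f(3)[of t] F'_pos[of t] a_pos D_nonneg
      by (intro divide_left_mono mult_nonneg_nonneg) auto
    finally show ?thesis by (simp add: mult.commute)
  qed
  then have "\<bar>S (\<lambda>t. (deriv f t / deriv F t - f t * deriv (deriv F) t / (deriv F t)\<^sup>2) / deriv F t) x\<bar> \<le>
      S (\<lambda>t. (a + D) / lam * (f t / deriv F t)) x"
    by (intro order_trans[OF S_abs] S_mono)
  then show "\<bar>deriv (L f) x\<bar> \<le> (a + D) / lam * L f x"
    using S_lin[of "(a + D) / lam" "\<lambda>t. f t / deriv F t" 0 "\<lambda>_. 0" x]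
      DERIV_imp_deriv[OF L_deriv[OF f(1), of x]] by (simp add: L_def)
qed

lemma L_in_cone:
  assumes "f \<in> density_cone a"
  shows "L f \<in> density_cone a"
proof -
  note Lf = L_cone[OF assms]
  have "(a + D) / lam * L f x \<le> a * L f x" for x
    using Lf(3)[of x] lam unfolding a_contract by (intro mult_right_mono) auto
  then show ?thesis using Lf(1-4) order_trans[OF Lf(5)] by (auto simp: density_cone_def)
qed

text \<open>Subtracting a small constant from \<open>L f\<close> leaves it in the cone, because \<open>L\<close> maps the cone
  strictly inside itself.\<close>

lemma L_cone_minus:
  assumes "f \<in> density_cone a"
  shows "(\<lambda>x. (L f x - (1 - \<theta>)) / \<theta>) \<in> density_cone a"
proof -
  note Lf = L_cone[OF assms]
  have lower: "exp (- a) \<le> L f x" for x using cone_bounds[OF L_in_cone[OF assms]] a_pos by simp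
  have gap: "1 - \<theta> = (1 - (a + D) / lam / a) * exp (- a)" by (simp add: decay_def)
  have "1 - \<theta> < exp (- a)"
    unfolding gap using cone_gap(2) by simp
  then have pos: "L f x - (1 - \<theta>) > 0" for x using lower[of x] by simp
  have der: "((\<lambda>x. (L f x - (1 - \<theta>)) / \<theta>) has_real_derivative deriv (L f) x / \<theta>) (at x)" for x
    using Ck_DERIV[OF Lf(1), of x] decay_pos by (auto intro!: derivative_eq_intros)
  \<comment> \<open>Subtracting a constant leaves the derivative unchanged but lowers the right side
    of the cone inequality by \<open>a * (1 - \<theta>)\<close>. The slack of \<open>L_cone\<close>
    must pay for this, and \<theta> is defined so that it does so exactly where \<open>L f\<close>
    equals its lower bound \<open>exp (- a)\<close>.\<close>
  have "a * (1 - \<theta>) \<le> (a - (a + D) / lam) * L f x" for x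
  proof -
    have "a * ((1 - q / a) * E) = (a - q) * E" for q E
      using a_pos by (simp add: field_simps)
    then have "a * (1 - \<theta>) = (a - (a + D) / lam) * exp (- a)"
      unfolding gap .
    also have "\<dots> \<le> (a - (a + D) / lam) * L f x"
      using lower[of x] lam unfolding a_contract by (intro mult_left_mono) auto
    finally show ?thesis .
  qed
  then have "(a + D) / lam * L f x \<le> a * (L f x - (1 - \<theta>))" for x
    by (simp add: algebra_simps)
  then have "\<bar>deriv (L f) x\<bar> \<le> a * (L f x - (1 - \<theta>))" for x
    using Lf(5)[of x] by (rule order_trans[rotated])
  then have "\<bar>deriv (\<lambda>x. (L f x - (1 - \<theta>)) / \<theta>) x\<bar> \<le> a * ((L f x - (1 - \<theta>)) / \<theta>)" for x
    using decay_pos DERIV_imp_deriv[OF der[of x]] by (simp add: abs_divide divide_right_mono)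
  moreover have "circ_int (\<lambda>x. (L f x - (1 - \<theta>)) / \<theta>) = 1"
    using L1_periodic_integrable[OF Ck_L1_periodic[OF Lf(1,2)]] Lf(4) decay_pos
    by (simp add: Bochner_Integration.integral_diff)
  moreover have "(\<lambda>x. (L f x - (1 - \<theta>)) / \<theta>) \<in> Ck 1"
    using decay_pos by (intro Ck_divide Ck_diff Lf) auto
  ultimately show ?thesis
    using pos decay_pos Lf(2) by (auto simp: density_cone_def periodic_def)
qed

lemma iterate_lin:
  "(L ^^ n) (\<lambda>t. \<alpha> * v t + \<beta> * w t) = (\<lambda>x. \<alpha> * (L ^^ n) v x + \<beta> * (L ^^ n) w x)"
  by (induction n) (auto simp: L_lin)

lemma iterate_diff: "(L ^^ n) (\<lambda>t. v t - w t) = (\<lambda>x. (L ^^ n) v x - (L ^^ n) w x)"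
  using iterate_lin[of n 1 v "-1" w] by simp

lemma coupling:
  assumes "f \<in> density_cone a" "g \<in> density_cone a"
  shows "\<exists>f'\<in>density_cone a. \<exists>g'\<in>density_cone a. \<forall>x. (L ^^ n) f x - (L ^^ n) g x = \<theta> ^ n * (f' x - g' x)"
proof (induction n)
  case 0
  then show ?case using assms by auto
next
  case (Suc n)
  then obtain f' g' where fg: "f' \<in> density_cone a" "g' \<in> density_cone a"
    and eq: "\<And>x. (L ^^ n) f x - (L ^^ n) g x = \<theta> ^ n * (f' x - g' x)" by blast
  \<comment> \<open>The same constant is removed from \<open>L f'\<close> and \<open>L g'\<close>,
    hence it cancels in the difference; renormalising to mass 1 yields the factor \<theta>.\<close>
  have "(L ^^ Suc n) f x - (L ^^ Suc n) g x = \<theta> ^ Suc n *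
      ((L f' x - (1 - \<theta>)) / \<theta> - (L g' x - (1 - \<theta>)) / \<theta>)" for x
  proof -
    have "(L ^^ Suc n) f x - (L ^^ Suc n) g x = L (\<lambda>t. (L ^^ n) f t - (L ^^ n) g t) x"
      by (simp add: L_diff)
    also have "\<dots> = L (\<lambda>t. \<theta> ^ n * f' t + (- (\<theta> ^ n)) * g' t) x"
      by (simp add: eq right_diff_distrib)
    also have "\<dots> = \<theta> ^ n * (L f' x - L g' x)" by (subst L_lin) (simp add: algebra_simps)
    finally have "(L ^^ Suc n) f x - (L ^^ Suc n) g x = \<theta> ^ n * (L f' x - L g' x)" .
    moreover have "(L f' x - (1 - \<theta>)) / \<theta> - (L g' x - (1 - \<theta>)) / \<theta> = (L f' x - L g' x) / \<theta>"
      by (simp add: diff_divide_distrib)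
    ultimately show ?thesis using decay_pos by simp
  qed
  then show ?case
    by (intro bexI[OF _ L_cone_minus[OF fg(1)]] bexI[OF _ L_cone_minus[OF fg(2)]] allI)
qed

lemma one_cone: "(\<lambda>_. 1) \<in> density_cone a"
  using a_pos by (simp add: density_cone_def periodic_def)

lemma cone_diff_bound:
  assumes "f \<in> density_cone a" "g \<in> density_cone a"
  shows "\<bar>f x - g x\<bar> \<le> exp a"
  using cone_bounds[OF assms(1), of x] cone_bounds[OF assms(2), of x] a_pos
    less_trans[OF _ exp_gt_zero, of 0] by (smt (verit) exp_gt_zero)

text \<open>A mean-zero function is a multiple of the difference of two densities in the cone,
  \<open>1 + e / K\<close> and 1, to which the coupling applies.\<close>

lemma iterate_zero_mean:
  assumes e: "e \<in> Ck 1" "periodic e" "circ_int e = 0"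
    and A: "A > 0" "\<And>x. \<bar>e x\<bar> \<le> A" "\<And>x. \<bar>deriv e x\<bar> \<le> A"
  shows "\<bar>(L ^^ n) e x\<bar> \<le> A * decay_const lam D * \<theta> ^ n"
proof -
  \<comment> \<open>Solves \<open>A / K = a * (1 - A / K)\<close>: the largest possible slope of
    \<open>1 + e / K\<close> is then just \<open>a\<close> times its least possible value.\<close>
  define K where "K = A * (1 + 1 / a)"
  have K: "K > 0" "A < K" using A a_pos by (auto simp: K_def add_pos_pos algebra_simps)
  define f where "f t = 1 + e t / K" for t
  have der: "(f has_real_derivative deriv e t / K) (at t)" for t
    unfolding f_def using Ck_DERIV[OF e(1), of t] K by (auto intro!: derivative_eq_intros)
  have "f \<in> density_cone a"
  proof -
    have "f t > 0" for t
    proof -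
      have "\<bar>e t / K\<bar> < 1" using A(2)[of t] K by (simp add: abs_divide)
      then show ?thesis unfolding f_def by linarith
    qed
    moreover have "\<bar>deriv f t\<bar> \<le> a * f t" for t
    proof -
      have "\<bar>deriv f t\<bar> \<le> A / K"
        using DERIV_imp_deriv[OF der[of t]] A(3)[of t] K by (simp add: abs_divide divide_right_mono)
      also have "A / K = a * (1 - A / K)"
        using K a_pos unfolding K_def by (simp add: field_simps)
      also have "\<dots> \<le> a * f t"
      proof -
        have "- A / K \<le> e t / K" using A(2)[of t] K
          by (intro divide_right_mono) auto
        then show ?thesis using a_pos by (simp add: f_def)
      qed
      finally show ?thesis .
    qed
    moreover have "circ_int f = 1"
      unfolding f_def using L1_periodic_integrable[OF Ck_L1_periodic[OF e(1,2)]] e(3)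
      by (subst Bochner_Integration.integral_add) auto
    moreover have "f \<in> Ck 1" unfolding f_def using K by (intro Ck_add Ck_divide e) auto
    moreover have "periodic f" using e(2) by (simp add: periodic_def f_def)
    ultimately show ?thesis by (simp add: density_cone_def)
  qed
  then obtain f' g' where fg: "f' \<in> density_cone a" "g' \<in> density_cone a"
    and eq: "\<And>x. (L ^^ n) f x - (L ^^ n) (\<lambda>_. 1) x = \<theta> ^ n * (f' x - g' x)"
    using coupling[OF _ one_cone, of f n] by blast
  have "e = (\<lambda>t. K * f t + (- K) * 1)" using K by (auto simp: f_def field_simps)
  then have "(L ^^ n) e x = K * (L ^^ n) f x + (- K) * (L ^^ n) (\<lambda>_. 1) x"
    using iterate_lin[of n K f "- K" "\<lambda>_. 1"] by metis
  also have "\<dots> = K * ((L ^^ n) f x - (L ^^ n) (\<lambda>_. 1) x)" by (simp add: algebra_simps)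
  also have "\<dots> = K * (\<theta> ^ n * (f' x - g' x))" by (simp only: eq)
  finally have "\<bar>(L ^^ n) e x\<bar> = K * (\<theta> ^ n * \<bar>f' x - g' x\<bar>)"
    using K decay_pos by (simp add: abs_mult)
  also have "\<dots> \<le> K * (\<theta> ^ n * exp a)"
    using K decay_pos cone_diff_bound[OF fg] by (intro mult_left_mono) auto
  finally show ?thesis by (simp add: K_def decay_const_def algebra_simps)
qed

text \<open>Positivity of \<open>L\<close> together with preservation of the integral.\<close>

lemma L_norm:
  assumes "w \<in> L1_periodic"
  shows "L1_norm (L w) \<le> L1_norm w"
proof -
  have "L1_norm (L w) \<le> circ_int (L (\<lambda>x. \<bar>w x\<bar>))"
    by (intro circ_int_mono L_integral L1_periodic_abs assms L_abs)
  then show ?thesis using L_integral(2)[OF L1_periodic_abs[OF assms]] by simp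
qed

lemma iterate_L1: "w \<in> L1_periodic \<Longrightarrow> (L ^^ n) w \<in> L1_periodic"
  by (induction n) (auto intro: L_integral)

lemma iterate_norm:
  "w \<in> L1_periodic \<Longrightarrow> L1_norm ((L ^^ n) w) \<le> L1_norm w"
proof (induction n)
  case (Suc n)
  then show ?case using L_norm[OF iterate_L1[OF Suc.prems, of n]] by simp
qed simp

lemma circ_int_triangle:
  assumes "u \<in> L1_periodic" "v \<in> L1_periodic"
  shows "L1_norm (\<lambda>x. u x + v x) \<le> L1_norm u + L1_norm v"
proof -
  have "L1_norm (\<lambda>x. u x + v x) \<le> circ_int (\<lambda>x. \<bar>u x\<bar> + \<bar>v x\<bar>)"
    using assms by (intro integral_mono) (auto simp: L1_periodic_def)
  also have "\<dots> = L1_norm u + L1_norm v"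
    using assms by (intro Bochner_Integration.integral_add) (auto simp: L1_periodic_def)
  finally show ?thesis .
qed

text \<open>A merely integrable \<open>u\<close> has no rate of decay. It is approximated by a
  \<open>C^1\<close> function, recentred to mean zero; the error does not grow because
  \<open>L\<close> contracts the \<open>L^1\<close> norm.\<close>

lemma iterate_L1_tendsto_0:
  assumes u: "u \<in> L1_periodic" "circ_int u = 0"
  shows "(\<lambda>n. L1_norm ((L ^^ n) u)) \<longlonglongrightarrow> 0"
proof (rule LIMSEQ_I)
  fix r :: real assume r: "r > 0"
  obtain v where v: "v \<in> Ck 1" "periodic v" "L1_norm (\<lambda>x. u x - v x) < r / 3"
    using L1_approx_C1[OF L1_periodic_integrable[OF u(1)], of "r / 3"] r by auto
  note vL = Ck_L1_periodic[OF v(1,2)]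
  have uv: "(\<lambda>x. u x - v x) \<in> L1_periodic" using u vL by (intro L1_periodic_diff)
  define m where "m = circ_int v"
  have "\<bar>m\<bar> = \<bar>circ_int (\<lambda>x. u x - v x)\<bar>"
    using u vL by (simp add: m_def L1_periodic_integrable)
  also have "\<dots> \<le> L1_norm (\<lambda>x. u x - v x)" by (rule integral_abs_bound)
  finally have m: "\<bar>m\<bar> < r / 3" using v(3) by simp
  define w where "w x = v x - m" for x
  have w: "w \<in> Ck 1" "periodic w" "circ_int w = 0"
    unfolding w_def using v L1_periodic_integrable[OF vL]
    by (auto intro: Ck_diff simp: periodic_def m_def)
  note wL = Ck_L1_periodic[OF w(1,2)]
  have uw: "L1_norm (\<lambda>x. u x - w x) < 2 * r / 3"
    using circ_int_triangle[OF uv const_L1_periodic[of m]] v(3) m by (simp add: w_def algebra_simps)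
  obtain M1 where M1: "M1 > 0" "\<And>x. \<bar>w x\<bar> \<le> M1"
    using periodic_bounded[OF w(2) Ck_continuous[OF w(1)]] by blast
  obtain M2 where M2: "M2 > 0" "\<And>x. \<bar>deriv w x\<bar> \<le> M2"
    using periodic_bounded[OF periodic_deriv[OF w(2)]] Ck_continuous[OF Ck_deriv[OF w(1), of 0]] by auto
  define A where "A = max M1 M2"
  have "\<bar>(L ^^ n) w x\<bar> \<le> A * decay_const lam D * \<theta> ^ n" for n x
    using M1 M2 by (intro iterate_zero_mean w) (auto simp: A_def max.coboundedI1 max.coboundedI2)
  then have wn: "L1_norm ((L ^^ n) w) \<le> A * decay_const lam D * \<theta> ^ n" for n
    by (intro circ_int_abs_bound iterate_L1 wL)
  have "(\<lambda>n. A * decay_const lam D * \<theta> ^ n) \<longlonglongrightarrow> A * decay_const lam D * 0"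
    using decay_pos decay_less_1 by (intro tendsto_intros LIMSEQ_realpow_zero) auto
  then have "\<forall>\<^sub>F n in sequentially. A * decay_const lam D * \<theta> ^ n < r / 3"
    by (rule order_tendstoD(2)) (use r in auto)
  then obtain n0 where n0: "\<And>n. n \<ge> n0 \<Longrightarrow> A * decay_const lam D * \<theta> ^ n < r / 3"
    by (auto simp: eventually_sequentially)
  have "L1_norm ((L ^^ n) u) < r" if "n \<ge> n0" for n
  proof -
    have uwL: "(\<lambda>x. u x - w x) \<in> L1_periodic" using u wL by (intro L1_periodic_diff)
    have "L1_norm ((L ^^ n) u) = L1_norm (\<lambda>x. (L ^^ n) (\<lambda>x. u x - w x) x + (L ^^ n) w x)"
      by (simp add: iterate_diff)
    also have "\<dots> \<le> L1_norm (\<lambda>x. (L ^^ n) (\<lambda>x. u x - w x) x) + L1_norm ((L ^^ n) w)"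
      by (intro circ_int_triangle iterate_L1 uwL wL)
    also have "\<dots> < r" using iterate_norm[OF uwL, of n] uw wn[of n] n0[OF that] by linarith
    finally show ?thesis .
  qed
  moreover have "0 \<le> L1_norm ((L ^^ n) u)" for n by simp
  ultimately show "\<exists>no. \<forall>n\<ge>no. norm (L1_norm ((L ^^ n) u) - 0) < r"
    by (intro exI[of _ n0]) auto
qed

text \<open>The constants depend on the lift only through \<open>lam\<close> and \<open>D\<close>, which gives uniformity along a family.\<close>

theorem almost_invariant_bound:
  assumes u: "u \<in> L1_periodic" "circ_int u = 0"
    and e: "e \<in> Ck 1" "periodic e"
    and A: "A > 0" "\<And>x. \<bar>e x\<bar> \<le> A" "\<And>x. \<bar>deriv e x\<bar> \<le> A"
    and \<eta>: "\<And>x. \<bar>e x\<bar> \<le> \<eta>"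
    and eq: "AE x in lebesgue_on {0..1}. u x = L u x + e x"
  shows "L1_norm u \<le> real N * \<eta> + A * decay_const lam D * \<theta> ^ N / (1 - \<theta>)"
proof -
  note eL = Ck_L1_periodic[OF e(1,2)]
  note Lu = L_integral[OF u(1)]
  have "circ_int u = circ_int (\<lambda>x. L u x + e x)"
    using eq u eL Lu by (intro integral_cong_AE) (auto simp: L1_periodic_def)
  then have e0: "circ_int e = 0"
    using u Lu eL by (simp add: L1_periodic_integrable)
  define C where "C = A * decay_const lam D"
  have C: "C \<ge> 0" using A decay_const_pos by (simp add: C_def)
  have en: "L1_norm ((L ^^ n) e) \<le> C * \<theta> ^ n" "L1_norm ((L ^^ n) e) \<le> \<eta>" for n
  proof -
    show "L1_norm ((L ^^ n) e) \<le> C * \<theta> ^ n"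
      using iterate_zero_mean[OF e e0 A] unfolding C_def by (intro circ_int_abs_bound iterate_L1 eL)
    show "L1_norm ((L ^^ n) e) \<le> \<eta>"
      using iterate_norm[OF eL, of n] circ_int_abs_bound[OF eL \<eta>] by linarith
  qed
  \<comment> \<open>The equation for \<open>u\<close> holds only almost everywhere, whereas
    \<open>L\<close> acts on actual functions. The discrepancy \<open>z\<close> is carried along;
    its iterates keep \<open>L^1\<close> norm 0.\<close>
  define z where "z x = u x - (L u x + e x)" for x
  have zL: "z \<in> L1_periodic"
    unfolding z_def using L1_periodic_diff[OF u(1) L1_periodic_lin[OF Lu(1) eL, of 1 1]] by simp
  have "AE x in lebesgue_on {0..1}. \<bar>z x\<bar> = 0"
    using eq by (auto simp: z_def)
  then have "L1_norm z = circ_int (\<lambda>_. 0)"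
    using L1_periodic_abs[OF zL] by (intro integral_cong_AE) (auto simp: L1_periodic_def)
  then have z0: "L1_norm ((L ^^ n) z) \<le> 0" for n
    using iterate_norm[OF zL, of n] by simp
  have step: "L1_norm ((L ^^ n) u) \<le> L1_norm ((L ^^ Suc n) u) + L1_norm ((L ^^ n) e)" for n
  proof -
    have "(L ^^ n) z = (\<lambda>x. (L ^^ n) u x - ((L ^^ Suc n) u x + (L ^^ n) e x))"
      using iterate_lin[of n 1 "L u" 1 e]
      unfolding z_def by (simp only: iterate_diff funpow_Suc_right o_def) simp
    then have "L1_norm ((L ^^ n) u) =
        L1_norm (\<lambda>x. (L ^^ n) z x + ((L ^^ Suc n) u x + (L ^^ n) e x))" by simp
    also have "\<dots> \<le> L1_norm ((L ^^ n) z) + L1_norm (\<lambda>x. (L ^^ Suc n) u x + (L ^^ n) e x)"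
      using L1_periodic_lin[OF iterate_L1[OF u(1), of "Suc n"] iterate_L1[OF eL, of n], of 1 1]
      by (intro circ_int_triangle iterate_L1 zL) simp
    also have "\<dots> \<le> 0 + (L1_norm ((L ^^ Suc n) u) + L1_norm ((L ^^ n) e))"
      by (intro add_mono z0 circ_int_triangle iterate_L1 u eL)
    finally show ?thesis by simp
  qed
  \<comment> \<open>Partial sums of the Neumann series with remainder \<open>L^n u\<close>.\<close>
  have "L1_norm u \<le> L1_norm ((L ^^ n) u) + (\<Sum>j<n. L1_norm ((L ^^ j) e))" for n
  proof (induction n)
    case (Suc n)
    then show ?case using step[of n] by simp
  qed simp
  moreover have "(\<Sum>j<n. L1_norm ((L ^^ j) e)) \<le> real N * \<eta> + C * \<theta> ^ N / (1 - \<theta>)" if "n \<ge> N" for n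
  proof -
    \<comment> \<open>Cut at \<open>N\<close>: the plain bound \<eta> for the head, the geometric
      bound for the tail.\<close>
    have "(\<Sum>j<n. L1_norm ((L ^^ j) e)) =
       (\<Sum>j<N. L1_norm ((L ^^ j) e)) + (\<Sum>j=N..<n. L1_norm ((L ^^ j) e))"
      using that by (simp add: lessThan_atLeast0 sum.atLeastLessThan_concat)
    also have "\<dots> \<le> (\<Sum>j<N. \<eta>) + (\<Sum>j=N..<n. C * \<theta> ^ j)"
      by (intro add_mono sum_mono en)
    also have "(\<Sum>j=N..<n. C * \<theta> ^ j) = C * (\<theta> ^ N - \<theta> ^ n) / (1 - \<theta>)"
      using that
    proof (induction n rule: dec_induct)
      case (step n)
      then have "(\<Sum>j=N..<Suc n. C * \<theta> ^ j) = C * (\<theta> ^ N - \<theta> ^ n) / (1 - \<theta>) + C * \<theta> ^ n" by simp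
      then show ?case using decay_less_1 by (simp add: divide_simps) (simp add: algebra_simps)
    qed simp
    also have "\<dots> \<le> C * \<theta> ^ N / (1 - \<theta>)"
      using C decay_pos decay_less_1 by (intro divide_right_mono mult_left_mono) auto
    finally show ?thesis by simp
  qed
  ultimately have bound: "L1_norm u \<le> L1_norm ((L ^^ n) u) + (real N * \<eta> + C * \<theta> ^ N / (1 - \<theta>))"
    if "n \<ge> N" for n using that by (meson add_left_mono order_trans)
  have "(\<lambda>n. L1_norm ((L ^^ n) u) + (real N * \<eta> + C * \<theta> ^ N / (1 - \<theta>))) \<longlonglongrightarrow>
      0 + (real N * \<eta> + C * \<theta> ^ N / (1 - \<theta>))"
    by (intro tendsto_intros iterate_L1_tendsto_0 u)
  then have "L1_norm u \<le> 0 + (real N * \<eta> + C * \<theta> ^ N / (1 - \<theta>))"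
    by (rule LIMSEQ_le_const) (use bound in blast)
  then show ?thesis by (simp add: C_def)
qed

end

section \<open>The invariant density and its regularity\<close>

lemma DERIV_uniform_limit:
  fixes f :: "nat \<Rightarrow> real \<Rightarrow> real"
  assumes der: "\<And>n x. (f n has_real_derivative f' n x) (at x)"
    and lim: "\<And>x. (\<lambda>n. f n x) \<longlonglongrightarrow> g x"
    and unif: "uniform_limit UNIV f' g' sequentially"
  shows "(g has_real_derivative g' x) (at x)"
proof -
  have "\<exists>g. \<forall>x\<in>UNIV. (\<lambda>n. f n x) \<longlonglongrightarrow> g x \<and> (g has_derivative (*) (g' x)) (at x within UNIV)"
  proof (rule has_derivative_sequence[where f'="\<lambda>n x. (*) (f' n x)"])
    show "(f n has_derivative (*) (f' n x)) (at x within UNIV)" for n x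
      using der[of n x] by (simp add: has_field_derivative_def)
    fix e :: real assume "e > 0"
    then have "\<forall>\<^sub>F n in sequentially. \<forall>x\<in>UNIV. dist (f' n x) (g' x) < e"
      using unif by (rule uniform_limitD[rotated])
    then show "\<forall>\<^sub>F n in sequentially. \<forall>x\<in>UNIV. \<forall>h. norm (f' n x * h - g' x * h) \<le> e * norm h"
    proof eventually_elim
      case (elim n)
      then show ?case
        by (auto simp: dist_real_def abs_mult less_imp_le intro!: mult_right_mono simp flip: left_diff_distrib)
    qed
  qed (use lim in auto)
  then obtain h where h: "\<And>x. (\<lambda>n. f n x) \<longlonglongrightarrow> h x" "\<And>x. (h has_derivative (*) (g' x)) (at x)"
    by auto
  have "h = g" using h(1) lim LIMSEQ_unique by blast
  then show ?thesis using h(2) by (simp add: has_field_derivative_def)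
qed

lemma uniform_limit_circ_int:
  assumes "\<And>n. f n \<in> L1_periodic" "g \<in> L1_periodic" "uniform_limit UNIV f g sequentially"
  shows "(\<lambda>n. circ_int (f n)) \<longlonglongrightarrow> circ_int g"
proof (rule LIMSEQ_I)
  fix r :: real assume "r > 0"
  then have "\<forall>\<^sub>F n in sequentially. \<forall>x\<in>UNIV. dist (f n x) (g x) < r / 2"
    using assms(3) by (intro uniform_limitD) auto
  then obtain n0 where n0: "\<And>n x. n \<ge> n0 \<Longrightarrow> \<bar>f n x - g x\<bar> < r / 2"
    by (auto simp: eventually_sequentially dist_real_def)
  have "norm (circ_int (f n) - circ_int g) < r" if "n \<ge> n0" for n
  proof -
    have "circ_int (f n) - circ_int g = circ_int (\<lambda>x. f n x - g x)"
      using assms by (simp add: L1_periodic_integrable)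
    then have "norm (circ_int (f n) - circ_int g) \<le> L1_norm (\<lambda>x. f n x - g x)"
      by (simp add: integral_abs_bound)
    also have "\<dots> \<le> r / 2"
      using n0[OF that] assms by (intro circ_int_abs_bound L1_periodic_diff) (auto intro: less_imp_le)
    finally show ?thesis using \<open>r > 0\<close> by simp
  qed
  then show "\<exists>no. \<forall>n\<ge>no. norm (circ_int (f n) - circ_int g) < r" by blast
qed

context expanding_lift
begin

section \<open>Weighted transfer operators, uniform limits and the continuous invariant
  density\<close>

lemma S_uniform:
  assumes "uniform_limit UNIV w v sequentially"
    and c: "\<And>t. \<bar>c t\<bar> \<le> M"
  shows "uniform_limit UNIV (\<lambda>n. S (\<lambda>t. c t * w n t)) (S (\<lambda>t. c t * v t)) sequentially"
proof (rule uniform_limitI)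
  fix e :: real assume "e > 0"
  have M: "M \<ge> 0" using c[of 0] by linarith
  define e' where "e' = e / (real d * (M + 1))"
  have e': "e' > 0" using \<open>e > 0\<close> M d_pos by (simp add: e'_def)
  then have "\<forall>\<^sub>F n in sequentially. \<forall>x\<in>UNIV. dist (w n x) (v x) < e'"
    using assms(1) by (rule uniform_limitD[rotated])
  then show "\<forall>\<^sub>F n in sequentially. \<forall>x\<in>UNIV. dist (S (\<lambda>t. c t * w n t) x) (S (\<lambda>t. c t * v t) x) < e"
  proof eventually_elim
    case (elim n)
    have "\<bar>S (\<lambda>t. c t * w n t) x - S (\<lambda>t. c t * v t) x\<bar> < e" for x
    proof -
      have "\<bar>c t * w n t - c t * v t\<bar> \<le> M * e'" for t
        using c[of t] elim M by (auto simp: dist_real_def abs_mult less_imp_le intro!: mult_mono simp flip: right_diff_distrib)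
      then have "\<bar>S (\<lambda>t. c t * w n t - c t * v t) x\<bar> \<le> real d * (M * e')" by (rule S_bound)
      also have "\<dots> < real d * ((M + 1) * e')" using d_pos e' by simp
      also have "\<dots> = e" using d_pos M by (simp add: e'_def)
      finally show ?thesis using S_lin[of 1 "\<lambda>t. c t * w n t" "-1" "\<lambda>t. c t * v t" x] by simp
    qed
    then show ?case by (simp add: dist_real_def)
  qed
qed

lemma weight_bound: "\<bar>(1 / deriv F t) ^ q\<bar> \<le> 1"
  using F'_gt_1[of t] by (simp add: power_le_one)

lemma weight_Ck: "F \<in> Ck (Suc k) \<Longrightarrow> (\<lambda>t. (1 / deriv F t) ^ q) \<in> Ck k"
  by (intro Ck_power Ck_inverse Ck_Suc_deriv(2) F'_neq_0)

lemma weight_periodic: "periodic (\<lambda>t. (1 / deriv F t) ^ q)"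
  using F'_periodic by (auto simp: periodic_def)

text \<open>\<open>W 1\<close> is \<open>L\<close>. Each differentiation raises the exponent by one,
  up to lower-order terms.\<close>

definition W :: "nat \<Rightarrow> (real \<Rightarrow> real) \<Rightarrow> real \<Rightarrow> real" where
  "W p w = S (\<lambda>t. (1 / deriv F t) ^ p * w t)"

lemma W_uniform:
  "uniform_limit UNIV w v sequentially \<Longrightarrow> uniform_limit UNIV (\<lambda>n. W p (w n)) (W p v) sequentially"
  unfolding W_def by (rule S_uniform[OF _ weight_bound])

lemma W_periodic: "periodic w \<Longrightarrow> periodic (W p w)"
  unfolding W_def using weight_periodic[of p] by (intro S_periodic) (simp add: periodic_def)

lemma W_Ck: "F \<in> Ck (Suc k) \<Longrightarrow> w \<in> Ck k \<Longrightarrow> W p w \<in> Ck k"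
  unfolding W_def by (intro S_Ck Ck_mult weight_Ck) (auto dest: Ck_antimono_Suc)

lemma W_diff: "W p (\<lambda>t. v t - w t) x = W p v x - W p w x"
  using S_lin[of 1 "\<lambda>t. (1 / deriv F t) ^ p * v t" "-1" "\<lambda>t. (1 / deriv F t) ^ p * w t" x]
  by (simp add: W_def right_diff_distrib)

lemma iterate_one_cone: "(L ^^ n) (\<lambda>_. 1) \<in> density_cone a"
  by (induction n) (auto intro: one_cone L_in_cone)

text \<open>Coupling \<open>L^m 1\<close> with 1 shows that the iterates of 1 are uniformly Cauchy;
  positivity survives the limit thanks to the common lower bound \<open>exp (- a)\<close>. The
  uniform convergence is part of the conclusion because the differentiability of the limit is later
  read off from these iterates.\<close>

lemma continuous_invariant_density:
  obtains \<rho> where "continuous_on UNIV \<rho>" "periodic \<rho>" "\<And>x. \<rho> x > 0" "L \<rho> = \<rho>" "circ_int \<rho> = 1"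
    "uniform_limit UNIV (\<lambda>n. (L ^^ n) (\<lambda>_. 1)) \<rho> sequentially"
proof -
  let ?f = "\<lambda>n. (L ^^ n) (\<lambda>_. 1 :: real)"
  have f: "?f n \<in> Ck 1" "periodic (?f n)" "circ_int (?f n) = 1" for n
    using iterate_one_cone[of n] by (auto simp: density_cone_def)
  have diff: "\<bar>?f (n + m) x - ?f n x\<bar> \<le> exp a * \<theta> ^ n" for n m x
  proof -
    obtain g h where gh: "g \<in> density_cone a" "h \<in> density_cone a"
      and eq: "\<And>x. (L ^^ n) (?f m) x - ?f n x = \<theta> ^ n * (g x - h x)"
      using coupling[OF iterate_one_cone[of m] one_cone, of n] by blast
    have "\<bar>?f (n + m) x - ?f n x\<bar> = \<theta> ^ n * \<bar>g x - h x\<bar>"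
      using eq[of x] decay_pos by (simp add: funpow_add abs_mult)
    also have "\<dots> \<le> \<theta> ^ n * exp a"
      using cone_diff_bound[OF gh, of x] decay_pos by (intro mult_left_mono) auto
    finally show ?thesis by (simp add: mult.commute)
  qed
  have "uniformly_Cauchy_on UNIV ?f"
  proof (rule uniformly_Cauchy_onI')
    fix e :: real assume e: "e > 0"
    have "(\<lambda>n. exp a * \<theta> ^ n) \<longlonglongrightarrow> exp a * 0"
      using decay_pos decay_less_1 by (intro tendsto_intros LIMSEQ_realpow_zero) auto
    then have "\<forall>\<^sub>F n in sequentially. exp a * \<theta> ^ n < e"
      by (rule order_tendstoD(2)) (use e in auto)
    then obtain n0 where n0: "\<And>n. n \<ge> n0 \<Longrightarrow> exp a * \<theta> ^ n < e" by (auto simp: eventually_sequentially)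
    have "dist (?f m x) (?f n x) < e" if "n0 \<le> m" "m < n" for m n x
      using diff[where n=m and m="n - m" and x=x] n0[OF that(1)] that
      by (simp add: dist_real_def abs_minus_commute)
    then show "\<exists>M. \<forall>x\<in>UNIV. \<forall>m\<ge>M. \<forall>n>m. dist (?f m x) (?f n x) < e" by blast
  qed
  then obtain \<rho> where \<rho>: "uniform_limit UNIV ?f \<rho> sequentially"
    using Cauchy_uniformly_convergent uniformly_convergent_on_def by metis
  have pw: "(\<lambda>n. ?f n x) \<longlonglongrightarrow> \<rho> x" for x
    using tendsto_uniform_limitI[OF \<rho>, of x] by simp
  have cont: "continuous_on UNIV \<rho>"
    by (rule uniform_limit_theorem[OF _ \<rho>]) (intro always_eventually allI Ck_continuous[OF f(1)], simp)
  have per: "periodic \<rho>"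
    unfolding periodic_def
  proof
    fix t
    have "(\<lambda>n. ?f n (t + 1)) \<longlonglongrightarrow> \<rho> t" using pw[of t] periodicD[OF f(2)] by simp
    then show "\<rho> (t + 1) = \<rho> t" using pw[of "t + 1"] LIMSEQ_unique by blast
  qed
  have pos: "\<rho> x > 0" for x
  proof -
    have "exp (- a) \<le> \<rho> x"
      by (rule LIMSEQ_le_const[OF pw]) (use cone_bounds[OF iterate_one_cone] a_pos in auto)
    then show ?thesis using exp_gt_zero[of "- a"] by linarith
  qed
  have "uniform_limit UNIV (\<lambda>n. ?f (Suc n)) (L \<rho>) sequentially"
    using W_uniform[OF \<rho>, of 1] by (simp add: L_def[abs_def] W_def)
  then have "(\<lambda>n. ?f (Suc n) x) \<longlonglongrightarrow> L \<rho> x" for x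
    using tendsto_uniform_limitI by fastforce
  then have "L \<rho> = \<rho>" using LIMSEQ_unique LIMSEQ_Suc[OF pw] by blast
  moreover have "circ_int \<rho> = 1"
    using uniform_limit_circ_int[OF Ck_L1_periodic[OF f(1,2)] continuous_L1_periodic[OF cont per] \<rho>] f(3)
    by (simp add: LIMSEQ_const_iff)
  ultimately show ?thesis using that cont per pos \<rho> by blast
qed

text \<open>The weight \<open>\<rho>\<close> is essential: these operators need not contract the plain supremum norm.\<close>

lemma W_contract:
  assumes \<rho>: "L \<rho> = \<rho>" "\<And>x. \<rho> x > 0" and w: "\<And>x. \<bar>w x\<bar> \<le> K * \<rho> x" and p: "p \<ge> 2" and K: "K \<ge> 0"
  shows "\<bar>W p w x\<bar> \<le> K / lam * \<rho> x"
proof -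
  have "\<bar>(1 / deriv F t) ^ p * w t\<bar> \<le> K / lam * (\<rho> t / deriv F t)" for t
  proof -
    \<comment> \<open>One factor \<open>1 / F'\<close> is kept, so that summation reproduces
      \<open>L \<rho> = \<rho>\<close>; a second one supplies \<open>1 / lam\<close>.\<close>
    have "(1 / deriv F t) ^ p \<le> (1 / deriv F t)\<^sup>2"
      using F'_gt_1[of t] p by (intro power_decreasing) auto
    also have "\<dots> \<le> 1 / lam * (1 / deriv F t)"
      unfolding power2_eq_square
      using F'_ge[of t] lam F'_pos[of t] by (intro mult_right_mono divide_left_mono) auto
    finally have "\<bar>(1 / deriv F t) ^ p\<bar> * \<bar>w t\<bar> \<le> 1 / lam * (1 / deriv F t) * (K * \<rho> t)"
      using w[of t] lam F'_pos[of t] by (intro mult_mono) auto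
    then show ?thesis by (simp add: abs_mult mult_ac)
  qed
  then have "\<bar>W p w x\<bar> \<le> S (\<lambda>t. K / lam * (\<rho> t / deriv F t)) x"
    unfolding W_def by (intro order_trans[OF S_abs] S_mono)
  also have "\<dots> = K / lam * L \<rho> x"
    using S_lin[of "K / lam" "\<lambda>t. \<rho> t / deriv F t" 0 "\<lambda>_. 0" x] by (simp add: L_def)
  finally show ?thesis by (simp add: \<rho>)
qed

text \<open>In the norm weighted by \<rho>, the eventual oscillation \<open>K\<close> of the
  sequence improves to \<open>\<mu> * K + e\<close> for every \<open>e > 0\<close>, because the
  oscillation of \<open>r\<close> tends to 0. Once finite, it must vanish.\<close>

lemma contracting_recursion_converges:
  assumes \<rho>: "continuous_on UNIV \<rho>" "periodic \<rho>" "\<And>x. \<rho> x > 0" "L \<rho> = \<rho>" and p: "p \<ge> 2"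
    and v: "\<And>n. continuous_on UNIV (v n)" "\<And>n. periodic (v n)"
    and rec: "\<And>n x. v (Suc n) x = W p (v n) x + r n x"
    and r: "uniformly_convergent_on UNIV r"
  shows "uniformly_convergent_on UNIV v"
proof -
  define \<mu> where "\<mu> = 1 / lam"
  have \<mu>: "0 < \<mu>" "\<mu> < 1" using lam by (auto simp: \<mu>_def)
  obtain m where m: "m > 0" "\<And>x. m \<le> \<rho> x"
  proof -
    have nz: "\<rho> x \<noteq> 0" for x using \<rho>(3)[of x] by simp
    have "periodic (\<lambda>x. 1 / \<rho> x)" using \<rho>(2) by (simp add: periodic_def)
    moreover have "continuous_on UNIV (\<lambda>x. 1 / \<rho> x)"
      by (intro continuous_on_divide continuous_on_const \<rho>(1) ballI nz)
    ultimately obtain M where M: "M > 0" "\<And>x. \<bar>1 / \<rho> x\<bar> \<le> M"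
      using periodic_bounded by blast
    have "1 / M \<le> \<rho> x" for x
    proof -
      have "1 / \<rho> x \<le> M" using M(2)[of x] by linarith
      then have "1 \<le> M * \<rho> x" using \<rho>(3)[of x] by (simp add: pos_divide_le_eq)
      then show ?thesis using M(1) by (simp add: pos_divide_le_eq mult.commute)
    qed
    then show ?thesis using that[of "1 / M"] M(1) by simp
  qed
  have scale: "\<bar>y\<bar> \<le> K / m * \<rho> x" if "\<bar>y\<bar> \<le> K" for y K x
  proof -
    have "K \<ge> 0" using that by linarith
    then have "K * m \<le> K * \<rho> x" using m by (intro mult_left_mono) auto
    then have "K \<le> K / m * \<rho> x" using m by (simp add: field_simps)
    then show ?thesis using that by linarith
  qed
  have S_diff: "v (Suc i) x - v (Suc j) x = W p (\<lambda>t. v i t - v j t) x + (r i x - r j x)" for i j x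
    by (simp add: rec W_diff)
  have r_Cauchy: "uniformly_Cauchy_on UNIV r" using r by (rule uniformly_convergent_Cauchy)
  \<comment> \<open>\<open>K\<close> bounds the oscillation of some tail of \<open>v\<close>,
    measured against \<rho>.\<close>
  define good where "good K \<longleftrightarrow> (\<exists>N. \<forall>i\<ge>N. \<forall>j\<ge>N. \<forall>x. \<bar>v i x - v j x\<bar> \<le> K * \<rho> x)" for K
  have step: "good (\<mu> * K + e)" if "good K" and K0: "K \<ge> 0" and e0: "e > 0" for K e
  proof -
    obtain N where N: "\<And>i j x. i \<ge> N \<Longrightarrow> j \<ge> N \<Longrightarrow> \<bar>v i x - v j x\<bar> \<le> K * \<rho> x"
      using \<open>good K\<close> unfolding good_def by blast
    obtain N' where N': "\<And>i j x. i \<ge> N' \<Longrightarrow> j \<ge> N' \<Longrightarrow> \<bar>r i x - r j x\<bar> < e * m"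
      using r_Cauchy \<open>e > 0\<close> m unfolding uniformly_Cauchy_on_def dist_real_def
      by (metis UNIV_I mult_pos_pos)
    have "\<bar>v i x - v j x\<bar> \<le> (\<mu> * K + e) * \<rho> x" if ij: "i \<ge> Suc (max N N')" "j \<ge> Suc (max N N')" for i j x
    proof -
      obtain i' j' where [simp]: "i = Suc i'" "j = Suc j'" using ij by (metis Suc_le_D)
      have "\<bar>W p (\<lambda>t. v i' t - v j' t) x\<bar> \<le> K / lam * \<rho> x"
        using N ij by (intro W_contract \<rho> p \<open>K \<ge> 0\<close>) auto
      moreover have "\<bar>r i' x - r j' x\<bar> \<le> e * m / m * \<rho> x"
        using N'[of i' j' x] ij by (intro scale) auto
      ultimately show ?thesis using m S_diff[of i' x j'] by (simp add: \<mu>_def algebra_simps)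
    qed
    then show ?thesis unfolding good_def by blast
  qed
  have start: "\<exists>K\<ge>0. good K"
  proof -
    obtain N where N: "\<And>i j x. i \<ge> N \<Longrightarrow> j \<ge> N \<Longrightarrow> \<bar>r i x - r j x\<bar> < 1"
      using r_Cauchy unfolding uniformly_Cauchy_on_def dist_real_def by (metis UNIV_I zero_less_one)
    have rN: "r n = (\<lambda>x. v (Suc n) x - W p (v n) x)" for n
      by (auto simp: rec)
    have "r N \<in> Ck 0"
      unfolding rN using v(1) F_C2 by (intro Ck_diff W_Ck) (auto simp: Ck_0 intro: Ck_antimono)
    moreover have "periodic (r N)"
      unfolding rN using v(2)[of "Suc N"] W_periodic[OF v(2)[of N], of p] by (simp add: periodic_def)
    ultimately obtain B where B: "B > 0" "\<And>x. \<bar>r N x\<bar> \<le> B"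
      using periodic_bounded[of "r N"] by (auto simp: Ck_0)
    have rB: "\<bar>r n x\<bar> \<le> (B + 1) / m * \<rho> x" if "n \<ge> N" for n x
      using N[of n N x] B(2)[of x] that by (intro scale) linarith
    obtain A where A: "A > 0" "\<And>x. \<bar>v N x\<bar> \<le> A" using periodic_bounded[OF v(2,1)] by blast
    \<comment> \<open>The second entry makes the ball of radius \<open>K\<close> invariant:
      \<open>\<mu> * K\<close> plus the bound on \<open>r\<close> does not exceed \<open>K\<close>.
      The first one places \<open>v N\<close> in that ball.\<close>
    define K where "K = max (A / m) ((B + 1) / m / (1 - \<mu>))"
    have K: "K \<ge> 0" "(B + 1) / m \<le> (1 - \<mu>) * K"
    proof -
      show "K \<ge> 0" using A m by (simp add: K_def max.coboundedI1)
      have "(B + 1) / m / (1 - \<mu>) \<le> K" by (simp add: K_def)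
      then have "(B + 1) / m \<le> K * (1 - \<mu>)" using \<mu> by (subst (asm) pos_divide_le_eq) auto
      then show "(B + 1) / m \<le> (1 - \<mu>) * K" by (simp only: mult.commute)
    qed
    have vK: "\<bar>v (N + n) x\<bar> \<le> K * \<rho> x" for n x
    proof (induction n arbitrary: x)
      case 0
      have "A / m * \<rho> x \<le> K * \<rho> x" using \<rho>(3)[of x] by (intro mult_right_mono) (auto simp: K_def)
      then show ?case using scale[OF A(2), of x x] by simp
    next
      case (Suc n)
      have "\<bar>W p (v (N + n)) x\<bar> \<le> K / lam * \<rho> x"
        by (intro W_contract \<rho> p Suc K)
      moreover have "\<bar>r (N + n) x\<bar> \<le> (1 - \<mu>) * K * \<rho> x"
        using rB[of "N + n" x] mult_right_mono[OF K(2), of "\<rho> x"] \<rho>(3)[of x] by simp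
      ultimately have "\<bar>v (Suc (N + n)) x\<bar> \<le> K / lam * \<rho> x + (1 - \<mu>) * K * \<rho> x"
        unfolding rec by linarith
      then show ?case by (simp add: \<mu>_def algebra_simps)
    qed
    have "\<bar>v i x - v j x\<bar> \<le> (2 * K) * \<rho> x" if "i \<ge> N" "j \<ge> N" for i j x
      using vK[of "i - N" x] vK[of "j - N" x] that by simp
    then have "good (2 * K)" unfolding good_def by blast
    then show ?thesis using K(1) by (intro exI[of _ "2 * K"]) auto
  qed
  obtain M where M: "M > 0" "\<And>x. \<bar>\<rho> x\<bar> \<le> M" using periodic_bounded[OF \<rho>(2,1)] by blast
  have "uniformly_Cauchy_on UNIV v"
  proof (rule uniformly_Cauchy_onI)
    fix e :: real assume "e > 0"
    \<comment> \<open>Then \<open>e' / (1 - \<mu>)\<close>, the fixed point of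
      \<open>K \<mapsto> \<mu> * K + e'\<close>, is half of the target \<open>e / M\<close>, where
      \<open>M\<close> bounds \<rho>.\<close>
    define e' where "e' = e / (2 * M) * (1 - \<mu>)"
    have e': "e' > 0" using \<open>e > 0\<close> M \<mu> by (simp add: e'_def)
    obtain K where K: "K \<ge> 0" "good K" using start by blast
    have it: "good (\<mu> ^ n * K + e' / (1 - \<mu>))" for n
    proof (induction n)
      case 0
      have "K * \<rho> x \<le> (K + e' / (1 - \<mu>)) * \<rho> x" for x
        using e' \<mu> \<rho>(3)[of x] by (intro mult_right_mono) auto
      then show ?case using K(2) unfolding good_def by simp (meson order_trans)
    next
      case (Suc n)
      have "good (\<mu> * (\<mu> ^ n * K + e' / (1 - \<mu>)) + e')"
        using Suc K \<mu> e' by (intro step) auto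
      moreover have "\<mu> * (\<mu> ^ n * K + e' / (1 - \<mu>)) + e' = \<mu> ^ Suc n * K + e' / (1 - \<mu>)"
        using \<mu> by (simp add: divide_simps) (simp add: algebra_simps)
      ultimately show ?case by simp
    qed
    have "(\<lambda>n. \<mu> ^ n * K + e' / (1 - \<mu>)) \<longlonglongrightarrow> 0 * K + e' / (1 - \<mu>)"
      using \<mu> by (intro tendsto_intros LIMSEQ_realpow_zero) auto
    moreover have "0 * K + e' / (1 - \<mu>) < e / M"
      using \<mu> M \<open>e > 0\<close> by (simp add: e'_def divide_strict_left_mono)
    ultimately have "\<forall>\<^sub>F n in sequentially. \<mu> ^ n * K + e' / (1 - \<mu>) < e / M"
      by (rule order_tendstoD(2))
    then obtain n where n: "\<mu> ^ n * K + e' / (1 - \<mu>) < e / M" by (auto simp: eventually_sequentially)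
    obtain N where N: "\<And>i j x. i \<ge> N \<Longrightarrow> j \<ge> N \<Longrightarrow> \<bar>v i x - v j x\<bar> \<le> (\<mu> ^ n * K + e' / (1 - \<mu>)) * \<rho> x"
      using it[of n] unfolding good_def by blast
    have "dist (v i x) (v j x) < e" if "i \<ge> N" "j \<ge> N" for i j x
    proof -
      have "\<bar>v i x - v j x\<bar> \<le> (\<mu> ^ n * K + e' / (1 - \<mu>)) * \<rho> x" by (rule N[OF that])
      also have "\<dots> < e / M * \<rho> x" using n \<rho>(3)[of x] by (intro mult_strict_right_mono)
      also have "\<dots> \<le> e / M * M" using M(1) order_trans[OF abs_ge_self M(2)[of x]] \<open>e > 0\<close> by (intro mult_left_mono) auto
      finally show ?thesis using M by (simp add: dist_real_def)
    qed
    then show "\<exists>N. \<forall>x\<in>UNIV. \<forall>i\<ge>N. \<forall>j\<ge>N. dist (v i x) (v j x) < e" by blast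
  qed
  then show ?thesis by (rule Cauchy_uniformly_convergent)
qed

end

section \<open>Bootstrapping the regularity of the invariant density\<close>

lemma uniform_limit_add_const:
  fixes f :: "nat \<Rightarrow> 'a \<Rightarrow> real"
  assumes "uniform_limit UNIV f g sequentially"
  shows "uniform_limit UNIV (\<lambda>n x. f n x + b x) (\<lambda>x. g x + b x) sequentially"
  by (intro uniform_limit_intros assms)

context expanding_lift
begin

text \<open>Coefficient of the undifferentiated \<open>w\<close> in the derivative of
  \<open>W q w\<close>.\<close>

definition dW :: "nat \<Rightarrow> real \<Rightarrow> real" where
  "dW q t = deriv (\<lambda>t. (1 / deriv F t) ^ q) t / deriv F t"

lemma F_C2': "F \<in> Ck (Suc (Suc 0))"
  using F_C2 by (simp add: numeral_2_eq_2)

lemma dW_Ck: "F \<in> Ck (Suc (Suc k)) \<Longrightarrow> dW q \<in> Ck k"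
  unfolding dW_def[abs_def]
  by (intro Ck_divide Ck_Suc_deriv(2)[of F] F'_neq_0 Ck_Suc_deriv(2)[OF weight_Ck])
     (auto dest: Ck_antimono_Suc)

lemma dW_periodic: "periodic (dW q)"
  unfolding dW_def[abs_def]
  using periodic_deriv[OF weight_periodic[of q]] F'_periodic by (simp add: periodic_def)

lemma W_deriv:
  assumes "w \<in> Ck 1"
  shows "(W q w has_real_derivative W (Suc q) (deriv w) x + S (\<lambda>t. dW q t * w t) x) (at x)"
proof -
  have c: "(\<lambda>t. (1 / deriv F t) ^ q) \<in> Ck 1"
    using weight_Ck[OF F_C2'] by simp
  have eq: "deriv (\<lambda>t. (1 / deriv F t) ^ q * w t) =
      (\<lambda>t. (1 / deriv F t) ^ q * deriv w t + deriv (\<lambda>t. (1 / deriv F t) ^ q) t * w t)"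
    by (intro ext DERIV_imp_deriv DERIV_cong[OF DERIV_mult[OF Ck_DERIV[OF c] Ck_DERIV[OF assms]]]) simp_all
  have "(\<lambda>t. ((1 / deriv F t) ^ q * deriv w t + deriv (\<lambda>t. (1 / deriv F t) ^ q) t * w t) / deriv F t) =
      (\<lambda>t. 1 * ((1 / deriv F t) ^ Suc q * deriv w t) + 1 * (dW q t * w t))"
    by (auto simp: dW_def add_divide_distrib)
  then show ?thesis
    using S_deriv[OF Ck_mult[OF c assms], of x] S_lin[of 1 "\<lambda>t. (1 / deriv F t) ^ Suc q * deriv w t" 1 "\<lambda>t. dW q t * w t" x]
    unfolding eq W_def by simp
qed

text \<open>The derivatives of the \<open>u n\<close> obey a recursion with weight
  \<open>W (Suc q)\<close>, which contracts even for \<open>q = 1\<close>. So they converge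
  uniformly, and the limit equation for \<open>deriv v\<close> has the same shape with the
  lower-order term as inhomogeneity.\<close>

lemma C1_bootstrap:
  assumes \<rho>: "continuous_on UNIV \<rho>" "periodic \<rho>" "\<And>x. \<rho> x > 0" "L \<rho> = \<rho>" and q: "q \<ge> 1"
    and u: "\<And>n. u n \<in> Ck 1" "\<And>n. periodic (u n)"
    and rec: "\<And>n x. u (Suc n) x = W q (u n) x + b x"
    and b: "b \<in> Ck 1" "periodic b"
    and lim: "uniform_limit UNIV u v sequentially"
  shows "v \<in> Ck 1"
    and "deriv v x = W (Suc q) (deriv v) x + (S (\<lambda>t. dW q t * v t) x + deriv b x)"
proof -
  define r where "r n x = S (\<lambda>t. dW q t * u n t) x + deriv b x" for n x
  obtain M where M: "\<And>t. \<bar>dW q t\<bar> \<le> M"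
    using periodic_bounded[OF dW_periodic Ck_continuous[OF dW_Ck[OF F_C2']]] by blast
  have r_lim: "uniform_limit UNIV r (\<lambda>x. S (\<lambda>t. dW q t * v t) x + deriv b x) sequentially"
    unfolding r_def by (intro uniform_limit_add_const S_uniform[OF lim M])
  have u_eq: "u (Suc n) = (\<lambda>x. W q (u n) x + b x)" for n
    by (rule ext) (rule rec)
  have der: "deriv (u (Suc n)) x = W (Suc q) (deriv (u n)) x + r n x" for n x
  proof -
    have "(u (Suc n) has_real_derivative (W (Suc q) (deriv (u n)) x + S (\<lambda>t. dW q t * u n t) x) + deriv b x) (at x)"
      unfolding u_eq by (intro DERIV_add W_deriv u Ck_DERIV[OF b(1)]) simp
    then show ?thesis by (simp add: r_def DERIV_imp_deriv)
  qed
  have cont: "continuous_on UNIV (deriv (u n))" for n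
    using Ck_continuous[OF Ck_deriv[OF u(1), of 0]] by simp
  have "uniformly_convergent_on UNIV (\<lambda>n. deriv (u n))"
  proof (rule contracting_recursion_converges[OF \<rho>])
    show "Suc q \<ge> 2" using q by simp
    show "deriv (u (Suc n)) x = W (Suc q) (deriv (u n)) x + r n x" for n x by (rule der)
    show "uniformly_convergent_on UNIV r" using r_lim by (auto simp: uniformly_convergent_on_def)
  qed (use cont periodic_deriv[OF u(2)] in auto)
  then obtain v' where v': "uniform_limit UNIV (\<lambda>n. deriv (u n)) v' sequentially"
    by (auto simp: uniformly_convergent_on_def)
  have v'_cont: "continuous_on UNIV v'"
    by (rule uniform_limit_theorem[OF _ v']) (intro always_eventually allI cont, simp)
  have v_der: "(v has_real_derivative v' x) (at x)" for x
    using DERIV_uniform_limit[OF Ck_DERIV[OF u(1)] _ v'] tendsto_uniform_limitI[OF lim] by simp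
  then have dv: "deriv v = v'" by (auto intro: DERIV_imp_deriv)
  show "v \<in> Ck 1"
    unfolding One_nat_def by (rule Ck_SucI[OF v_der]) (simp add: Ck_0 v'_cont)
  have "(\<lambda>n. W (Suc q) (deriv (u n)) x + r n x) \<longlonglongrightarrow> W (Suc q) v' x + (S (\<lambda>t. dW q t * v t) x + deriv b x)"
    using tendsto_uniform_limitI[OF W_uniform[OF v'], of x] tendsto_uniform_limitI[OF r_lim, of x]
    by (intro tendsto_add) auto
  moreover have "(\<lambda>n. deriv (u (Suc n)) x) \<longlonglongrightarrow> v' x"
    using LIMSEQ_Suc[OF tendsto_uniform_limitI[OF v', of x]] by simp
  ultimately show "deriv v x = W (Suc q) (deriv v) x + (S (\<lambda>t. dW q t * v t) x + deriv b x)"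
    unfolding dv der using LIMSEQ_unique by blast
qed

text \<open>The derivative of a solution solves an equation of the same kind with
  \<open>q + 1\<close> in place of \<open>q\<close>, hence the induction on \<open>k\<close> for all
  \<open>q\<close>, \<open>b\<close>, \<open>v\<close> simultaneously.\<close>

lemma contracting_fixed_point_Ck:
  assumes \<rho>: "continuous_on UNIV \<rho>" "periodic \<rho>" "\<And>x. \<rho> x > 0" "L \<rho> = \<rho>"
  shows "q \<ge> 2 \<Longrightarrow> F \<in> Ck (Suc k) \<Longrightarrow> b \<in> Ck k \<Longrightarrow> periodic b \<Longrightarrow> continuous_on UNIV v \<Longrightarrow>
    periodic v \<Longrightarrow> (\<And>x. v x = W q v x + b x) \<Longrightarrow> v \<in> Ck k"
proof (induction k arbitrary: q b v)
  case 0
  show ?case using 0(5) by (simp add: Ck_0)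
next
  case (Suc k)
  \<comment> \<open>Since \<open>v\<close> is only known to be continuous, it cannot be
    differentiated directly; Picard iterates from 0 are \<open>C^1\<close> and converge to it by
    contraction.\<close>
  define u where "u n = ((\<lambda>w x. W q w x + b x) ^^ n) (\<lambda>_. 0)" for n
  have u_Suc: "u (Suc n) = (\<lambda>x. W q (u n) x + b x)" for n by (simp add: u_def)
  have b1: "b \<in> Ck 1" using Ck_antimono[OF Suc.prems(3), of 1] by simp
  have u: "u n \<in> Ck 1 \<and> periodic (u n)" for n
  proof (induction n)
    case 0
    then show ?case by (simp add: u_def periodic_def)
  next
    case (Suc n)
    have "W q (u n) \<in> Ck 1" "periodic (W q (u n))"
      using Suc F_C2' by (auto intro: W_Ck W_periodic)
    then show ?case using b1 \<open>periodic b\<close> unfolding u_Suc by (auto intro: Ck_add simp: periodic_def)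
  qed
  have v_eq: "v = (\<lambda>x. W q v x + b x)" by (rule ext) (rule Suc.prems(7))
  have lim: "uniform_limit UNIV u v sequentially"
  proof -
    obtain M where M: "M > 0" "\<And>x. \<bar>v x\<bar> \<le> M"
      using periodic_bounded[OF Suc.prems(6,5)] by blast
    have "periodic (\<lambda>x. v x / \<rho> x)" using \<rho>(2) Suc.prems(6) by (simp add: periodic_def)
    moreover have "continuous_on UNIV (\<lambda>x. v x / \<rho> x)"
      using \<rho>(3) by (intro continuous_on_divide ballI \<rho>(1) Suc.prems(5)) (metis less_irrefl)
    ultimately obtain K where K: "K > 0" "\<And>x. \<bar>v x / \<rho> x\<bar> \<le> K"
      using periodic_bounded by blast
    obtain R where R: "R > 0" "\<And>x. \<bar>\<rho> x\<bar> \<le> R" using periodic_bounded[OF \<rho>(2,1)] by blast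
    have bound: "\<bar>v x - u n x\<bar> \<le> (K / lam ^ n) * \<rho> x" for n x
    proof (induction n arbitrary: x)
      case 0
      then show ?case using K(2)[of x] \<rho>(3)[of x] by (simp add: u_def abs_divide pos_divide_le_eq)
    next
      case (Suc n)
      have "v x - u (Suc n) x = W q v x - W q (u n) x"
        unfolding u_Suc by (subst v_eq) simp
      also have "\<dots> = W q (\<lambda>t. v t - u n t) x"
        by (simp add: W_diff)
      also have "\<bar>\<dots>\<bar> \<le> (K / lam ^ n) / lam * \<rho> x"
        using Suc K lam \<open>q \<ge> 2\<close> by (intro W_contract \<rho>) auto
      finally show ?case by (simp add: mult.commute)
    qed
    show ?thesis
    proof (rule uniform_limitI)
      fix e :: real assume "e > 0"
      have "(\<lambda>n. K * R * (1 / lam) ^ n) \<longlonglongrightarrow> K * R * 0"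
        using lam by (intro tendsto_intros LIMSEQ_realpow_zero) auto
      then have "\<forall>\<^sub>F n in sequentially. K * R * (1 / lam) ^ n < e"
        by (rule order_tendstoD(2)) (use \<open>e > 0\<close> in auto)
      then show "\<forall>\<^sub>F n in sequentially. \<forall>x\<in>UNIV. dist (u n x) (v x) < e"
      proof eventually_elim
        case (elim n)
        have "dist (u n x) (v x) < e" for x
        proof -
          have "(K / lam ^ n) * \<rho> x \<le> (K / lam ^ n) * R"
            using K lam R(2)[of x] by (intro mult_left_mono) auto
          then show ?thesis using bound[of x n] elim
            by (simp add: dist_real_def abs_minus_commute power_one_over field_simps)
        qed
        then show ?case by blast
      qed
    qed
  qed
  have q1: "q \<ge> 1" using \<open>q \<ge> 2\<close> by simp
  note boot = C1_bootstrap[OF \<rho> q1, of u b v]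
  have v1: "v \<in> Ck 1" and dv: "deriv v x = W (Suc q) (deriv v) x + (S (\<lambda>t. dW q t * v t) x + deriv b x)" for x
    using boot u u_Suc b1 \<open>periodic b\<close> lim by auto
  \<comment> \<open>The induction hypothesis is used twice: here for \<open>v\<close> itself,
    because the inhomogeneity for \<open>deriv v\<close> contains \<open>v\<close>, and below for
    \<open>deriv v\<close>.\<close>
  have vk: "v \<in> Ck k"
    by (rule Suc.IH[of q b v, OF Suc.prems(1) Ck_antimono_Suc[OF Suc.prems(2)]
          Ck_antimono_Suc[OF Suc.prems(3)] Suc.prems(4-7)])
  have Fk: "F \<in> Ck (Suc k)" "F \<in> Ck k"
    using Ck_antimono[OF Suc.prems(2)] by auto
  have "deriv v \<in> Ck k"
  proof (rule Suc.IH[of "Suc q" "\<lambda>x. S (\<lambda>t. dW q t * v t) x + deriv b x"])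
    show "(\<lambda>x. S (\<lambda>t. dW q t * v t) x + deriv b x) \<in> Ck k"
      by (intro Ck_add S_Ck Ck_mult dW_Ck vk Fk Ck_Suc_deriv(2) Suc.prems(2,3))
    have "periodic (S (\<lambda>t. dW q t * v t))"
      using dW_periodic[of q] \<open>periodic v\<close> by (intro S_periodic) (simp add: periodic_def)
    then show "periodic (\<lambda>x. S (\<lambda>t. dW q t * v t) x + deriv b x)"
      using periodic_deriv[OF \<open>periodic b\<close>] by (simp add: periodic_def)
    show "continuous_on UNIV (deriv v)" using Ck_continuous[OF Ck_deriv[OF v1, of 0]] by simp
    show "deriv v x = W (Suc q) (deriv v) x + (S (\<lambda>t. dW q t * v t) x + deriv b x)" for x
      by (rule dv)
  qed (use q1 Fk periodic_deriv[OF \<open>periodic v\<close>] in auto)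
  then show ?case using v1 by (intro Ck_SucI[of v "deriv v"] Ck_DERIV) auto
qed

text \<open>The equation for \<rho> has \<open>q = 1\<close> and is outside the reach of
  \<open>contracting_fixed_point_Ck\<close>. The first derivative is obtained from the iterates of 1
  instead; it satisfies an equation with \<open>q = 2\<close>, from where the contraction takes
  over.\<close>

theorem invariant_density_Ck:
  assumes "F \<in> Ck (Suc k)"
  obtains \<rho> where "\<rho> \<in> Ck k" "periodic \<rho>" "\<And>x. \<rho> x > 0" "L \<rho> = \<rho>" "circ_int \<rho> = 1"
proof -
  obtain \<rho> where \<rho>: "continuous_on UNIV \<rho>" "periodic \<rho>" "\<And>x. \<rho> x > 0" "L \<rho> = \<rho>" "circ_int \<rho> = 1"
    and lim: "uniform_limit UNIV (\<lambda>n. (L ^^ n) (\<lambda>_. 1)) \<rho> sequentially"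
    using continuous_invariant_density by blast
  have LW: "L = W 1" by (auto simp: L_def W_def fun_eq_iff)
  have f: "(L ^^ n) (\<lambda>_. 1) \<in> Ck 1" "periodic ((L ^^ n) (\<lambda>_. 1))" for n
    using iterate_one_cone[of n] by (auto simp: density_cone_def)
  have boot: "\<rho> \<in> Ck 1" "deriv \<rho> x = W (Suc 1) (deriv \<rho>) x + (S (\<lambda>t. dW 1 t * \<rho> t) x + deriv (\<lambda>_. 0) x)" for x
    using C1_bootstrap[OF \<rho>(1-4) order_refl, where b="\<lambda>_. 0" and v=\<rho> and u="\<lambda>n. (L ^^ n) (\<lambda>_. 1)"] f lim
    by (auto simp: LW periodic_def)
  have "\<rho> \<in> Ck k" using assms
  proof (induction k)
    case 0
    then show ?case using \<rho>(1) by (simp add: Ck_0)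
  next
    case (Suc k)
    have \<rho>k: "\<rho> \<in> Ck k" and Fk: "F \<in> Ck k" "F \<in> Ck (Suc k)"
      using Suc.IH Ck_antimono[OF Suc.prems] by auto
    have "deriv \<rho> \<in> Ck k"
    proof (rule contracting_fixed_point_Ck[OF \<rho>(1-4), of "Suc 1"])
      show "S (\<lambda>t. dW 1 t * \<rho> t) \<in> Ck k"
        using Suc.prems by (intro S_Ck Ck_mult dW_Ck \<rho>k Fk)
      show "periodic (S (\<lambda>t. dW 1 t * \<rho> t))"
        using dW_periodic[of 1] \<rho>(2) by (intro S_periodic) (simp add: periodic_def)
      show "continuous_on UNIV (deriv \<rho>)" using Ck_continuous[OF Ck_deriv[OF boot(1), of 0]] by simp
      show "deriv \<rho> x = W (Suc 1) (deriv \<rho>) x + S (\<lambda>t. dW 1 t * \<rho> t) x" for x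
        by (rule trans[OF boot(2)]) simp
    qed (use Fk periodic_deriv[OF \<rho>(2)] in auto)
    then show ?case using boot(1) by (intro Ck_SucI[of \<rho> "deriv \<rho>"] Ck_DERIV) auto
  qed
  then show ?thesis using that \<rho> by blast
qed

end

section \<open>Linear response on the line\<close>

text \<open>In the application \<open>p\<close> is the displacement divided by \<delta>, so it
  varies with \<delta>; only its bound \<open>P\<close> is common. Smallness of
  \<open>\<delta> * P\<close> leaves at least half of \<open>lam - 1\<close> as expansion
  margin.\<close>

locale perturbed_lift = expanding_lift F d lam D
  for F d lam D +
  fixes p :: "real \<Rightarrow> real" and \<delta> P B2 :: real
  assumes p_C2: "p \<in> Ck 2" and p_periodic: "periodic p"
    and p_bound: "\<bar>p t\<bar> \<le> P" "\<bar>deriv p t\<bar> \<le> P" "\<bar>deriv (deriv p) t\<bar> \<le> P"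
    and small: "\<bar>\<delta>\<bar> * P \<le> (lam - 1) / 2"
    and F''_bound: "\<bar>deriv (deriv F) t\<bar> \<le> B2"
begin

definition F1 :: "real \<Rightarrow> real" where "F1 t = F t + \<delta> * p t"

lemma P_nonneg: "P \<ge> 0" using p_bound(1)[of 0] by linarith

lemma B2_nonneg: "B2 \<ge> 0" using F''_bound[of 0] by linarith

lemma deriv_F1: "deriv F1 = (\<lambda>t. deriv F t + \<delta> * deriv p t)"
  unfolding F1_def[abs_def]
  by (intro ext DERIV_imp_deriv DERIV_add F_deriv DERIV_cmult Ck_DERIV[OF p_C2]) simp

lemma deriv_deriv_F1: "deriv (deriv F1) = (\<lambda>t. deriv (deriv F) t + \<delta> * deriv (deriv p) t)"
  unfolding deriv_F1
  by (intro ext DERIV_imp_deriv DERIV_add F'_deriv DERIV_cmult Ck_DERIV[OF Ck_deriv[OF p_C2, of 1]]) simp_all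

lemma scaled_bound: "\<bar>y\<bar> \<le> P \<Longrightarrow> \<bar>\<delta> * y\<bar> \<le> (lam - 1) / 2"
  using mult_left_mono[of "\<bar>y\<bar>" P "\<bar>\<delta>\<bar>"] small by (simp add: abs_mult)

lemma F1'_ge: "(lam + 1) / 2 \<le> deriv F1 t"
proof -
  have "deriv F1 t = deriv F t + \<delta> * deriv p t" by (simp add: deriv_F1)
  moreover have "\<bar>\<delta> * deriv p t\<bar> \<le> (lam - 1) / 2" by (rule scaled_bound[OF p_bound(2)])
  ultimately show ?thesis using F'_ge[of t] by (simp add: field_simps abs_le_iff)
qed

lemma F1''_bound: "\<bar>deriv (deriv F1) t\<bar> \<le> B2 + (lam - 1) / 2"
proof -
  have "deriv (deriv F1) t = deriv (deriv F) t + \<delta> * deriv (deriv p) t" by (simp add: deriv_deriv_F1)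
  moreover have "\<bar>\<delta> * deriv (deriv p) t\<bar> \<le> (lam - 1) / 2" by (rule scaled_bound[OF p_bound(3)])
  ultimately show ?thesis using F''_bound[of t] by linarith
qed

text \<open>Both constants are free of \<open>p\<close> and \<delta>, which makes the decay rate
  uniform along a family.\<close>

sublocale P: expanding_lift F1 d "(lam + 1) / 2" "B2 + (lam - 1) / 2"
proof
  show "F1 \<in> Ck 2" unfolding F1_def[abs_def] by (intro Ck_add Ck_mult F_C2 p_C2 Ck_const)
  show "F1 (t + 1) = F1 t + real d" for t
    using F_shift[of t] periodicD[OF p_periodic, of t] by (simp add: F1_def)
  show "\<bar>deriv (deriv F1) t\<bar> \<le> (B2 + (lam - 1) / 2) * deriv F1 t" for t
  proof -
    have "(B2 + (lam - 1) / 2) * 1 \<le> (B2 + (lam - 1) / 2) * deriv F1 t"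
      using F1'_ge[of t] lam B2_nonneg by (intro mult_left_mono) (auto simp: field_simps)
    with F1''_bound[of t] show ?thesis by (simp only: mult_1_right)
  qed
qed (use d_pos lam F1'_ge in auto)

text \<open>Exact formula for the displaced branch: it is the old branch evaluated at a point
  shifted by \<open>\<delta> * p\<close>, so first-order expansions only involve
  \<open>G\<close>.\<close>

lemma G_perturbed: "P.G x = G (x - \<delta> * p (P.G x))"
proof -
  have "F (P.G x) = x - \<delta> * p (P.G x)" using P.F_G[of x] by (simp add: F1_def)
  then show ?thesis by (metis G_F)
qed

lemma G_diff: "\<bar>P.G x - G x\<bar> \<le> \<bar>\<delta>\<bar> * P"
proof -
  have "\<bar>P.G x - G x\<bar> = \<bar>G (x - \<delta> * p (P.G x)) - G x\<bar>" by (simp flip: G_perturbed)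
  also have "\<dots> \<le> \<bar>\<delta>\<bar> * \<bar>p (P.G x)\<bar>"
    using G_lip[of "x - \<delta> * p (P.G x)" x] by (simp add: abs_mult)
  also have "\<dots> \<le> \<bar>\<delta>\<bar> * P" using p_bound by (intro mult_left_mono) auto
  finally show ?thesis .
qed

text \<open>Two sources of error: \<eta> from changing the summand,
  \<open>M * P * \<bar>\<delta>\<bar>\<close> from displacing the branches.\<close>

lemma S_diff:
  assumes "\<And>t. \<bar>Q1 t - Q0 t\<bar> \<le> \<eta>" and M: "M \<ge> 0" "\<And>s t. \<bar>Q0 s - Q0 t\<bar> \<le> M * \<bar>s - t\<bar>"
  shows "\<bar>P.S Q1 x - S Q0 x\<bar> \<le> real d * (\<eta> + M * P * \<bar>\<delta>\<bar>)"
proof -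
  have "\<bar>Q1 (P.G y) - Q0 (G y)\<bar> \<le> \<eta> + M * P * \<bar>\<delta>\<bar>" for y
  proof -
    have "M * \<bar>P.G y - G y\<bar> \<le> M * (\<bar>\<delta>\<bar> * P)" using M G_diff by (intro mult_left_mono)
    then show ?thesis using assms(1)[of "P.G y"] M(2)[of "P.G y" "G y"] by (simp add: mult_ac)
  qed
  then have "(\<Sum>j<d. \<bar>Q1 (P.G (x + real j)) - Q0 (G (x + real j))\<bar>) \<le> (\<Sum>j<d. \<eta> + M * P * \<bar>\<delta>\<bar>)"
    by (intro sum_mono)
  then show ?thesis
    unfolding P.S_def S_def using sum_abs[of "\<lambda>j. Q1 (P.G (x + real j)) - Q0 (G (x + real j))" "{..<d}"]
    by (simp add: sum_subtractf)
qed

lemma inverse_bounds: "0 < 1 / deriv F t" "1 / deriv F t \<le> 1" "0 < 1 / deriv F1 t" "1 / deriv F1 t \<le> 1"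
  using F'_gt_1[of t] P.F'_gt_1[of t] by auto

lemma inverse_diff_eq: "1 / deriv F1 t - 1 / deriv F t = - (\<delta> * deriv p t * (1 / deriv F1 t) * (1 / deriv F t))"
proof -
  have "deriv F t - deriv F1 t = - (\<delta> * deriv p t)" by (simp add: deriv_F1)
  moreover have "1 / deriv F1 t - 1 / deriv F t = (deriv F t - deriv F1 t) * (1 / deriv F1 t) * (1 / deriv F t)"
    using F'_neq_0[of t] P.F'_neq_0[of t] by (simp add: field_simps)
  ultimately show ?thesis by simp
qed

lemma inverse_diff: "\<bar>1 / deriv F1 t - 1 / deriv F t\<bar> \<le> P * \<bar>\<delta>\<bar>"
proof -
  have "\<bar>1 / deriv F1 t - 1 / deriv F t\<bar> = (\<bar>\<delta>\<bar> * \<bar>deriv p t\<bar>) * (1 / deriv F1 t) * (1 / deriv F t)"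
    unfolding inverse_diff_eq using P.F'_pos[of t] F'_pos[of t] by (simp add: abs_mult)
  also have "\<dots> \<le> (\<bar>\<delta>\<bar> * P) * 1 * 1"
    using inverse_bounds[of t] p_bound(2)[of t] P_nonneg by (intro mult_mono mult_nonneg_nonneg) auto
  finally show ?thesis by (simp add: mult.commute)
qed

lemma L_diff_bound:
  assumes w: "\<And>t. \<bar>w t\<bar> \<le> B" and M: "M \<ge> 0" "\<And>s t. \<bar>w s / deriv F s - w t / deriv F t\<bar> \<le> M * \<bar>s - t\<bar>"
  shows "\<bar>P.L w x - L w x\<bar> \<le> real d * (B * P + M * P) * \<bar>\<delta>\<bar>"
proof -
  have "\<bar>w t / deriv F1 t - w t / deriv F t\<bar> \<le> B * (P * \<bar>\<delta>\<bar>)" for t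
  proof -
    have "w t / deriv F1 t - w t / deriv F t = w t * (1 / deriv F1 t - 1 / deriv F t)"
      by (simp add: right_diff_distrib)
    then show ?thesis using w[of t] inverse_diff[of t] by (simp add: abs_mult mult_mono' del: times_divide_eq_right)
  qed
  from S_diff[OF this M, of x] show ?thesis by (simp add: P.L_def L_def algebra_simps)
qed

lemma power_diff_bound:
  fixes y z :: real
  assumes "0 \<le> y" "y \<le> 1" "0 \<le> z" "z \<le> 1" "\<bar>y - z\<bar> \<le> h"
  shows "\<bar>y ^ n - z ^ n\<bar> \<le> real n * h"
proof (induction n)
  case (Suc n)
  have "y ^ Suc n - z ^ Suc n = y * (y ^ n - z ^ n) + (y - z) * z ^ n" by (simp add: algebra_simps)
  also have "\<bar>\<dots>\<bar> \<le> \<bar>y * (y ^ n - z ^ n)\<bar> + \<bar>(y - z) * z ^ n\<bar>" by (rule abs_triangle_ineq)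
  also have "\<dots> \<le> 1 * (real n * h) + h * 1"
    unfolding abs_mult using Suc assms by (intro add_mono mult_mono) (auto simp: power_le_one)
  finally show ?case by (simp add: algebra_simps)
qed simp

text \<open>Order \<delta> is enough here, as the derivative of the defect only sets the amplitude
  of the decaying tail. \<open>Q0\<close> is the summand in the derivative of \<open>L w\<close>;
  its Lipschitz condition is what will use a third derivative of \<open>F\<close>.\<close>

lemma deriv_L_diff_bound:
  assumes w: "w \<in> Ck 1" "\<And>t. \<bar>w t\<bar> \<le> B" "\<And>t. \<bar>deriv w t\<bar> \<le> B"
    and Q0: "Q0 = (\<lambda>t. (deriv w t / deriv F t - w t * deriv (deriv F) t / (deriv F t)\<^sup>2) / deriv F t)"
    and M: "M \<ge> 0" "\<And>s t. \<bar>Q0 s - Q0 t\<bar> \<le> M * \<bar>s - t\<bar>"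
  shows "\<bar>deriv (P.L w) x - deriv (L w) x\<bar> \<le> real d * (B * (3 + 3 * B2) * P + M * P) * \<bar>\<delta>\<bar>"
proof -
  define Q1 where "Q1 t = (deriv w t / deriv F1 t - w t * deriv (deriv F1) t / (deriv F1 t)\<^sup>2) / deriv F1 t" for t
  have B: "B \<ge> 0" using w(2)[of 0] by linarith
  have "\<bar>Q1 t - Q0 t\<bar> \<le> B * (3 + 3 * B2) * P * \<bar>\<delta>\<bar>" for t
  proof -
    define y z where "y = 1 / deriv F1 t" and "z = 1 / deriv F t"
    have yz: "0 < y" "y \<le> 1" "0 < z" "z \<le> 1" "\<bar>y - z\<bar> \<le> P * \<bar>\<delta>\<bar>"
      using inverse_bounds[of t] inverse_diff[of t] unfolding y_def z_def by blast+
    have pw: "\<bar>y ^ n - z ^ n\<bar> \<le> real n * (P * \<bar>\<delta>\<bar>)" for n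
      using yz by (intro power_diff_bound) auto
    have Q1': "Q1 t = deriv w t * y ^ 2 - w t * (deriv (deriv F1) t * y ^ 3)"
      using P.F'_neq_0[of t] by (simp add: Q1_def y_def field_simps power2_eq_square power3_eq_cube)
    have Q0': "Q0 t = deriv w t * z ^ 2 - w t * (deriv (deriv F) t * z ^ 3)"
      using F'_neq_0[of t] by (simp add: Q0 z_def field_simps power2_eq_square power3_eq_cube)
    have F2: "deriv (deriv F1) t * y ^ 3 - deriv (deriv F) t * z ^ 3 =
        deriv (deriv F) t * (y ^ 3 - z ^ 3) + \<delta> * deriv (deriv p) t * y ^ 3"
      by (simp add: deriv_deriv_F1 algebra_simps)
    have "\<bar>deriv (deriv F1) t * y ^ 3 - deriv (deriv F) t * z ^ 3\<bar> \<le>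
        \<bar>deriv (deriv F) t\<bar> * \<bar>y ^ 3 - z ^ 3\<bar> + \<bar>\<delta>\<bar> * \<bar>deriv (deriv p) t\<bar> * \<bar>y ^ 3\<bar>"
      unfolding F2 abs_mult[symmetric] by (rule abs_triangle_ineq)
    also have "\<dots> \<le> B2 * (3 * (P * \<bar>\<delta>\<bar>)) + \<bar>\<delta>\<bar> * P * 1"
      using pw[of 3] F''_bound[of t] p_bound(3)[of t] yz B2_nonneg P_nonneg
      by (intro add_mono mult_mono) (auto simp: power_le_one)
    finally have F2b: "\<bar>deriv (deriv F1) t * y ^ 3 - deriv (deriv F) t * z ^ 3\<bar> \<le> (3 * B2 + 1) * (P * \<bar>\<delta>\<bar>)"
      by (simp add: algebra_simps)
    have split: "Q1 t - Q0 t = deriv w t * (y ^ 2 - z ^ 2) - w t * (deriv (deriv F1) t * y ^ 3 - deriv (deriv F) t * z ^ 3)"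
      unfolding Q1' Q0' by (simp add: algebra_simps)
    have "\<bar>Q1 t - Q0 t\<bar> \<le> \<bar>deriv w t\<bar> * \<bar>y ^ 2 - z ^ 2\<bar> + \<bar>w t\<bar> * \<bar>deriv (deriv F1) t * y ^ 3 - deriv (deriv F) t * z ^ 3\<bar>"
      unfolding split abs_mult[symmetric] by (rule abs_triangle_ineq4)
    also have "\<dots> \<le> B * (2 * (P * \<bar>\<delta>\<bar>)) + B * ((3 * B2 + 1) * (P * \<bar>\<delta>\<bar>))"
    proof (rule add_mono)
      show "\<bar>deriv w t\<bar> * \<bar>y ^ 2 - z ^ 2\<bar> \<le> B * (2 * (P * \<bar>\<delta>\<bar>))"
        by (rule mult_mono[OF w(3) _ B abs_ge_zero]) (rule pw[of 2, unfolded of_nat_numeral])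
    qed (rule mult_mono[OF w(2) F2b B abs_ge_zero])
    finally show ?thesis by (simp add: algebra_simps)
  qed
  from S_diff[OF this M, of x] show ?thesis
    using DERIV_imp_deriv[OF P.L_deriv[OF w(1), of x]] DERIV_imp_deriv[OF L_deriv[OF w(1), of x]]
    by (simp add: Q1_def[abs_def] Q0 algebra_simps)
qed

text \<open>Since \<open>S (\<epsilon> H) = L (\<epsilon> w)\<close>, this is the expansion \<open>L\<^sub>\<delta> w = L w - \<delta> (L (\<epsilon> w))' + o(\<delta>)\<close>.\<close>

lemma L_expansion:
  assumes w: "\<And>t. \<bar>w t\<bar> \<le> B"
    and H: "H = (\<lambda>t. w t / deriv F t)" "H \<in> Ck 1"
    and close: "\<And>t. \<bar>p t - \<epsilon> t\<bar> \<le> \<eta>" "\<And>t. \<bar>deriv p t - deriv \<epsilon> t\<bar> \<le> \<eta>"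
    and \<epsilon>: "\<epsilon> \<in> Ck 1" "\<And>t. \<bar>deriv \<epsilon> t\<bar> \<le> E" "\<And>s t. \<bar>\<epsilon> s - \<epsilon> t\<bar> \<le> E * \<bar>s - t\<bar>"
    and M1: "M1 \<ge> 0" "\<And>s t. \<bar>deriv \<epsilon> s * H s / deriv F s - deriv \<epsilon> t * H t / deriv F t\<bar> \<le> M1 * \<bar>s - t\<bar>"
    and M2: "M2 \<ge> 0" "\<And>s t. \<bar>deriv H s / deriv F s - deriv H t / deriv F t\<bar> \<le> M2 * \<bar>s - t\<bar>"
    and B3: "\<And>t. \<bar>deriv H t / deriv F t\<bar> \<le> B3"
  shows "\<bar>P.L w x - L w x + \<delta> * deriv (S (\<lambda>t. \<epsilon> t * H t)) x\<bar> \<le>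
    real d * \<bar>\<delta>\<bar> * ((B + B3) * \<eta> + (E * B * P + M1 * P + M2 * P\<^sup>2 + B3 * E * P) * \<bar>\<delta>\<bar>)"
proof -
  have B: "B \<ge> 0" using w[of 0] by linarith
  have E: "E \<ge> 0" using \<epsilon>(2)[of 0] by linarith
  have \<eta>: "\<eta> \<ge> 0" using close(1)[of 0] by linarith
  have B3n: "B3 \<ge> 0" using B3[of 0] by linarith
  define Q1 where "Q1 t = deriv p t * w t * (1 / deriv F1 t) * (1 / deriv F t)" for t
  define Q0 where "Q0 t = deriv \<epsilon> t * H t / deriv F t" for t
  \<comment> \<open>Changing the weight from \<open>1 / F'\<close> to \<open>1 / F1'\<close> along
    the displaced branches produces the term with the derivative of \<epsilon>.\<close>
  have "P.S (\<lambda>t. w t / deriv F1 t) x - P.S H x = P.S (\<lambda>t. 1 * (w t / deriv F1 t) + (- 1) * H t) x"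
    by (subst P.S_lin) simp
  also have "(\<lambda>t. 1 * (w t / deriv F1 t) + (- 1) * H t) = (\<lambda>t. (- \<delta>) * Q1 t + 0 * Q1 t)"
  proof
    fix t
    have "1 * (w t / deriv F1 t) + (- 1) * H t = w t * (1 / deriv F1 t - 1 / deriv F t)"
      by (simp add: H right_diff_distrib)
    then show "1 * (w t / deriv F1 t) + (- 1) * H t = (- \<delta>) * Q1 t + 0 * Q1 t"
      unfolding inverse_diff_eq by (simp add: Q1_def mult_ac)
  qed
  also have "P.S (\<lambda>t. (- \<delta>) * Q1 t + 0 * Q1 t) x = - \<delta> * P.S Q1 x"
    by (subst P.S_lin) simp
  finally have part1: "P.L w x - P.S H x = - \<delta> * P.S Q1 x" by (simp add: P.L_def)
  have "\<bar>Q1 t - Q0 t\<bar> \<le> B * \<eta> + E * B * (P * \<bar>\<delta>\<bar>)" for t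
  proof -
    define y z where "y = 1 / deriv F1 t" and "z = 1 / deriv F t"
    have yz: "0 < y" "y \<le> 1" "0 < z" "z \<le> 1" "\<bar>y - z\<bar> \<le> P * \<bar>\<delta>\<bar>"
      using inverse_bounds[of t] inverse_diff[of t] unfolding y_def z_def by blast+
    have split: "Q1 t - Q0 t = (deriv p t - deriv \<epsilon> t) * w t * (y * z) + deriv \<epsilon> t * w t * ((y - z) * z)"
      unfolding Q1_def Q0_def H y_def[symmetric] z_def[symmetric]
      by (simp add: z_def algebra_simps)
    have "\<bar>Q1 t - Q0 t\<bar> \<le> \<bar>deriv p t - deriv \<epsilon> t\<bar> * \<bar>w t\<bar> * \<bar>y * z\<bar> + \<bar>deriv \<epsilon> t\<bar> * \<bar>w t\<bar> * (\<bar>y - z\<bar> * \<bar>z\<bar>)"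
      unfolding split abs_mult[symmetric] by (rule abs_triangle_ineq)
    also have "\<dots> \<le> \<eta> * B * 1 + E * B * ((P * \<bar>\<delta>\<bar>) * 1)"
      using yz close(2)[of t] w[of t] \<epsilon>(2)[of t] B E \<eta> P_nonneg
      by (intro add_mono mult_mono mult_nonneg_nonneg) (auto simp: mult_le_one)
    finally show ?thesis by (simp add: mult_ac)
  qed
  from S_diff[OF this M1[folded Q0_def], of x]
  have "\<bar>P.S Q1 x - S Q0 x\<bar> \<le> real d * (B * \<eta> + (E * B * P + M1 * P) * \<bar>\<delta>\<bar>)"
    by (simp add: algebra_simps)
  then have b1: "\<bar>\<delta> * (P.S Q1 x - S Q0 x)\<bar> \<le> \<bar>\<delta>\<bar> * (real d * (B * \<eta> + (E * B * P + M1 * P) * \<bar>\<delta>\<bar>))"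
    unfolding abs_mult by (intro mult_left_mono) auto
  \<comment> \<open>Moving the branches with the weight kept produces the other half, \<epsilon>
    times the derivative of \<open>H\<close>. \<open>K'\<close> is the derivative of
    \<open>H \<circ> G\<close>.\<close>
  define K' where "K' y = deriv H (G y) / deriv F (G y)" for y
  have K_der: "((\<lambda>y. H (G y)) has_real_derivative K' y) (at y)" for y
    unfolding K'_def using DERIV_chain2[OF Ck_DERIV[OF H(2)] G_deriv, of y] by simp
  have K'_lip: "\<bar>K' y - K' z\<bar> \<le> M2 * \<bar>y - z\<bar>" for y z
    unfolding K'_def using M2(2)[of "G y" "G z"] mult_left_mono[OF G_lip[of y z] M2(1)] by linarith
  have summand: "\<bar>H (P.G y) - H (G y) + \<delta> * (\<epsilon> (G y) * K' y)\<bar> \<le>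
      \<bar>\<delta>\<bar> * (B3 * \<eta> + (M2 * P\<^sup>2 + B3 * E * P) * \<bar>\<delta>\<bar>)" for y
  proof -
    define h where "h = \<delta> * p (P.G y)"
    have h: "\<bar>h\<bar> \<le> \<bar>\<delta>\<bar> * P" unfolding h_def abs_mult using p_bound by (intro mult_left_mono) auto
    \<comment> \<open>A Lipschitz \<open>K'\<close> already gives a quadratic remainder.\<close>
    have taylor: "\<bar>H (G (y - h)) - H (G y) + h * K' y\<bar> \<le> M2 * \<bar>h\<bar> * \<bar>h\<bar>"
    proof -
      have "norm ((\<lambda>z. H (G z) - K' y * z) (y - h) - (\<lambda>z. H (G z) - K' y * z) y) \<le> M2 * \<bar>h\<bar> * norm (y - h - y)"
      proof (rule field_differentiable_bound[of "cball y \<bar>h\<bar>" _ "\<lambda>z. K' z - K' y"])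
        show "((\<lambda>z. H (G z) - K' y * z) has_field_derivative K' z - K' y) (at z within cball y \<bar>h\<bar>)" for z
          by (rule has_field_derivative_at_within[OF DERIV_diff[OF K_der DERIV_cmult_Id]])
        show "norm (K' z - K' y) \<le> M2 * \<bar>h\<bar>" if "z \<in> cball y \<bar>h\<bar>" for z
          using K'_lip[of z y] that mult_left_mono[of "\<bar>z - y\<bar>" "\<bar>h\<bar>" M2] M2(1)
          by (simp add: dist_real_def abs_minus_commute)
      qed (auto simp: dist_real_def)
      then show ?thesis by (simp add: algebra_simps)
    qed
    have "M2 * \<bar>h\<bar> * \<bar>h\<bar> \<le> M2 * (\<bar>\<delta>\<bar> * P) * (\<bar>\<delta>\<bar> * P)"
      using h M2(1) P_nonneg by (intro mult_mono mult_nonneg_nonneg) auto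
    then have t1: "\<bar>H (G (y - h)) - H (G y) + h * K' y\<bar> \<le> \<bar>\<delta>\<bar> * (M2 * P\<^sup>2 * \<bar>\<delta>\<bar>)"
      using taylor by (simp add: power2_eq_square mult_ac)
    have "\<bar>p (P.G y) - \<epsilon> (G y)\<bar> \<le> \<eta> + E * (\<bar>\<delta>\<bar> * P)"
      using close(1)[of "P.G y"] \<epsilon>(3)[of "P.G y" "G y"] mult_left_mono[OF G_diff[of y] E] by linarith
    then have "\<bar>\<delta>\<bar> * \<bar>p (P.G y) - \<epsilon> (G y)\<bar> * \<bar>K' y\<bar> \<le> \<bar>\<delta>\<bar> * (\<eta> + E * (\<bar>\<delta>\<bar> * P)) * B3"
      using B3[of "G y"] B3n E \<eta> P_nonneg unfolding K'_def
      by (intro mult_mono mult_nonneg_nonneg add_nonneg_nonneg) auto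
    then have t2: "\<bar>h * K' y - \<delta> * (\<epsilon> (G y) * K' y)\<bar> \<le> \<bar>\<delta>\<bar> * (B3 * \<eta> + B3 * E * P * \<bar>\<delta>\<bar>)"
      unfolding h_def abs_mult[symmetric] by (simp add: algebra_simps)
    have "P.G y = G (y - h)" using G_perturbed[of y] by (simp add: h_def)
    then show ?thesis using t1 t2 by (simp add: algebra_simps)
  qed
  have sums: "P.S H x - S H x + \<delta> * S (\<lambda>t. \<epsilon> t * deriv H t / deriv F t) x =
      (\<Sum>j<d. H (P.G (x + real j)) - H (G (x + real j)) + \<delta> * (\<epsilon> (G (x + real j)) * K' (x + real j)))"
    by (simp add: P.S_def S_def K'_def sum.distrib sum_subtractf sum_distrib_left)
  have "\<bar>P.S H x - S H x + \<delta> * S (\<lambda>t. \<epsilon> t * deriv H t / deriv F t) x\<bar> \<le> (\<Sum>j<d. \<bar>\<delta>\<bar> * (B3 * \<eta> + (M2 * P\<^sup>2 + B3 * E * P) * \<bar>\<delta>\<bar>))"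
    unfolding sums by (intro order_trans[OF sum_abs] sum_mono summand)
  also have "\<dots> = \<bar>\<delta>\<bar> * (real d * (B3 * \<eta> + (M2 * P\<^sup>2 + B3 * E * P) * \<bar>\<delta>\<bar>))"
    by (simp only: sum_constant card_lessThan) (rule mult.left_commute)
  finally have b2: "\<bar>P.S H x - S H x + \<delta> * S (\<lambda>t. \<epsilon> t * deriv H t / deriv F t) x\<bar> \<le>
      \<bar>\<delta>\<bar> * (real d * (B3 * \<eta> + (M2 * P\<^sup>2 + B3 * E * P) * \<bar>\<delta>\<bar>))" .
  \<comment> \<open>The product rule joins the two halves.\<close>
  have "deriv (\<lambda>t. \<epsilon> t * H t) = (\<lambda>t. deriv \<epsilon> t * H t + \<epsilon> t * deriv H t)"
    by (intro ext DERIV_imp_deriv DERIV_cong[OF DERIV_mult[OF Ck_DERIV[OF \<epsilon>(1)] Ck_DERIV[OF H(2)]]]) simp_all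
  then have "deriv (S (\<lambda>t. \<epsilon> t * H t)) x = S (\<lambda>t. 1 * Q0 t + 1 * (\<epsilon> t * deriv H t / deriv F t)) x"
    using DERIV_imp_deriv[OF S_deriv[OF Ck_mult[OF \<epsilon>(1) H(2)], of x]]
    by (simp add: Q0_def add_divide_distrib)
  then have dS: "deriv (S (\<lambda>t. \<epsilon> t * H t)) x = S Q0 x + S (\<lambda>t. \<epsilon> t * deriv H t / deriv F t) x"
    by (simp only: S_lin)
  have "P.L w x - L w x + \<delta> * deriv (S (\<lambda>t. \<epsilon> t * H t)) x =
      - (\<delta> * (P.S Q1 x - S Q0 x)) + (P.S H x - S H x + \<delta> * S (\<lambda>t. \<epsilon> t * deriv H t / deriv F t) x)"
    using part1 unfolding dS by (simp add: L_def H algebra_simps)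
  then have "\<bar>P.L w x - L w x + \<delta> * deriv (S (\<lambda>t. \<epsilon> t * H t)) x\<bar> \<le>
      \<bar>\<delta> * (P.S Q1 x - S Q0 x)\<bar> + \<bar>P.S H x - S H x + \<delta> * S (\<lambda>t. \<epsilon> t * deriv H t / deriv F t) x\<bar>"
    by linarith
  also have "\<dots> \<le> \<bar>\<delta>\<bar> * (real d * (B * \<eta> + (E * B * P + M1 * P) * \<bar>\<delta>\<bar>)) +
      \<bar>\<delta>\<bar> * (real d * (B3 * \<eta> + (M2 * P\<^sup>2 + B3 * E * P) * \<bar>\<delta>\<bar>))"
    by (rule add_mono[OF b1 b2])
  finally show ?thesis by (simp only: algebra_simps)
qed

end

section \<open>The defect of the first-order candidate and the response on the line\<close>

definition close_C2 :: "real \<Rightarrow> (real \<Rightarrow> real) \<Rightarrow> (real \<Rightarrow> real) \<Rightarrow> bool" where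
  "close_C2 \<eta> p q \<longleftrightarrow> (\<forall>t. \<bar>p t - q t\<bar> \<le> \<eta> \<and> \<bar>deriv p t - deriv q t\<bar> \<le> \<eta> \<and>
     \<bar>deriv (deriv p) t - deriv (deriv q) t\<bar> \<le> \<eta>)"

context expanding_lift
begin

text \<open>The operator of the perturbed lift is taken from outside its locale: it depends on the
  lift and on \<open>d\<close> only, so no smallness of \<delta> is needed to state it.\<close>

definition residual :: "real \<Rightarrow> (real \<Rightarrow> real) \<Rightarrow> (real \<Rightarrow> real) \<Rightarrow> real \<Rightarrow> real" where
  "residual \<delta> p R x = expanding_lift.L (\<lambda>t. F t + \<delta> * p t) d R x - R x"

text \<open>The quantifier order is the point: \<open>P\<close>, \<open>B2\<close> and
  \<open>C\<close> are chosen before \<open>p\<close>, \<delta> and \<eta>.\<close>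

lemma perturbation_residual_bounds:
  assumes F: "F \<in> Ck 3"
    and \<rho>0: "\<rho>0 \<in> Ck 2" "periodic \<rho>0" "L \<rho>0 = \<rho>0"
    and \<rho>1: "\<rho>1 \<in> Ck 1" "periodic \<rho>1"
    and \<epsilon>: "\<epsilon> \<in> Ck 2" "periodic \<epsilon>"
    and resp: "\<And>x. deriv (S (\<lambda>t. \<epsilon> t * (\<rho>0 t / deriv F t))) x = L \<rho>1 x - \<rho>1 x"
  shows "\<exists>P>0. \<exists>B2. \<exists>C>0. \<forall>p \<delta> \<eta>. p \<in> Ck 2 \<longrightarrow> periodic p \<longrightarrow> \<bar>\<delta>\<bar> * P \<le> (lam - 1) / 2 \<longrightarrow> \<eta> \<le> 1 \<longrightarrow>
      close_C2 \<eta> p \<epsilon> \<longrightarrow>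
      perturbed_lift F d lam D p \<delta> P B2 \<and>
      residual \<delta> p (\<lambda>t. \<rho>0 t + \<delta> * \<rho>1 t) \<in> Ck 1 \<and> periodic (residual \<delta> p (\<lambda>t. \<rho>0 t + \<delta> * \<rho>1 t)) \<and>
      (\<forall>x. \<bar>residual \<delta> p (\<lambda>t. \<rho>0 t + \<delta> * \<rho>1 t) x\<bar> \<le> C * \<bar>\<delta>\<bar> * (\<eta> + \<bar>\<delta>\<bar>)) \<and>
      (\<forall>x. \<bar>deriv (residual \<delta> p (\<lambda>t. \<rho>0 t + \<delta> * \<rho>1 t)) x\<bar> \<le> C * \<bar>\<delta>\<bar>)"
proof -
  have bdd: "\<exists>M\<ge>0. \<forall>t. \<bar>f t\<bar> \<le> M" if "f \<in> Ck 0" "periodic f" for f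
    using periodic_bounded[OF that(2)] that(1) unfolding Ck_0 by (metis less_imp_le)
  have lips: "\<exists>M\<ge>0. \<forall>s t. \<bar>f s - f t\<bar> \<le> M * \<bar>s - t\<bar>" if "f \<in> Ck 1" "periodic f" for f
    using periodic_Lipschitz[OF that(2,1)] by (metis less_imp_le)
  have F': "deriv F \<in> Ck 2" "deriv (deriv F) \<in> Ck 1"
    using Ck_deriv[OF F, of 2] Ck_deriv[of "deriv F" 2 1] by simp_all
  have F'1: "deriv F \<in> Ck 1" using F'(1) Ck_antimono[of _ 2 1] by simp
  have \<rho>0': "deriv \<rho>0 \<in> Ck 1" "\<rho>0 \<in> Ck 1" "\<rho>0 \<in> Ck 0" "deriv \<rho>0 \<in> Ck 0"
    using Ck_deriv[OF \<rho>0(1), of 1] Ck_deriv[OF \<rho>0(1), of 0] Ck_antimono[OF \<rho>0(1)] by simp_all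
  have \<rho>1': "deriv \<rho>1 \<in> Ck 0" "\<rho>1 \<in> Ck 0"
    using Ck_deriv[OF \<rho>1(1), of 0] Ck_antimono[OF \<rho>1(1), of 0] by simp_all
  have \<epsilon>': "deriv \<epsilon> \<in> Ck 1" "\<epsilon> \<in> Ck 1" "\<epsilon> \<in> Ck 0" "deriv \<epsilon> \<in> Ck 0" "deriv (deriv \<epsilon>) \<in> Ck 0"
    using Ck_deriv[OF \<epsilon>(1), of 1] Ck_deriv[OF \<epsilon>(1), of 0] Ck_antimono[OF \<epsilon>(1)]
      Ck_deriv[of "deriv \<epsilon>" 1 0] by simp_all
  define H where "H = (\<lambda>t. \<rho>0 t / deriv F t)"
  have H2: "H \<in> Ck 2" unfolding H_def by (intro Ck_divide \<rho>0 F' F'_neq_0)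
  have H: "H \<in> Ck 1" "deriv H \<in> Ck 1" using Ck_antimono[OF H2, of 1] Ck_deriv[OF H2, of 1] by simp_all
  have perF: "deriv F (t + 1) = deriv F t" "deriv (deriv F) (t + 1) = deriv (deriv F) t" for t
    using F'_periodic periodic_deriv[OF F'_periodic] by (auto simp: periodic_def)
  have per\<rho>: "\<rho>0 (t + 1) = \<rho>0 t" "deriv \<rho>0 (t + 1) = deriv \<rho>0 t" "\<rho>1 (t + 1) = \<rho>1 t" for t
    using \<rho>0(2) periodic_deriv[OF \<rho>0(2)] \<rho>1(2) by (auto simp: periodic_def)
  have perH: "periodic H" using perF per\<rho> by (simp add: periodic_def H_def)
  have per\<epsilon>: "deriv \<epsilon> (t + 1) = deriv \<epsilon> t" "deriv H (t + 1) = deriv H t" "H (t + 1) = H t" for t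
    using periodic_deriv[OF \<epsilon>(2)] periodic_deriv[OF perH] perH by (auto simp: periodic_def)
  define Q where "Q = (\<lambda>t. (deriv \<rho>0 t / deriv F t - \<rho>0 t * deriv (deriv F) t / (deriv F t)\<^sup>2) / deriv F t)"
  obtain B0 where B0: "B0 \<ge> 0" "\<And>t. \<bar>\<rho>0 t\<bar> \<le> B0" using bdd[OF \<rho>0'(3) \<rho>0(2)] by blast
  obtain B0' where B0': "B0' \<ge> 0" "\<And>t. \<bar>deriv \<rho>0 t\<bar> \<le> B0'"
    using bdd[OF \<rho>0'(4) periodic_deriv[OF \<rho>0(2)]] by blast
  define B where "B = B0 + B0'"
  have B: "\<bar>\<rho>0 t\<bar> \<le> B" "\<bar>deriv \<rho>0 t\<bar> \<le> B" "B \<ge> 0" for t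
    using B0(1) B0(2)[of t] B0'(1) B0'(2)[of t] by (auto simp: B_def)
  obtain R where R: "R \<ge> 0" "\<And>t. \<bar>\<rho>1 t\<bar> \<le> R" using bdd[OF \<rho>1'(2) \<rho>1(2)] by blast
  obtain R' where R': "R' \<ge> 0" "\<And>t. \<bar>deriv \<rho>1 t\<bar> \<le> R'"
    using bdd[OF \<rho>1'(1) periodic_deriv[OF \<rho>1(2)]] by blast
  obtain E0 where E0: "E0 \<ge> 0" "\<And>t. \<bar>\<epsilon> t\<bar> \<le> E0" using bdd[OF \<epsilon>'(3) \<epsilon>(2)] by blast
  obtain E1 where E1: "E1 \<ge> 0" "\<And>t. \<bar>deriv \<epsilon> t\<bar> \<le> E1"
    using bdd[OF \<epsilon>'(4) periodic_deriv[OF \<epsilon>(2)]] by blast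
  obtain E2 where E2: "E2 \<ge> 0" "\<And>t. \<bar>deriv (deriv \<epsilon>) t\<bar> \<le> E2"
    using bdd[OF \<epsilon>'(5) periodic_deriv[OF periodic_deriv[OF \<epsilon>(2)]]] by blast
  obtain E3 where E3: "E3 \<ge> 0" "\<And>s t. \<bar>\<epsilon> s - \<epsilon> t\<bar> \<le> E3 * \<bar>s - t\<bar>" using lips[OF \<epsilon>'(2) \<epsilon>(2)] by blast
  define E where "E = E1 + E3"
  have E: "E \<ge> 0" "\<bar>deriv \<epsilon> t\<bar> \<le> E" "\<bar>\<epsilon> s - \<epsilon> t\<bar> \<le> E * \<bar>s - t\<bar>" for s t
    using E1(1) E1(2)[of t] E3(1) order_trans[OF E3(2)[of s t] mult_right_mono[of E3 E "\<bar>s - t\<bar>"]]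
    by (auto simp: E_def)
  obtain B2 where B2: "B2 \<ge> 0" "\<And>t. \<bar>deriv (deriv F) t\<bar> \<le> B2"
    using bdd[OF Ck_antimono[OF F'(2), of 0] periodic_deriv[OF F'_periodic]] by auto
  have C1s: "(\<lambda>t. deriv \<epsilon> t * H t / deriv F t) \<in> Ck 1" "(\<lambda>t. deriv H t / deriv F t) \<in> Ck 1"
    "(\<lambda>t. \<rho>1 t / deriv F t) \<in> Ck 1"
    by (intro Ck_divide Ck_mult \<epsilon>'(1) H F'1 F'_neq_0 \<rho>1(1))+
  have Q1: "Q \<in> Ck 1"
    unfolding Q_def by (intro Ck_divide Ck_diff Ck_mult Ck_power \<rho>0'(1,2) F'(2) F'1 F'_neq_0 power_not_zero)
  have pers: "periodic (\<lambda>t. deriv \<epsilon> t * H t / deriv F t)" "periodic (\<lambda>t. deriv H t / deriv F t)"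
    "periodic (\<lambda>t. \<rho>1 t / deriv F t)" "periodic Q"
    unfolding periodic_def Q_def by (simp_all only: perF per\<rho> per\<epsilon> simp_thms)
  obtain M1 where M1: "M1 \<ge> 0" "\<And>s t. \<bar>deriv \<epsilon> s * H s / deriv F s - deriv \<epsilon> t * H t / deriv F t\<bar> \<le> M1 * \<bar>s - t\<bar>"
    using lips[OF C1s(1) pers(1)] by blast
  obtain M2 where M2: "M2 \<ge> 0" "\<And>s t. \<bar>deriv H s / deriv F s - deriv H t / deriv F t\<bar> \<le> M2 * \<bar>s - t\<bar>"
    using lips[OF C1s(2) pers(2)] by blast
  obtain B3 where B3: "B3 \<ge> 0" "\<And>t. \<bar>deriv H t / deriv F t\<bar> \<le> B3"
    using bdd[OF Ck_antimono[OF C1s(2), of 0] pers(2)] by auto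
  obtain M4 where M4: "M4 \<ge> 0" "\<And>s t. \<bar>\<rho>1 s / deriv F s - \<rho>1 t / deriv F t\<bar> \<le> M4 * \<bar>s - t\<bar>"
    using lips[OF C1s(3) pers(3)] by blast
  obtain M5 where M5: "M5 \<ge> 0" "\<And>s t. \<bar>Q s - Q t\<bar> \<le> M5 * \<bar>s - t\<bar>"
    using lips[OF Q1 pers(4)] by blast
  \<comment> \<open>The 1 accounts for the distance \<eta> \<le> 1 between \<open>p\<close> and
    \<epsilon>.\<close>
  define P where "P = E0 + E1 + E2 + 1"
  have P: "P > 0" using E0 E1 E2 by (simp add: P_def)
  define K1 where "K1 = E * B * P + M1 * P + M2 * P\<^sup>2 + B3 * E * P"
  define K2 where "K2 = R * P + M4 * P"
  define K3 where "K3 = B * (3 + 3 * B2) * P + M5 * P"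
  define D1 where "D1 = B2 + (lam - 1) / 2"
  define C where "C = real d * (B + B3 + K1 + K2) + (real d * K3 + (real d * (R' + R * D1) + R')) + 1"
  have nn: "K1 \<ge> 0" "K2 \<ge> 0" "K3 \<ge> 0" "D1 \<ge> 0"
    using E B P M1 M2 B3 R M4 B2 M5 lam by (auto simp: K1_def K2_def K3_def D1_def)
  have C1: "real d * (B + B3 + K1 + K2) \<le> C" and C2: "real d * K3 + (real d * (R' + R * D1) + R') \<le> C" and C0: "C > 0"
    using nn B B3 R R' by (auto simp: C_def intro!: add_nonneg_pos add_nonneg_nonneg)
  show ?thesis
  proof (rule exI[of _ P], rule conjI[OF P], rule exI[of _ B2], rule exI[of _ C], rule conjI[OF C0],
      intro allI impI)
    fix p \<delta> \<eta>
    assume p: "p \<in> Ck 2" "periodic p" and small: "\<bar>\<delta>\<bar> * P \<le> (lam - 1) / 2" and \<eta>1: "\<eta> \<le> 1"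
      and "close_C2 \<eta> p \<epsilon>"
    then have close: "\<bar>p t - \<epsilon> t\<bar> \<le> \<eta>" "\<bar>deriv p t - deriv \<epsilon> t\<bar> \<le> \<eta>"
        "\<bar>deriv (deriv p) t - deriv (deriv \<epsilon>) t\<bar> \<le> \<eta>" for t
      by (auto simp: close_C2_def)
    have \<eta>0: "\<eta> \<ge> 0" using close(1)[of 0] by linarith
    interpret PL: perturbed_lift F d lam D p \<delta> P B2
    proof
      show "\<bar>p t\<bar> \<le> P" for t using close(1)[of t] E0(2)[of t] E1(1) E2(1) \<eta>1 by (simp add: P_def)
      show "\<bar>deriv p t\<bar> \<le> P" for t using close(2)[of t] E1(2)[of t] E0(1) E2(1) \<eta>1 by (simp add: P_def)
      show "\<bar>deriv (deriv p) t\<bar> \<le> P" for t using close(3)[of t] E2(2)[of t] E0(1) E1(1) \<eta>1 by (simp add: P_def)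
    qed (use p small B2 in auto)
    define e where "e x = PL.P.L (\<lambda>t. \<rho>0 t + \<delta> * \<rho>1 t) x - (\<rho>0 x + \<delta> * \<rho>1 x)" for x
    have e_eq: "e = (\<lambda>x. (PL.P.L \<rho>0 x - \<rho>0 x) + \<delta> * (PL.P.L \<rho>1 x - \<rho>1 x))"
    proof
      fix x
      show "e x = (PL.P.L \<rho>0 x - \<rho>0 x) + \<delta> * (PL.P.L \<rho>1 x - \<rho>1 x)"
        using PL.P.L_lin[of 1 \<rho>0 \<delta> \<rho>1 x] by (simp add: e_def algebra_simps)
    qed
    have e_C1: "e \<in> Ck 1"
      unfolding e_eq by (intro Ck_add Ck_diff Ck_mult Ck_const PL.P.L_C1 \<rho>0'(2) \<rho>1)
    have e_per: "periodic e"
      using PL.P.L_periodic[OF \<rho>0(2)] PL.P.L_periodic[OF \<rho>1(2)] per\<rho> unfolding e_eq by (simp add: periodic_def)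
    have e_bound: "\<bar>e x\<bar> \<le> C * \<bar>\<delta>\<bar> * (\<eta> + \<bar>\<delta>\<bar>)" for x
    proof -
      have respH: "deriv (S (\<lambda>t. \<epsilon> t * H t)) x = L \<rho>1 x - \<rho>1 x"
        using resp[of x] by (simp only: H_def)
      have exp1: "\<bar>PL.P.L \<rho>0 x - L \<rho>0 x + \<delta> * (L \<rho>1 x - \<rho>1 x)\<bar> \<le>
          real d * \<bar>\<delta>\<bar> * ((B + B3) * \<eta> + K1 * \<bar>\<delta>\<bar>)"
        using PL.L_expansion[OF B(1) H_def H(1) close(1,2) \<epsilon>'(2) E(2,3) M1 M2 B3(2), of x]
        unfolding respH K1_def .
      have exp2: "\<bar>PL.P.L \<rho>1 x - L \<rho>1 x\<bar> \<le> real d * K2 * \<bar>\<delta>\<bar>"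
        unfolding K2_def by (rule PL.L_diff_bound[OF R(2) M4])
      \<comment> \<open>By \<open>L \<rho>0 = \<rho>0\<close> and the response equation, the first
        bracket is the remainder of \<open>L_expansion\<close>; the second summand is of order
        \<delta> squared.\<close>
      have split: "e x = (PL.P.L \<rho>0 x - L \<rho>0 x + \<delta> * (L \<rho>1 x - \<rho>1 x)) + \<delta> * (PL.P.L \<rho>1 x - L \<rho>1 x)"
        by (simp add: e_eq \<rho>0(3) algebra_simps)
      have "\<bar>e x\<bar> \<le> \<bar>PL.P.L \<rho>0 x - L \<rho>0 x + \<delta> * (L \<rho>1 x - \<rho>1 x)\<bar> + \<bar>\<delta>\<bar> * \<bar>PL.P.L \<rho>1 x - L \<rho>1 x\<bar>"
        unfolding split abs_mult[symmetric] by (rule abs_triangle_ineq)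
      also have "\<dots> \<le> real d * \<bar>\<delta>\<bar> * ((B + B3) * \<eta> + K1 * \<bar>\<delta>\<bar>) + \<bar>\<delta>\<bar> * (real d * K2 * \<bar>\<delta>\<bar>)"
        by (intro add_mono exp1 mult_left_mono exp2 abs_ge_zero)
      also have "\<dots> = real d * \<bar>\<delta>\<bar> * ((B + B3) * \<eta> + (K1 + K2) * \<bar>\<delta>\<bar>)" by (simp add: algebra_simps)
      also have "\<dots> \<le> real d * \<bar>\<delta>\<bar> * ((B + B3 + K1 + K2) * (\<eta> + \<bar>\<delta>\<bar>))"
        using nn B B3 \<eta>0 by (intro mult_left_mono) (auto simp: algebra_simps intro!: add_nonneg_nonneg)
      also have "\<dots> = real d * (B + B3 + K1 + K2) * (\<bar>\<delta>\<bar> * (\<eta> + \<bar>\<delta>\<bar>))" by (simp add: algebra_simps)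
      also have "\<dots> \<le> C * (\<bar>\<delta>\<bar> * (\<eta> + \<bar>\<delta>\<bar>))"
        using C1 \<eta>0 by (intro mult_right_mono) auto
      finally show ?thesis by (simp only: mult.assoc)
    qed
    have de_bound: "\<bar>deriv e x\<bar> \<le> C * \<bar>\<delta>\<bar>" for x
    proof -
      have L\<rho>0: "PL.P.L \<rho>0 \<in> Ck 1" "PL.P.L \<rho>1 \<in> Ck 1"
        by (intro PL.P.L_C1 \<rho>0'(2) \<rho>1)+
      have "(e has_real_derivative (deriv (PL.P.L \<rho>0) x - deriv \<rho>0 x) + \<delta> * (deriv (PL.P.L \<rho>1) x - deriv \<rho>1 x)) (at x)"
        unfolding e_eq by (intro DERIV_add DERIV_diff DERIV_cmult Ck_DERIV[OF L\<rho>0(1)] Ck_DERIV[OF L\<rho>0(2)]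
            Ck_DERIV[OF \<rho>0'(2)] Ck_DERIV[OF \<rho>1(1)]) simp_all
      then have de: "deriv e x = (deriv (PL.P.L \<rho>0) x - deriv (L \<rho>0) x) + \<delta> * (deriv (PL.P.L \<rho>1) x - deriv \<rho>1 x)"
        by (simp add: \<rho>0(3) DERIV_imp_deriv)
      have d1: "\<bar>deriv (PL.P.L \<rho>0) x - deriv (L \<rho>0) x\<bar> \<le> real d * K3 * \<bar>\<delta>\<bar>"
        unfolding K3_def by (rule PL.deriv_L_diff_bound[OF \<rho>0'(2) B(1,2) Q_def M5])
      have "\<bar>(deriv \<rho>1 t / deriv PL.F1 t - \<rho>1 t * deriv (deriv PL.F1) t / (deriv PL.F1 t)\<^sup>2) / deriv PL.F1 t\<bar> \<le> R' + R * D1" for t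
      proof -
        define y where "y = 1 / deriv PL.F1 t"
        have y: "0 < y" "y \<le> 1" using PL.inverse_bounds[of t] by (auto simp: y_def)
        have split: "(deriv \<rho>1 t / deriv PL.F1 t - \<rho>1 t * deriv (deriv PL.F1) t / (deriv PL.F1 t)\<^sup>2) / deriv PL.F1 t =
            deriv \<rho>1 t * y ^ 2 - \<rho>1 t * (deriv (deriv PL.F1) t) * y ^ 3"
          using PL.P.F'_neq_0[of t] by (simp add: y_def field_simps power2_eq_square power3_eq_cube)
        have "\<bar>deriv \<rho>1 t * y ^ 2 - \<rho>1 t * (deriv (deriv PL.F1) t) * y ^ 3\<bar> \<le>
            \<bar>deriv \<rho>1 t\<bar> * \<bar>y ^ 2\<bar> + \<bar>\<rho>1 t\<bar> * \<bar>deriv (deriv PL.F1) t\<bar> * \<bar>y ^ 3\<bar>"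
          unfolding abs_mult[symmetric] by (rule abs_triangle_ineq4)
        also have "\<dots> \<le> R' * 1 + R * D1 * 1"
          using R R' y PL.F1''_bound[of t] nn unfolding D1_def
          by (intro add_mono mult_mono mult_nonneg_nonneg) (auto simp: power_le_one)
        finally show ?thesis unfolding split by simp
      qed
      then have "\<bar>deriv (PL.P.L \<rho>1) x\<bar> \<le> real d * (R' + R * D1)"
        unfolding DERIV_imp_deriv[OF PL.P.L_deriv[OF \<rho>1(1), of x]] by (rule PL.P.S_bound)
      then have d2: "\<bar>deriv (PL.P.L \<rho>1) x - deriv \<rho>1 x\<bar> \<le> real d * (R' + R * D1) + R'"
        using R'(2)[of x] by linarith
      have "\<bar>deriv e x\<bar> \<le> \<bar>deriv (PL.P.L \<rho>0) x - deriv (L \<rho>0) x\<bar> + \<bar>\<delta>\<bar> * \<bar>deriv (PL.P.L \<rho>1) x - deriv \<rho>1 x\<bar>"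
        unfolding de abs_mult[symmetric] by (rule abs_triangle_ineq)
      also have "\<dots> \<le> real d * K3 * \<bar>\<delta>\<bar> + \<bar>\<delta>\<bar> * (real d * (R' + R * D1) + R')"
        by (intro add_mono d1 mult_left_mono d2 abs_ge_zero)
      also have "\<dots> = (real d * K3 + (real d * (R' + R * D1) + R')) * \<bar>\<delta>\<bar>" by (simp add: algebra_simps)
      also have "\<dots> \<le> C * \<bar>\<delta>\<bar>" using C2 by (rule mult_right_mono) simp
      finally show ?thesis .
    qed
    have "PL.F1 = (\<lambda>t. F t + \<delta> * p t)" by (auto simp: PL.F1_def)
    then have "residual \<delta> p (\<lambda>t. \<rho>0 t + \<delta> * \<rho>1 t) = e"
      by (auto simp: residual_def e_def)
    then show "perturbed_lift F d lam D p \<delta> P B2 \<and>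
      residual \<delta> p (\<lambda>t. \<rho>0 t + \<delta> * \<rho>1 t) \<in> Ck 1 \<and> periodic (residual \<delta> p (\<lambda>t. \<rho>0 t + \<delta> * \<rho>1 t)) \<and>
      (\<forall>x. \<bar>residual \<delta> p (\<lambda>t. \<rho>0 t + \<delta> * \<rho>1 t) x\<bar> \<le> C * \<bar>\<delta>\<bar> * (\<eta> + \<bar>\<delta>\<bar>)) \<and>
      (\<forall>x. \<bar>deriv (residual \<delta> p (\<lambda>t. \<rho>0 t + \<delta> * \<rho>1 t)) x\<bar> \<le> C * \<bar>\<delta>\<bar>)"
      using PL.perturbed_lift_axioms e_C1 e_per e_bound de_bound by simp
  qed
qed

theorem linear_response:
  assumes F: "F \<in> Ck 3"
    and \<rho>0: "\<rho>0 \<in> Ck 2" "periodic \<rho>0" "L \<rho>0 = \<rho>0" "circ_int \<rho>0 = 1"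
    and \<rho>1: "\<rho>1 \<in> Ck 1" "periodic \<rho>1" "circ_int \<rho>1 = 0"
    and \<epsilon>: "\<epsilon> \<in> Ck 2" "periodic \<epsilon>"
    and resp: "\<And>x. deriv (S (\<lambda>t. \<epsilon> t * (\<rho>0 t / deriv F t))) x = L \<rho>1 x - \<rho>1 x"
    and p: "\<forall>\<^sub>F \<delta> in at 0. p \<delta> \<in> Ck 2 \<and> periodic (p \<delta>)"
    and close: "\<And>\<eta>. \<eta> > 0 \<Longrightarrow> \<forall>\<^sub>F \<delta> in at 0. close_C2 \<eta> (p \<delta>) \<epsilon>"
    and r: "\<forall>\<^sub>F \<delta> in at 0. r \<delta> \<in> L1_periodic \<and> circ_int (r \<delta>) = 1 \<and>
      (AE x in lebesgue_on {0..1}. expanding_lift.L (\<lambda>t. F t + \<delta> * p \<delta> t) d (r \<delta>) x = r \<delta> x)"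
  shows "((\<lambda>\<delta>. circ_int (\<lambda>x. \<bar>(r \<delta> x - \<rho>0 x) / \<delta> - \<rho>1 x\<bar>)) \<longlongrightarrow> 0) (at 0)"
proof (rule tendstoI)
  fix \<tau> :: real assume \<tau>: "\<tau> > 0"
  obtain P B2 C where P: "P > 0" "C > 0" and res: "\<And>p \<delta> \<eta>. p \<in> Ck 2 \<Longrightarrow> periodic p \<Longrightarrow>
      \<bar>\<delta>\<bar> * P \<le> (lam - 1) / 2 \<Longrightarrow> \<eta> \<le> 1 \<Longrightarrow> close_C2 \<eta> p \<epsilon> \<Longrightarrow>
      perturbed_lift F d lam D p \<delta> P B2 \<and>
      residual \<delta> p (\<lambda>t. \<rho>0 t + \<delta> * \<rho>1 t) \<in> Ck 1 \<and> periodic (residual \<delta> p (\<lambda>t. \<rho>0 t + \<delta> * \<rho>1 t)) \<and>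
      (\<forall>x. \<bar>residual \<delta> p (\<lambda>t. \<rho>0 t + \<delta> * \<rho>1 t) x\<bar> \<le> C * \<bar>\<delta>\<bar> * (\<eta> + \<bar>\<delta>\<bar>)) \<and>
      (\<forall>x. \<bar>deriv (residual \<delta> p (\<lambda>t. \<rho>0 t + \<delta> * \<rho>1 t)) x\<bar> \<le> C * \<bar>\<delta>\<bar>)"
    using perturbation_residual_bounds[OF F \<rho>0(1-3) \<rho>1(1,2) \<epsilon> resp] by blast
  define D1 where "D1 = B2 + (lam - 1) / 2"
  define \<theta>1 where "\<theta>1 = decay ((lam + 1) / 2) D1"
  define \<kappa> where "\<kappa> = decay_const ((lam + 1) / 2) D1"
  \<comment> \<open>The estimate for each cut \<open>N\<close>, already divided by \<delta>. The
    bound on \<theta>1 is included because it is only known inside the locale of a perturbed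
    lift.\<close>
  have main: "\<bar>\<theta>1\<bar> < 1 \<and> circ_int (\<lambda>x. \<bar>(r' x - \<rho>0 x) / \<delta> - \<rho>1 x\<bar>) \<le>
       real N * (C * (\<eta> + \<bar>\<delta>\<bar>)) + 2 * C * \<kappa> * \<theta>1 ^ N / (1 - \<theta>1)"
    if \<delta>: "\<delta> \<noteq> 0" "\<bar>\<delta>\<bar> * P \<le> (lam - 1) / 2" "\<bar>\<delta>\<bar> \<le> 1" and q: "q \<in> Ck 2" "periodic q" and \<eta>: "\<eta> \<le> 1"
      and cl: "close_C2 \<eta> q \<epsilon>"
      and r': "r' \<in> L1_periodic" "circ_int r' = 1"
        "AE x in lebesgue_on {0..1}. expanding_lift.L (\<lambda>t. F t + \<delta> * q t) d r' x = r' x"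
    for \<delta> q \<eta> r' N
  proof -
    interpret PL: perturbed_lift F d lam D q \<delta> P B2
      using res[OF q \<delta>(2) \<eta> cl] by blast
    have F1: "(\<lambda>t. F t + \<delta> * q t) = PL.F1" by (auto simp: PL.F1_def)
    define R where "R t = \<rho>0 t + \<delta> * \<rho>1 t" for t
    define e where "e = residual \<delta> q R"
    have e_eq: "e x = PL.P.L R x - R x" for x by (simp add: e_def residual_def F1)
    have e: "e \<in> Ck 1" "periodic e" "\<And>x. \<bar>e x\<bar> \<le> C * \<bar>\<delta>\<bar> * (\<eta> + \<bar>\<delta>\<bar>)" "\<And>x. \<bar>deriv e x\<bar> \<le> C * \<bar>\<delta>\<bar>"
      using res[OF q \<delta>(2) \<eta> cl] by (simp_all add: e_def R_def[abs_def])
    have \<rho>L: "\<rho>0 \<in> L1_periodic" "\<rho>1 \<in> L1_periodic"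
      using \<rho>0 \<rho>1 by (auto intro: Ck_L1_periodic)
    have RL: "R \<in> L1_periodic" unfolding R_def[abs_def] using L1_periodic_lin[OF \<rho>L, of 1 \<delta>] by simp
    have "circ_int R = 1"
      unfolding R_def using \<rho>L \<rho>0 \<rho>1 by (subst Bochner_Integration.integral_add) (auto simp: L1_periodic_def)
    define u where "u x = r' x - R x" for x
    have uL: "u \<in> L1_periodic" unfolding u_def[abs_def] by (intro L1_periodic_diff r' RL)
    have u0: "circ_int u = 0"
      unfolding u_def using r' RL \<open>circ_int R = 1\<close>
      by (subst Bochner_Integration.integral_diff) (auto simp: L1_periodic_def)
    have eq: "AE x in lebesgue_on {0..1}. u x = PL.P.L u x + e x"
      using r'(3) unfolding F1
    proof eventually_elim
      case (elim x)
      then show ?case unfolding u_def[abs_def] PL.P.L_diff by (simp add: e_eq)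
    qed
    \<comment> \<open>The 2 absorbs \<open>\<eta> + \<bar>\<delta>\<bar> \<le> 2\<close>, so that
      one amplitude bounds both \<open>e\<close> and its derivative.\<close>
    have A: "0 < 2 * C * \<bar>\<delta>\<bar>" using P \<delta> by simp
    have eA: "\<bar>e x\<bar> \<le> 2 * C * \<bar>\<delta>\<bar>" for x
    proof -
      have "C * \<bar>\<delta>\<bar> * (\<eta> + \<bar>\<delta>\<bar>) \<le> C * \<bar>\<delta>\<bar> * 2" using P \<delta> \<eta> by (intro mult_left_mono) auto
      then show ?thesis using e(3)[of x] by simp
    qed
    have deA: "\<bar>deriv e x\<bar> \<le> 2 * C * \<bar>\<delta>\<bar>" for x
    proof -
      have "C * \<bar>\<delta>\<bar> \<ge> 0" using P by simp
      then show ?thesis using e(4)[of x] by simp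
    qed
    have "L1_norm u \<le> real N * (C * \<bar>\<delta>\<bar> * (\<eta> + \<bar>\<delta>\<bar>)) + 2 * C * \<bar>\<delta>\<bar> * \<kappa> * \<theta>1 ^ N / (1 - \<theta>1)"
      unfolding \<kappa>_def \<theta>1_def D1_def
      by (rule PL.P.almost_invariant_bound[OF uL u0 e(1,2) A eA deA e(3) eq])
    then have "L1_norm u / \<bar>\<delta>\<bar> \<le>
        (real N * (C * \<bar>\<delta>\<bar> * (\<eta> + \<bar>\<delta>\<bar>)) + 2 * C * \<bar>\<delta>\<bar> * \<kappa> * \<theta>1 ^ N / (1 - \<theta>1)) / \<bar>\<delta>\<bar>"
      by (rule divide_right_mono) simp
    also have "\<dots> = real N * (C * (\<eta> + \<bar>\<delta>\<bar>)) + 2 * C * \<kappa> * \<theta>1 ^ N / (1 - \<theta>1)"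
      using \<delta>(1) by (simp add: add_divide_distrib)
    also have "L1_norm u / \<bar>\<delta>\<bar> = circ_int (\<lambda>x. \<bar>u x\<bar> / \<bar>\<delta>\<bar>)" by simp
    also have "(\<lambda>x. \<bar>u x\<bar> / \<bar>\<delta>\<bar>) = (\<lambda>x. \<bar>(r' x - \<rho>0 x) / \<delta> - \<rho>1 x\<bar>)"
    proof
      fix x
      have "u x / \<delta> = (r' x - \<rho>0 x) / \<delta> - \<rho>1 x" using \<delta>(1) by (simp add: u_def R_def field_simps)
      then show "\<bar>u x\<bar> / \<bar>\<delta>\<bar> = \<bar>(r' x - \<rho>0 x) / \<delta> - \<rho>1 x\<bar>" by (metis abs_divide)
    qed
    finally show ?thesis using PL.P.decay_pos PL.P.decay_less_1 by (simp add: \<theta>1_def D1_def)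
  qed
  have near: "\<forall>\<^sub>F \<delta>::real in at 0. \<delta> \<noteq> 0 \<and> \<bar>\<delta>\<bar> < b" if "b > 0" for b
    unfolding eventually_at using that by (intro exI[of _ b]) (auto simp: dist_real_def)
  have "min 1 ((lam - 1) / 2 / P) > 0" using P lam by simp
  \<comment> \<open>\<theta>1 does not depend on \<delta>, so a single admissible \<delta> near 0
    suffices.\<close>
  from near[OF this] p close[OF zero_less_one] r
  have "\<forall>\<^sub>F \<delta>::real in at 0. \<bar>\<theta>1\<bar> < 1"
  proof eventually_elim
    case (elim \<delta>)
    have "\<bar>\<delta>\<bar> \<le> 1" "\<bar>\<delta>\<bar> * P \<le> (lam - 1) / 2"
      using elim(1) P by (auto simp: pos_less_divide_eq intro: less_imp_le)
    then show ?case using main[of \<delta> "p \<delta>" 1 "r \<delta>" 0] elim by blast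
  qed
  then have \<theta>1: "\<bar>\<theta>1\<bar> < 1" by (simp add: trivial_limit_at)
  have "(\<lambda>N. 2 * C * \<kappa> * \<theta>1 ^ N / (1 - \<theta>1)) \<longlonglongrightarrow> 2 * C * \<kappa> * 0 / (1 - \<theta>1)"
    using \<theta>1 by (intro tendsto_intros LIMSEQ_power_zero) auto
  then have "\<forall>\<^sub>F N in sequentially. 2 * C * \<kappa> * \<theta>1 ^ N / (1 - \<theta>1) < \<tau> / 3"
    by (rule order_tendstoD(2)) (use \<tau> in auto)
  then obtain N where N: "2 * C * \<kappa> * \<theta>1 ^ N / (1 - \<theta>1) < \<tau> / 3" by (auto simp: eventually_sequentially)
  \<comment> \<open>With \<open>N\<close> fixed, \<eta> and \<delta> each contribute at most a third
    of \<tau>; the tail is below the last third. The added 1 avoids a zero denominator for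
    \<open>N = 0\<close>.\<close>
  define \<eta> where "\<eta> = min 1 (\<tau> / 3 / (real N * C + 1))"
  have NC: "0 < real N * C + 1" using P by (simp add: add_nonneg_pos)
  have \<eta>: "0 < \<eta>" "\<eta> \<le> 1" using \<tau> NC by (auto simp: \<eta>_def)
  have \<eta>_small: "real N * C * y \<le> \<tau> / 3" if "y \<le> \<eta>" "0 \<le> y" for y
  proof -
    have "y \<le> \<tau> / 3 / (real N * C + 1)" using that(1) by (simp add: \<eta>_def)
    then have "y * (real N * C + 1) \<le> \<tau> / 3" using NC by (subst (asm) pos_le_divide_eq) auto
    then show ?thesis using that(2) by (simp add: algebra_simps)
  qed
  define b where "b = min \<eta> (min 1 ((lam - 1) / 2 / P))"
  have "b > 0" using \<eta> P lam by (simp add: b_def)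
  from near[OF this] p close[OF \<eta>(1)] r
  show "\<forall>\<^sub>F \<delta> in at 0. dist (circ_int (\<lambda>x. \<bar>(r \<delta> x - \<rho>0 x) / \<delta> - \<rho>1 x\<bar>)) 0 < \<tau>"
  proof eventually_elim
    case (elim \<delta>)
    have \<delta>: "\<bar>\<delta>\<bar> \<le> \<eta>" "\<bar>\<delta>\<bar> \<le> 1" "\<bar>\<delta>\<bar> * P \<le> (lam - 1) / 2"
      using elim(1) P by (auto simp: b_def pos_less_divide_eq intro: less_imp_le)
    have "circ_int (\<lambda>x. \<bar>(r \<delta> x - \<rho>0 x) / \<delta> - \<rho>1 x\<bar>) \<le>
       real N * (C * (\<eta> + \<bar>\<delta>\<bar>)) + 2 * C * \<kappa> * \<theta>1 ^ N / (1 - \<theta>1)"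
      using main[of \<delta> "p \<delta>" \<eta> "r \<delta>" N] elim \<delta> \<eta> by blast
    also have "\<dots> < \<tau>"
    proof -
      have "real N * (C * (\<eta> + \<bar>\<delta>\<bar>)) = real N * C * \<eta> + real N * C * \<bar>\<delta>\<bar>"
        by (simp add: algebra_simps)
      then show ?thesis
        using \<eta>_small[of \<eta>] \<eta>_small[of "\<bar>\<delta>\<bar>"] \<delta> \<eta> N by linarith
    qed
    finally show ?case by (simp add: dist_real_def)
  qed
qed

end

section \<open>From the circle to the line\<close>

lemma circ_eq_iff: "circ s = circ t \<longleftrightarrow> s - t \<in> \<int>"
  by (rule circle.abs_eq_iff)

lemma circ_rep [simp]: "circ (rep_circle x) = x"
  by (rule Quotient3_abs_rep[OF Quotient3_circle])

lemma circ_add: "circ (s + t) = circ s + circ t"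
  by (simp add: plus_circle.abs_eq)

lemma circ_add_1 [simp]: "circ (t + 1) = circ t"
  by (simp add: circ_eq_iff)

lemma circ_surj: obtains t where "x = circ t"
  by (metis circ_rep)

lemma periodic_circ: "periodic (\<lambda>t. f (circ t))"
  by (simp add: periodic_def)

definition on_circle :: "(real \<Rightarrow> real) \<Rightarrow> circle \<Rightarrow> real" where
  "on_circle f x = f (rep_circle x)"

lemma on_circle_circ:
  assumes "periodic f" shows "on_circle f (circ t) = f t"
proof -
  have "rep_circle (circ t) - t \<in> \<int>" by (simp flip: circ_eq_iff)
  then obtain n :: int where "rep_circle (circ t) = t + of_int n"
    by (auto elim!: Ints_cases simp: algebra_simps)
  then show ?thesis using periodic_of_int[OF assms] by (simp add: on_circle_def)
qed

lemma on_circle_Ck: "periodic f \<Longrightarrow> f \<in> Ck k \<Longrightarrow> on_circle f \<in> Ck_circle k"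
  by (simp add: Ck_circle_def on_circle_circ)

lemma Ck_funpow_deriv: "f \<in> Ck k \<Longrightarrow> j \<le> k \<Longrightarrow> (deriv ^^ j) f \<in> Ck (k - j)"
proof (induction j)
  case (Suc j)
  then have "(deriv ^^ j) f \<in> Ck (Suc (k - Suc j))" by (simp add: Suc_diff_Suc)
  then show ?case by (auto dest: Ck_Suc_deriv(2))
qed simp

lemma periodic_funpow_deriv: "periodic f \<Longrightarrow> periodic ((deriv ^^ j) f)" for f :: "real \<Rightarrow> real"
  by (induction j) (auto intro: periodic_deriv)

text \<open>Periodicity makes the suprema genuine ones, and as all of them are nonnegative each is
  bounded by the sum.\<close>

lemma Ck_norm_bound:
  assumes "f \<in> Ck_circle k" "j \<le> k"
  shows "\<bar>(deriv ^^ j) (\<lambda>t. f (circ t)) t\<bar> \<le> Ck_norm k f"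
proof -
  let ?g = "\<lambda>j t. \<bar>(deriv ^^ j) (\<lambda>t. f (circ t)) t\<bar>"
  have bdd: "bdd_above (range (?g j))" if "j \<le> k" for j
  proof -
    have "(\<lambda>t. f (circ t)) \<in> Ck k" using assms(1) by (simp add: Ck_circle_def)
    from Ck_continuous[OF Ck_funpow_deriv[OF this that]] periodic_funpow_deriv[OF periodic_circ]
    obtain M where "\<And>t. ?g j t \<le> M" using periodic_bounded by metis
    then show ?thesis by (intro bdd_aboveI[of _ M]) auto
  qed
  have le: "?g j t \<le> (SUP t. ?g j t)" if "j \<le> k" for j t
    by (rule cSUP_upper[OF _ bdd[OF that]]) simp
  have "0 \<le> (SUP t. ?g j t)" if "j \<le> k" for j
    using le[OF that, of 0] by (meson abs_ge_zero order_trans)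
  then have "(SUP t. ?g j t) \<le> (\<Sum>j\<le>k. SUP t. ?g j t)"
    using assms(2) by (intro member_le_sum) auto
  then show ?thesis using le[OF assms(2), of t] unfolding Ck_norm_def by linarith
qed

text \<open>The difference is continuous and integer-valued on a connected line.\<close>

lemma is_lift_unique:
  assumes "is_lift T F" "is_lift T F'"
  obtains n :: int where "\<And>t. F' t = F t + of_int n"
proof -
  have Z: "F' t - F t \<in> \<int>" for t
    using assms unfolding is_lift_def by (metis circ_eq_iff)
  have "(\<lambda>t. F' t - F t) constant_on UNIV"
  proof (rule continuous_discrete_range_constant)
    show "continuous_on UNIV (\<lambda>t. F' t - F t)"
      using assms by (auto simp: is_lift_def intro: continuous_on_diff)
    show "\<exists>e>0. \<forall>y. y \<in> UNIV \<and> F' y - F y \<noteq> F' x - F x \<longrightarrow> e \<le> norm (F' y - F y - (F' x - F x))" for x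
    proof (intro exI[of _ 1] conjI allI impI)
      fix y assume y: "y \<in> UNIV \<and> F' y - F y \<noteq> F' x - F x"
      then have "F' y - F y - (F' x - F x) \<in> \<int>" "F' y - F y - (F' x - F x) \<noteq> 0"
        using Z Ints_diff by auto
      then show "1 \<le> norm (F' y - F y - (F' x - F x))"
        using Ints_nonzero_abs_ge1 by (metis real_norm_def)
    qed simp
  qed simp
  then obtain c where c: "\<And>t. F' t - F t = c" by (auto simp: constant_on_def)
  then have "c \<in> \<int>" using Z[of 0] by simp
  then obtain n :: int where "c = of_int n" by (auto elim: Ints_cases)
  then show ?thesis using that[of n] c by (metis add.commute diff_add_cancel)
qed

lemma circle_deriv_eq:
  assumes F: "is_lift T F" "F \<in> Ck 1" "\<And>t. F (t + 1) = F t + real d"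
  shows "circle_deriv T (circ t) = deriv F t"
  unfolding circle_deriv_def
proof (rule the_equality)
  show "\<exists>F' t'. is_lift T F' \<and> circ t' = circ t \<and> (F' has_real_derivative deriv F t) (at t')"
    using F(1) Ck_DERIV[OF F(2), of t] by auto
  have per: "periodic (deriv F)" by (rule periodic_deriv_of_shift[of F, OF F(3)])
  fix D
  assume "\<exists>F' t'. is_lift T F' \<and> circ t' = circ t \<and> (F' has_real_derivative D) (at t')"
  then obtain F' t' where F': "is_lift T F'" "circ t' = circ t" "(F' has_real_derivative D) (at t')" by blast
  obtain n :: int where n: "\<And>s. F' s = F s + of_int n" using is_lift_unique[OF F(1) F'(1)] by blast
  have "F' = (\<lambda>s. F s + of_int n)" using n by blast
  then have "(F' has_real_derivative deriv F t') (at t')"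
    using Ck_DERIV[OF F(2), of t'] by (auto intro!: derivative_eq_intros)
  then have "D = deriv F t'" using F'(3) DERIV_unique by blast
  moreover obtain m :: int where "t' = t + of_int m"
    using F'(2) by (auto simp: circ_eq_iff elim!: Ints_cases) (metis add.commute diff_add_cancel)
  ultimately show "D = deriv F t" using periodic_of_int[OF per] by simp
qed

text \<open>\<open>lam\<close> is the infimum itself, and any bound of the second derivative serves
  as \<open>D\<close> because the first exceeds 1.\<close>

lemma expanding_lift_of_lift:
  assumes F: "is_lift T F" "F \<in> Ck 2" "\<And>t. F (t + 1) = F t + real d" and "d > 0"
    and T: "\<And>x. circle_deriv T x > 0" "(INF x. circle_deriv T x) > 1"
  obtains lam D where "expanding_lift F d lam D"
proof -
  define lam where "lam = (INF x. circle_deriv T x)"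
  have "bdd_below (range (circle_deriv T))" using T(1) by (intro bdd_belowI[of _ 0]) (auto intro: less_imp_le)
  then have lam: "lam \<le> circle_deriv T x" for x unfolding lam_def by (rule cINF_lower) simp
  have F1: "F \<in> Ck 1" using Ck_antimono[OF F(2), of 1] by simp
  have F': "lam \<le> deriv F t" for t
    using lam[of "circ t"] circle_deriv_eq[OF F(1) F1 F(3)] by simp
  have per: "periodic (deriv F)" by (rule periodic_deriv_of_shift[of F, OF F(3)])
  have "deriv (deriv F) \<in> Ck 0" using Ck_deriv[OF Ck_deriv[OF F(2), of 1], of 0] by simp
  then obtain M where M: "M > 0" "\<And>t. \<bar>deriv (deriv F) t\<bar> \<le> M"
    using periodic_bounded[OF periodic_deriv[OF per]] by (auto simp: Ck_0)
  have "expanding_lift F d lam M"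
  proof
    show "\<bar>deriv (deriv F) t\<bar> \<le> M * deriv F t" for t
    proof -
      have "M * 1 \<le> M * deriv F t" using F'[of t] T(2) M(1) by (intro mult_left_mono) (auto simp: lam_def)
      then show ?thesis using M(2)[of t] by linarith
    qed
  qed (use F F' T(2) \<open>d > 0\<close> in \<open>auto simp: lam_def\<close>)
  then show ?thesis using that by blast
qed

lemma expanding_map_lift:
  assumes "expanding_map k T" "k \<ge> 2"
  obtains F d lam D where "is_lift T F" "F \<in> Ck k" "d \<ge> 2" "expanding_lift F d lam D"
proof -
  obtain F and d :: int where F: "is_lift T F" "F \<in> Ck k" "d \<ge> 2" "\<And>t. F (t + 1) = F t + of_int d"
    using assms unfolding expanding_map_def by blast
  have "F (t + 1) = F t + real (nat d)" for t using F(3,4) by simp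
  moreover have "F \<in> Ck 2" using Ck_antimono[OF F(2) assms(2)] .
  moreover have "nat d > 0" "nat d \<ge> 2" using F(3) by auto
  moreover have "\<And>x. circle_deriv T x > 0" "(INF x. circle_deriv T x) > 1"
    using assms(1) by (auto simp: expanding_map_def)
  ultimately obtain lam D where "expanding_lift F (nat d) lam D"
    using expanding_lift_of_lift[of T F "nat d"] F(1) by blast
  then show ?thesis using that F \<open>nat d \<ge> 2\<close> by blast
qed

text \<open>The fibre over \<open>circ x\<close> has one point per residue modulo \<open>d\<close>:
  translating \<open>t\<close> by an integer \<open>m\<close> changes \<open>F t\<close> by
  \<open>m * d\<close>.\<close>

lemma (in expanding_lift) transfer_op_eq:
  assumes T: "is_lift T F"
  shows "transfer_op T w (circ x) = L (\<lambda>t. w (circ t)) x"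
proof -
  have F1: "F \<in> Ck 1" using Ck_antimono[OF F_C2, of 1] by simp
  have T_circ: "T (circ t) = circ (F t)" for t using T by (simp add: is_lift_def)
  have "bij_betw (\<lambda>j. circ (G (x + real j))) {..<d} {y. T y = circ x}"
    unfolding bij_betw_def
  proof
    show "inj_on (\<lambda>j. circ (G (x + real j))) {..<d}"
    proof (rule inj_onI)
      fix i j assume ij: "i \<in> {..<d}" "j \<in> {..<d}" "circ (G (x + real i)) = circ (G (x + real j))"
      then obtain m :: int where m: "G (x + real i) = G (x + real j) + of_int m"
        by (auto simp: circ_eq_iff elim!: Ints_cases) (metis add.commute diff_add_cancel)
      then have "x + real i = F (G (x + real j) + of_int m)" by (metis F_G)
      then have "real i = real j + of_int m * real d" by (simp add: F_shift_int)
      then have "real_of_int (int i) = real_of_int (int j + m * int d)" by simp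
      then have "int i = int j + m * int d" by (simp only: of_int_eq_iff)
      then have "int i mod int d = int j mod int d" by simp
      then show "i = j" using ij by simp
    qed
    show "(\<lambda>j. circ (G (x + real j))) ` {..<d} = {y. T y = circ x}"
    proof (intro equalityI subsetI)
      fix y assume "y \<in> {y. T y = circ x}"
      moreover obtain s where s: "y = circ s" using circ_surj by blast
      ultimately have "circ (F s) = circ x" using T_circ by simp
      then obtain n :: int where n: "F s = x + of_int n"
        by (auto simp: circ_eq_iff elim!: Ints_cases) (metis add.commute diff_add_cancel)
      \<comment> \<open>The remainder selects the branch; the quotient is the integer by which
        \<open>s\<close> differs from the chosen preimage.\<close>
      define j where "j = nat (n mod int d)"
      have j: "j < d" using d_pos by (simp add: j_def nat_less_iff)
      have "n = int j + (n div int d) * int d" using d_pos by (simp add: j_def)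
      then have "real_of_int n = real_of_int (int j + (n div int d) * int d)" by (rule arg_cong)
      then have "F s = x + real j + of_int (n div int d) * real d" unfolding n by simp
      also have "\<dots> = F (G (x + real j) + of_int (n div int d))" by (simp add: F_shift_int)
      finally have "s = G (x + real j) + of_int (n div int d)" by (metis G_F)
      then have "y = circ (G (x + real j))" by (simp add: s circ_eq_iff)
      then show "y \<in> (\<lambda>j. circ (G (x + real j))) ` {..<d}" using j by blast
    qed (auto simp: T_circ circ_eq_iff)
  qed
  from sum.reindex_bij_betw[OF this, of "\<lambda>y. w y / circle_deriv T y"]
  show ?thesis
    by (simp add: transfer_op_def L_def S_def circle_deriv_eq[OF T F1 F_shift])
qed

section \<open>Integration on the circle and on the unit interval\<close>

lemma sets_circle_lebesgue: "sets circle_lebesgue = {A. circ -` A \<in> sets lebesgue}"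
  and space_circle_lebesgue [simp]: "space circle_lebesgue = UNIV"
proof -
  have "sigma_algebra UNIV {A. circ -` A \<in> sets lebesgue}"
  proof (rule sigma_algebra_iff2[THEN iffD2], intro conjI ballI allI impI)
    fix s assume "s \<in> {A. circ -` A \<in> sets lebesgue}"
    then show "UNIV - s \<in> {A. circ -` A \<in> sets lebesgue}"
      by (auto simp: vimage_Diff intro: sets.compl_sets[of _ lebesgue, simplified])
  next
    fix A :: "nat \<Rightarrow> circle set" assume "range A \<subseteq> {A. circ -` A \<in> sets lebesgue}"
    then show "\<Union> (range A) \<in> {A. circ -` A \<in> sets lebesgue}"
      by (auto simp: vimage_UN)
  qed auto
  then show "sets circle_lebesgue = {A. circ -` A \<in> sets lebesgue}"
    by (simp add: circle_lebesgue_def sets_measure_of sigma_algebra.sigma_sets_eq)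
qed (simp add: circle_lebesgue_def)

lemma circ_measurable: "circ \<in> lebesgue_on {0..<1} \<rightarrow>\<^sub>M sigma UNIV {A. circ -` A \<in> sets lebesgue}"
  by (rule measurable_measure_of) (auto simp: sets_restrict_space)

lemma circle_borel_measurable:
  "(\<lambda>t. f (circ t)) \<in> borel_measurable lebesgue \<Longrightarrow> f \<in> borel_measurable circle_lebesgue"
  by (auto simp: measurable_def sets_circle_lebesgue vimage_def)

lemma AE_circle:
  assumes "AE x in circle_lebesgue. Q x"
  shows "AE t in lebesgue_on {0..1}. Q (circ t)"
proof -
  have "AE t in lebesgue_on {0..<1}. Q (circ t)"
    using assms unfolding circle_lebesgue_def by (rule AE_distrD[OF circ_measurable])
  then have "AE t in lebesgue. t \<in> {0..<1} \<longrightarrow> Q (circ t)" by (simp add: AE_restrict_space_iff)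
  moreover have "AE t in lebesgue. t \<notin> {1::real}" by (rule AE_not_in) auto
  ultimately have "AE t in lebesgue. t \<in> {0..1} \<longrightarrow> Q (circ t)" by eventually_elim auto
  then show ?thesis by (simp add: AE_restrict_space_iff)
qed

text \<open>The two intervals differ by the null set \<open>{1}\<close>; the circle measure uses the
  half-open one, the calculus on the line the closed one.\<close>

lemma half_open_unit_interval:
  fixes f :: "real \<Rightarrow> real"
  shows "integrable (lebesgue_on {0..<1}) f \<longleftrightarrow> integrable (lebesgue_on {0..1}) f"
    and "(LINT x|lebesgue_on {0..<1}. f x) = circ_int f"
proof -
  have "{x \<in> {0..<1} - {0..1}. f x \<noteq> 0} = {}" "{x \<in> {0..1} - {0..<1}. f x \<noteq> 0} \<subseteq> {1}" by auto
  then have neg: "negligible {x \<in> {0..<1} - {0..1}. f x \<noteq> 0}" "negligible {x \<in> {0..1} - {0..<1}. f x \<noteq> 0}"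
    by (metis negligible_empty) (metis \<open>{x \<in> {0..1} - {0..<1}. f x \<noteq> 0} \<subseteq> {1}\<close> negligible_sing negligible_subset)
  show int: "integrable (lebesgue_on {0..<1}) f \<longleftrightarrow> integrable (lebesgue_on {0..1}) f"
    using absolutely_integrable_spike_set_eq[OF neg]
    by (simp add: set_integrable_def integrable_restrict_space)
  show "(LINT x|lebesgue_on {0..<1}. f x) = circ_int f"
  proof (cases "integrable (lebesgue_on {0..1}) f")
    case True
    then show ?thesis
      using integral_spike_set[OF neg] int by (simp add: lebesgue_integral_eq_integral)
  next
    case False
    then show ?thesis using int by (simp add: not_integrable_integral_eq)
  qed
qed

lemma circle_integrable:
  assumes "integrable circle_lebesgue f"
  shows "(\<lambda>t. f (circ t)) \<in> L1_periodic"
  using integrable_distr[OF circ_measurable, of f] assms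
  by (simp add: circle_lebesgue_def L1_periodic_def periodic_circ half_open_unit_interval)

lemma circle_integral:
  assumes "f \<in> borel_measurable circle_lebesgue"
  shows "(LINT x|circle_lebesgue. f x) = circ_int (\<lambda>t. f (circ t))"
  using assms integral_distr[OF circ_measurable, of f]
  by (simp add: circle_lebesgue_def half_open_unit_interval)

section \<open>Prescribing the response\<close>

context expanding_lift
begin

text \<open>\<open>almost_invariant_bound\<close> with zero defect: only the tail term remains, and
  it tends to 0 with \<open>N\<close>.\<close>

lemma invariant_density_unique:
  assumes f: "f \<in> L1_periodic" "circ_int f = 1" "AE x in lebesgue_on {0..1}. L f x = f x"
    and g: "g \<in> L1_periodic" "circ_int g = 1" "L g = g"
  shows "AE x in lebesgue_on {0..1}. f x = g x"
proof -
  let ?u = "\<lambda>x. f x - g x"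
  have u: "?u \<in> L1_periodic" using f g by (intro L1_periodic_diff)
  have u0: "circ_int ?u = 0" using f g by (simp add: L1_periodic_integrable)
  have eq: "AE x in lebesgue_on {0..1}. ?u x = L ?u x + 0"
    using f(3) by eventually_elim (simp add: L_diff g(3))
  have "L1_norm ?u \<le> decay_const lam D * \<theta> ^ N / (1 - \<theta>)" for N
    using almost_invariant_bound[OF u u0, of "\<lambda>_. 0" 1 0 N] eq by (simp add: periodic_def)
  moreover have "(\<lambda>N. decay_const lam D * \<theta> ^ N / (1 - \<theta>)) \<longlonglongrightarrow> decay_const lam D * 0 / (1 - \<theta>)"
    using decay_pos decay_less_1 by (intro tendsto_intros LIMSEQ_realpow_zero) auto
  ultimately have "L1_norm ?u \<le> decay_const lam D * 0 / (1 - \<theta>)"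
    by (intro LIMSEQ_le_const) auto
  then have "L1_norm ?u = 0" by (intro antisym) auto
  then have "AE x in lebesgue_on {0..1}. \<bar>?u x\<bar> = 0"
    using L1_periodic_integrable[OF L1_periodic_abs[OF u]]
    by (subst (asm) integral_nonneg_eq_0_iff_AE) auto
  then show ?thesis by simp
qed

end

lemma on_circle_invariant_density:
  assumes "expanding_lift F d lam D" "is_lift T F" "invariant_density T \<rho>"
  shows "(\<lambda>t. \<rho> (circ t)) \<in> L1_periodic" "circ_int (\<lambda>t. \<rho> (circ t)) = 1"
    "AE t in lebesgue_on {0..1}. expanding_lift.L F d (\<lambda>t. \<rho> (circ t)) t = \<rho> (circ t)"
proof -
  interpret expanding_lift F d lam D by fact
  have \<rho>: "integrable circle_lebesgue \<rho>" "(LINT x|circle_lebesgue. \<rho> x) = 1"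
    "AE x in circle_lebesgue. transfer_op T \<rho> x = \<rho> x"
    using assms(3) by (auto simp: invariant_density_def)
  show "(\<lambda>t. \<rho> (circ t)) \<in> L1_periodic" by (rule circle_integrable[OF \<rho>(1)])
  show "circ_int (\<lambda>t. \<rho> (circ t)) = 1"
    using circle_integral[of \<rho>] \<rho> by auto
  show "AE t in lebesgue_on {0..1}. L (\<lambda>t. \<rho> (circ t)) t = \<rho> (circ t)"
    using AE_circle[OF \<rho>(3)] by (simp add: transfer_op_eq[OF assms(2)])
qed

lemma close_C2_of_Ck_norm:
  assumes p: "p \<in> Ck_circle 3" and q: "q \<in> Ck_circle 3" and norm: "Ck_norm 3 (\<lambda>x. p x - q x) \<le> \<eta>"
  shows "close_C2 \<eta> (\<lambda>t. p (circ t)) (\<lambda>t. q (circ t))"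
proof -
  let ?p = "\<lambda>t. p (circ t)" and ?q = "\<lambda>t. q (circ t)"
  have C3: "?p \<in> Ck 3" "?q \<in> Ck 3" using p q by (auto simp: Ck_circle_def)
  then have C2: "deriv ?p \<in> Ck 2" "deriv ?q \<in> Ck 2"
    using Ck_deriv[of ?p 3 2] Ck_deriv[of ?q 3 2] by auto
  have d1: "deriv (\<lambda>t. ?p t - ?q t) = (\<lambda>t. deriv ?p t - deriv ?q t)"
    by (intro ext DERIV_imp_deriv DERIV_diff Ck_DERIV[OF C3(1)] Ck_DERIV[OF C3(2)]) auto
  have d2: "deriv (\<lambda>t. deriv ?p t - deriv ?q t) = (\<lambda>t. deriv (deriv ?p) t - deriv (deriv ?q) t)"
    by (intro ext DERIV_imp_deriv DERIV_diff Ck_DERIV[OF C2(1)] Ck_DERIV[OF C2(2)]) auto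
  have "(\<lambda>x. p x - q x) \<in> Ck_circle 3"
    using Ck_diff[OF C3] by (simp add: Ck_circle_def)
  note bound = order_trans[OF Ck_norm_bound[OF this] norm]
  show ?thesis
    unfolding close_C2_def using bound[of 0] bound[of 1] bound[of 2]
    by (auto simp: numeral_2_eq_2 d1 d2)
qed

lemma periodic_response_realises:
  assumes lift: "expanding_lift F d lam D" "is_lift T0 F" and F: "F \<in> Ck 3"
    and \<rho>: "\<rho> \<in> Ck 2" "periodic \<rho>" "expanding_lift.L F d \<rho> = \<rho>" "circ_int \<rho> = 1"
    and \<rho>0: "invariant_density T0 \<rho>0"
    and \<rho>1: "\<rho>1 \<in> Ck_circle 1" "(LINT x|circle_lebesgue. \<rho>1 x) = 0"
    and resp: "\<And>x. deriv (expanding_lift.S F d (\<lambda>t. \<epsilon> (circ t) * (\<rho> t / deriv F t))) x =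
      expanding_lift.L F d (\<lambda>t. \<rho>1 (circ t)) x - \<rho>1 (circ x)"
  shows "realises T0 \<rho>0 \<rho>1 \<epsilon>"
  unfolding realises_def
proof (intro allI impI)
  fix \<eta> T \<rho>\<delta>
  assume fam: "differentiable_family \<eta> T0 \<epsilon> T"
    and dens: "\<forall>\<delta>\<in>{-\<eta><..<\<eta>}. invariant_density (T \<delta>) (\<rho>\<delta> \<delta>)"
  interpret expanding_lift F d lam D by fact
  obtain h where \<eta>: "\<eta> > 0" and \<epsilon>: "\<epsilon> \<in> Ck_circle 3"
    and exp: "\<And>\<delta>. \<delta> \<in> {-\<eta><..<\<eta>} \<Longrightarrow> expanding_map 3 (T \<delta>)"
    and h: "\<forall>\<^sub>F \<delta> in at 0. h \<delta> \<in> Ck_circle 3 \<and> (\<forall>x. T \<delta> x = T0 x + circ (h \<delta> x))"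
    and lim: "((\<lambda>\<delta>. Ck_norm 3 (\<lambda>x. h \<delta> x / \<delta> - \<epsilon> x)) \<longlongrightarrow> 0) (at 0)"
    using fam unfolding differentiable_family_def by blast
  \<comment> \<open>Dividing the displacement by \<delta> gives the family \<open>p\<close> of
    \<open>linear_response\<close>; the value at \<delta> = 0 is irrelevant for the limit.\<close>
  define p where "p \<delta> t = h \<delta> (circ t) / \<delta>" for \<delta> t
  have small: "\<forall>\<^sub>F \<delta> in at 0. \<delta> \<noteq> 0 \<and> \<delta> \<in> {-\<eta><..<\<eta>}"
    unfolding eventually_at using \<eta> by (intro exI[of _ \<eta>]) (auto simp: dist_real_def)
  have hp: "(\<lambda>x. h \<delta> x / \<delta>) \<in> Ck_circle 3" if "h \<delta> \<in> Ck_circle 3" for \<delta>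
    using that Ck_mult[OF Ck_const[of "1 / \<delta>"], of _ 3] by (simp add: Ck_circle_def)
  have lift_dens: "(\<lambda>t. \<rho>\<delta> \<delta> (circ t)) \<in> L1_periodic \<and> circ_int (\<lambda>t. \<rho>\<delta> \<delta> (circ t)) = 1 \<and>
      (AE x in lebesgue_on {0..1}. expanding_lift.L (\<lambda>t. F t + \<delta> * p \<delta> t) d (\<lambda>t. \<rho>\<delta> \<delta> (circ t)) x = \<rho>\<delta> \<delta> (circ x))"
    if \<delta>: "\<delta> \<noteq> 0" "\<delta> \<in> {-\<eta><..<\<eta>}" and h\<delta>: "h \<delta> \<in> Ck_circle 3" "\<forall>x. T \<delta> x = T0 x + circ (h \<delta> x)" for \<delta>
  proof -
    have eq: "(\<lambda>t. F t + \<delta> * p \<delta> t) = (\<lambda>t. F t + h \<delta> (circ t))" using \<delta> by (simp add: p_def)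
    have C: "(\<lambda>t. F t + h \<delta> (circ t)) \<in> Ck 3"
      using h\<delta>(1) by (intro Ck_add F) (simp add: Ck_circle_def)
    have lift': "is_lift (T \<delta>) (\<lambda>t. F t + h \<delta> (circ t))"
      using h\<delta>(2) lift(2) Ck_continuous[OF C] by (auto simp: is_lift_def circ_add)
    obtain lam' D' where el: "expanding_lift (\<lambda>t. F t + h \<delta> (circ t)) d lam' D'"
    proof (rule expanding_lift_of_lift[OF lift'])
      show "(\<lambda>t. F t + h \<delta> (circ t)) \<in> Ck 2" using Ck_antimono[OF C] by simp
      show "F (t + 1) + h \<delta> (circ (t + 1)) = F t + h \<delta> (circ t) + real d" for t by (simp add: F_shift)
    qed (use d_pos exp[OF \<delta>(2)] in \<open>auto simp: expanding_map_def\<close>)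
    show ?thesis
      using on_circle_invariant_density[OF el lift'] dens \<delta>(2) unfolding eq by blast
  qed
  let ?\<rho>1 = "\<lambda>t. \<rho>1 (circ t)"
  have \<rho>1C: "?\<rho>1 \<in> Ck 1" using \<rho>1(1) by (simp add: Ck_circle_def)
  have \<rho>1m: "\<rho>1 \<in> borel_measurable circle_lebesgue"
    using Ck_continuous[OF \<rho>1C, of UNIV]
    by (intro circle_borel_measurable measurable_completion) (simp add: borel_measurable_continuous_onI)
  have "((\<lambda>\<delta>. circ_int (\<lambda>x. \<bar>(\<rho>\<delta> \<delta> (circ x) - \<rho> x) / \<delta> - \<rho>1 (circ x)\<bar>)) \<longlongrightarrow> 0) (at 0)"
  proof (rule linear_response[OF F \<rho> \<rho>1C periodic_circ, where \<epsilon>="\<lambda>t. \<epsilon> (circ t)" and p=p])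
    show "circ_int ?\<rho>1 = 0" using circle_integral[OF \<rho>1m] \<rho>1(2) by simp
    show "(\<lambda>t. \<epsilon> (circ t)) \<in> Ck 2" using \<epsilon> Ck_antimono[of _ 3 2] by (simp add: Ck_circle_def)
    show "\<forall>\<^sub>F \<delta> in at 0. p \<delta> \<in> Ck 2 \<and> periodic (p \<delta>)"
      using h
    proof eventually_elim
      case (elim \<delta>)
      then show ?case using hp[of \<delta>] Ck_antimono[of "p \<delta>" 3 2]
        by (simp add: Ck_circle_def p_def[abs_def] periodic_def)
    qed
    show "\<forall>\<^sub>F \<delta> in at 0. close_C2 \<tau> (p \<delta>) (\<lambda>t. \<epsilon> (circ t))" if "\<tau> > 0" for \<tau>
      using h order_tendstoD(2)[OF lim that]
    proof eventually_elim
      case (elim \<delta>)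
      then show ?case
        using close_C2_of_Ck_norm[OF hp \<epsilon>, of \<delta> \<tau>] by (simp add: p_def[abs_def])
    qed
    show "\<forall>\<^sub>F \<delta> in at 0. (\<lambda>t. \<rho>\<delta> \<delta> (circ t)) \<in> L1_periodic \<and> circ_int (\<lambda>t. \<rho>\<delta> \<delta> (circ t)) = 1 \<and>
      (AE x in lebesgue_on {0..1}. expanding_lift.L (\<lambda>t. F t + \<delta> * p \<delta> t) d (\<lambda>t. \<rho>\<delta> \<delta> (circ t)) x = \<rho>\<delta> \<delta> (circ x))"
      using small h by eventually_elim (use lift_dens in blast)
  qed (use resp periodic_circ in auto)
  \<comment> \<open>The given \<open>\<rho>0\<close> is exchanged for its smooth representative
    \<rho>, to which it is equal almost everywhere.\<close>
  moreover have "\<forall>\<^sub>F \<delta> in at 0. circ_int (\<lambda>x. \<bar>(\<rho>\<delta> \<delta> (circ x) - \<rho> x) / \<delta> - \<rho>1 (circ x)\<bar>) =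
      (LINT x|circle_lebesgue. \<bar>(\<rho>\<delta> \<delta> x - \<rho>0 x) / \<delta> - \<rho>1 x\<bar>)"
    using small
  proof eventually_elim
    case (elim \<delta>)
    have int: "integrable circle_lebesgue (\<rho>\<delta> \<delta>)"
      using dens elim by (auto simp: invariant_density_def)
    have m: "\<rho>\<delta> \<delta> \<in> borel_measurable circle_lebesgue" "\<rho>0 \<in> borel_measurable circle_lebesgue"
      using dens elim \<rho>0 by (auto simp: invariant_density_def)
    note \<rho>0' = on_circle_invariant_density[OF lift \<rho>0]
    have ae: "AE t in lebesgue_on {0..1}. \<rho>0 (circ t) = \<rho> t"
      by (rule invariant_density_unique[OF \<rho>0' Ck_L1_periodic[OF \<rho>(1,2)] \<rho>(4,3)])
    have "(LINT x|circle_lebesgue. \<bar>(\<rho>\<delta> \<delta> x - \<rho>0 x) / \<delta> - \<rho>1 x\<bar>) =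
        circ_int (\<lambda>t. \<bar>(\<rho>\<delta> \<delta> (circ t) - \<rho>0 (circ t)) / \<delta> - \<rho>1 (circ t)\<bar>)"
      by (intro circle_integral borel_measurable_abs borel_measurable_diff borel_measurable_divide
          borel_measurable_const m \<rho>1m)
    also have "\<dots> = circ_int (\<lambda>x. \<bar>(\<rho>\<delta> \<delta> (circ x) - \<rho> x) / \<delta> - \<rho>1 (circ x)\<bar>)"
    proof (rule integral_cong_AE)
      have meas: "(\<lambda>t. \<rho>\<delta> \<delta> (circ t)) \<in> borel_measurable (lebesgue_on {0..1})"
          "(\<lambda>t. \<rho>0 (circ t)) \<in> borel_measurable (lebesgue_on {0..1})"
          "\<rho> \<in> borel_measurable (lebesgue_on {0..1})" "(\<lambda>t. \<rho>1 (circ t)) \<in> borel_measurable (lebesgue_on {0..1})"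
        by (intro borel_measurable_integrable L1_periodic_integrable circle_integrable int \<rho>0'(1)
            Ck_L1_periodic[OF \<rho>(1,2)] Ck_L1_periodic[OF \<rho>1C periodic_circ])+
      show "(\<lambda>t. \<bar>(\<rho>\<delta> \<delta> (circ t) - \<rho>0 (circ t)) / \<delta> - \<rho>1 (circ t)\<bar>) \<in> borel_measurable (lebesgue_on {0..1})"
        "(\<lambda>x. \<bar>(\<rho>\<delta> \<delta> (circ x) - \<rho> x) / \<delta> - \<rho>1 (circ x)\<bar>) \<in> borel_measurable (lebesgue_on {0..1})"
        by (intro borel_measurable_abs borel_measurable_diff borel_measurable_divide borel_measurable_const meas)+
      show "AE t in lebesgue_on {0..1}. \<bar>(\<rho>\<delta> \<delta> (circ t) - \<rho>0 (circ t)) / \<delta> - \<rho>1 (circ t)\<bar> =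
          \<bar>(\<rho>\<delta> \<delta> (circ t) - \<rho> t) / \<delta> - \<rho>1 (circ t)\<bar>"
        using ae by eventually_elim simp
    qed
    finally show ?case by simp
  qed
  ultimately show "((\<lambda>\<delta>. LINT x|circle_lebesgue. \<bar>(\<rho>\<delta> \<delta> x - \<rho>0 x) / \<delta> - \<rho>1 x\<bar>) \<longlongrightarrow> 0) (at 0)"
    by (rule Lim_transform_eventually)
qed

text \<open>A difference of consecutive values of a \<open>d\<close>-periodic function: its sum over
  \<open>d\<close> consecutive shifts telescopes to 0. For \<open>d = 1\<close> it would vanish
  identically.\<close>

definition null_wave :: "nat \<Rightarrow> real \<Rightarrow> real" where
  "null_wave d s = sin (2 * pi * s / real d) - sin (2 * pi * (s + 1) / real d)"

lemma null_wave_shift: "d > 0 \<Longrightarrow> null_wave d (s + real d) = null_wave d s"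
proof -
  assume "d > 0"
  then have "2 * pi * (t + real d) / real d = 2 * pi * t / real d + 2 * pi" for t
    by (simp add: field_simps)
  then have eq: "sin (2 * pi * (t + real d) / real d) = sin (2 * pi * t / real d)" for t
    by (simp only: sin_periodic)
  have "s + real d + 1 = (s + 1) + real d" by simp
  then show ?thesis by (simp only: null_wave_def eq)
qed

lemma null_wave_sum:
  assumes "d > 0" shows "(\<Sum>j<d. null_wave d (x + real j)) = 0"
proof -
  have "(\<Sum>j<d. null_wave d (x + real j)) =
      (\<Sum>j<d. sin (2 * pi * (x + real j) / real d) - sin (2 * pi * (x + real (Suc j)) / real d))"
    by (simp add: null_wave_def ac_simps)
  also have "\<dots> = sin (2 * pi * (x + real 0) / real d) - sin (2 * pi * (x + real d) / real d)"
    by (rule sum_lessThan_telescope')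
  also have "2 * pi * (x + real d) / real d = 2 * pi * x / real d + 2 * pi"
    using assms by (simp add: field_simps)
  finally show ?thesis by simp
qed

lemma null_wave_Ck: "null_wave d \<in> Ck k"
  unfolding null_wave_def[abs_def]
  by (cases "d = 0")
     (auto intro!: Ck_diff Ck_compose[OF Ck_sin_cos(1)] Ck_divide Ck_mult Ck_add)

text \<open>Infinitely many cosine values are needed to conclude that a polynomial in the cosine
  vanishes. At \<open>-1/2\<close> the wave equals \<open>-2 sin (pi / d)\<close>, which is nonzero
  for \<open>d \<ge> 2\<close>, and continuity provides an interval.\<close>

lemma null_wave_cos_values_infinite:
  assumes "d \<ge> 2"
  shows "infinite ((\<lambda>s. cos (2 * pi * s)) ` {s. null_wave d s \<noteq> 0})"
proof -
  have "null_wave d (-1/2) = - 2 * sin (pi / real d)"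
    by (simp add: null_wave_def)
  moreover have "sin (pi / real d) > 0"
    using assms by (intro sin_gt_zero) (auto simp: field_simps)
  ultimately have "null_wave d (-1/2) \<noteq> 0" by simp
  moreover have "isCont (null_wave d) (-1/2)"
    using Ck_continuous[OF null_wave_Ck[of d 0], of UNIV] by (simp add: continuous_on_eq_continuous_at)
  ultimately obtain e where e: "e > 0" "\<And>s. dist (-1/2) s < e \<Longrightarrow> null_wave d s \<noteq> 0"
    using continuous_at_avoid by metis
  \<comment> \<open>Length at most \<open>1/2\<close> keeps the interval inside
    \<open>[-1/2, 0]\<close>, where \<open>cos (2 * pi * s)\<close> is injective.\<close>
  define b where "b = min e (1/2)"
  let ?I = "{-1/2<..<-1/2 + b}"
  have "inj_on (\<lambda>s. cos (2 * pi * s)) ?I"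
  proof (rule inj_onI)
    fix s t assume st: "s \<in> ?I" "t \<in> ?I" and eq: "cos (2 * pi * s) = cos (2 * pi * t)"
    have "cos (- (2 * pi * s)) = cos (- (2 * pi * t))" using eq by simp
    moreover have "0 \<le> - (2 * pi * u) \<and> - (2 * pi * u) \<le> pi" if "u \<in> ?I" for u
    proof -
      have "-1/2 \<le> u" "u \<le> 0" using that by (auto simp: b_def)
      then have "pi * (-2 * u) \<le> pi * 1" by (intro mult_left_mono) auto
      moreover have "0 \<le> pi * (-2 * u)" using \<open>u \<le> 0\<close> mult_nonneg_nonneg[of pi "-2 * u"] by simp
      ultimately show ?thesis by (simp add: algebra_simps)
    qed
    ultimately have "- (2 * pi * s) = - (2 * pi * t)" using st cos_inj_pi by blast
    then show "s = t" by simp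
  qed
  moreover have "infinite ?I" using e(1) by (simp add: b_def infinite_Ioo)
  ultimately have "infinite ((\<lambda>s. cos (2 * pi * s)) ` ?I)" using finite_imageD by blast
  moreover have "?I \<subseteq> {s. null_wave d s \<noteq> 0}"
    using e(2) by (auto simp: b_def dist_real_def)
  ultimately show ?thesis by (meson finite_subset image_mono)
qed

section \<open>A criterion for infinite dimension\<close>

lemma sum_fun_apply: "(\<Sum>i\<in>I. f i) x = (\<Sum>i\<in>I. f i x)"
  by (induction I rule: infinite_finite_induct) (auto simp: plus_fun_def zero_fun_def)

text \<open>A finite \<open>S\<close> with \<open>A\<close> in its affine hull would have all
  differences \<open>v n\<close> in its span, too small for infinitely many independent vectors.
  Independence is asked of the indexed family, which also yields injectivity of
  \<open>v\<close>.\<close>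

lemma infinite_dim_affineI:
  fixes v :: "nat \<Rightarrow> 'a::real_vector"
  assumes "affine A" "e \<in> A" "\<And>n. e + v n \<in> A"
    and indep: "\<And>N c. finite N \<Longrightarrow> (\<Sum>n\<in>N. c n *\<^sub>R v n) = 0 \<Longrightarrow> \<forall>n\<in>N. c n = 0"
  shows "infinite_dim_affine A"
  unfolding infinite_dim_affine_def
proof (intro conjI notI)
  show "affine A" by fact
  assume "\<exists>S. finite S \<and> A \<subseteq> affine hull S"
  then obtain S where S: "finite S" "A \<subseteq> affine hull S" by blast
  then have AS: "A \<subseteq> span S" using affine_hull_subset_span by blast
  have inj: "inj v"
  proof (rule injI, rule ccontr)
    fix m n assume mn: "v m = v n" "m \<noteq> n"
    have "(\<Sum>i\<in>{m, n}. (if i = m then 1 else - 1) *\<^sub>R v i) = 0" using mn by simp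
    from indep[OF _ this] show False by simp
  qed
  have "independent (range v)"
    unfolding independent_explicit_module
  proof (intro allI impI)
    fix t u w assume t: "finite t" "t \<subseteq> range v" "(\<Sum>x\<in>t. u x *\<^sub>R x) = 0" "w \<in> t"
    define N where "N = v -` t"
    have N: "finite N" "v ` N = t" using t inj by (auto simp: N_def intro: finite_vimageI)
    have "(\<Sum>n\<in>N. u (v n) *\<^sub>R v n) = 0"
      using t(3) sum.reindex[of v N "\<lambda>x. u x *\<^sub>R x"] inj N(2) by (simp add: inj_on_subset)
    from indep[OF N(1) this] show "u w = 0" using t(4) N(2) by auto
  qed
  moreover have "range v \<subseteq> span S"
  proof
    fix x assume "x \<in> range v"
    then obtain n where "x = (e + v n) - e" by auto
    then show "x \<in> span S" using AS assms(2,3) by (metis span_diff subsetD)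
  qed
  ultimately have "finite (range v)" using independent_span_bound[OF S(1)] by blast
  then show False using inj by (simp add: finite_image_iff)
qed

theorem theorem4p1:
  fixes k :: nat and T0 :: "circle \<Rightarrow> circle" and \<rho>0 \<rho>1 :: "circle \<Rightarrow> real"
  assumes "k \<ge> 4"
    and "expanding_map k T0"
    and "invariant_density T0 \<rho>0"
    and "\<rho>1 \<in> Ck_circle (k - 2)"
    and "(LINT x|circle_lebesgue. \<rho>1 x) = 0"
  shows "(\<exists>\<epsilon>\<in>Ck_circle (k - 1). realises T0 \<rho>0 \<rho>1 \<epsilon>) \<and>
    (\<exists>A \<subseteq> Ck_circle (k - 1). infinite_dim_affine A \<and> (\<forall>\<epsilon>\<in>A. realises T0 \<rho>0 \<rho>1 \<epsilon>))"
proof -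
  obtain F d lam D where F: "is_lift T0 F" "F \<in> Ck k" and d: "d \<ge> 2" and el: "expanding_lift F d lam D"
    by (rule expanding_map_lift[OF assms(2)]) (use assms(1) in simp)
  interpret expanding_lift F d lam D by fact
  \<comment> \<open>Bookkeeping of smoothness: \<rho>, \<Gamma> and \<open>deriv F\<close> are of
    class \<open>m + 1\<close>, \<open>\<rho>1\<close> only of class \<open>m\<close>. Since
    \<open>m \<ge> 2\<close>, the solutions \<epsilon> are at least \<open>C^3\<close>, as
    \<open>differentiable_family\<close> demands.\<close>
  define m where "m = k - 2"
  have k: "k = Suc (Suc m)" "m \<ge> 2" using assms(1) by (auto simp: m_def)
  have Fm: "F \<in> Ck (Suc (Suc m))" "F \<in> Ck (Suc m)" "F \<in> Ck 3"
    using F(2) Ck_antimono[OF F(2)] k by auto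
  have F'm: "deriv F \<in> Ck (Suc m)" by (rule Ck_Suc_deriv(2)[OF Fm(1)])
  obtain \<rho> where \<rho>: "\<rho> \<in> Ck (Suc m)" "periodic \<rho>" "\<And>x. \<rho> x > 0" "L \<rho> = \<rho>" "circ_int \<rho> = 1"
    using invariant_density_Ck[OF Fm(1)] by blast
  have \<rho>nz: "\<rho> x \<noteq> 0" for x using \<rho>(3)[of x] by simp
  let ?\<rho>1 = "\<lambda>t. \<rho>1 (circ t)"
  have \<rho>1: "?\<rho>1 \<in> Ck m" using assms(4) by (simp add: Ck_circle_def m_def)
  \<comment> \<open>Right side of the response equation. Its mean is 0 because \<open>L\<close>
    preserves integrals, which makes the primitive \<Gamma> periodic.\<close>
  define g where "g x = L ?\<rho>1 x - \<rho>1 (circ x)" for x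
  have g: "g \<in> Ck m" "periodic g"
    unfolding g_def[abs_def] using L_periodic[OF periodic_circ, of \<rho>1]
    by (auto intro!: Ck_diff L_Ck \<rho>1 Fm simp: periodic_def)
  have "circ_int g = 0"
    unfolding g_def using L_integral[OF Ck_L1_periodic[OF \<rho>1 periodic_circ]] Ck_L1_periodic[OF \<rho>1 periodic_circ]
    by (simp add: L1_periodic_integrable)
  obtain \<Gamma> where \<Gamma>: "\<And>x. (\<Gamma> has_real_derivative g x) (at x)"
    using antiderivative_UNIV[OF Ck_continuous[OF g(1)]] by blast
  have \<Gamma>_C: "\<Gamma> \<in> Ck (Suc m)" by (rule Ck_SucI[OF \<Gamma> g(1)])
  have "(g has_integral \<Gamma> 1 - \<Gamma> 0) {0..1}"
    using \<Gamma> by (intro fundamental_theorem_of_calculus)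
      (auto simp: has_real_derivative_iff_has_vector_derivative[symmetric] intro: has_field_derivative_at_within)
  then have "integral {0..1} g = \<Gamma> 1 - \<Gamma> 0" by (rule integral_unique)
  moreover have "integral {0..1} g = circ_int g"
    using L1_periodic_integrable[OF Ck_L1_periodic[OF g]] by (simp add: lebesgue_integral_eq_integral)
  ultimately have \<Gamma>_per: "periodic \<Gamma>"
    using antiderivative_periodic_shift[OF \<Gamma> g(2)] \<open>circ_int g = 0\<close> by (simp add: periodic_def)
  \<comment> \<open>Solutions of the integrated equation for one fixed primitive \<Gamma>, hence an
    affine set.\<close>
  define A where "A = {\<epsilon> \<in> Ck_circle (k - 1). \<forall>x. S (\<lambda>t. \<epsilon> (circ t) * (\<rho> t / deriv F t)) x = \<Gamma> x}"
  have A_realises: "realises T0 \<rho>0 \<rho>1 \<epsilon>" if "\<epsilon> \<in> A" for \<epsilon>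
  proof (rule periodic_response_realises[OF el F(1) Fm(3) _ \<rho>(2,4,5) assms(3) _ assms(5)])
    show "\<rho> \<in> Ck 2" using Ck_antimono[OF \<rho>(1), of 2] k by simp
    show "\<rho>1 \<in> Ck_circle 1" using Ck_antimono[OF \<rho>1, of 1] k by (simp add: Ck_circle_def)
    have "S (\<lambda>t. \<epsilon> (circ t) * (\<rho> t / deriv F t)) = \<Gamma>" using that by (auto simp: A_def)
    then show "deriv (S (\<lambda>t. \<epsilon> (circ t) * (\<rho> t / deriv F t))) x = L ?\<rho>1 x - \<rho>1 (circ x)" for x
      using DERIV_imp_deriv[OF \<Gamma>[of x]] by (simp add: g_def)
  qed
  have lift_per: "periodic (\<lambda>t. f (F t))" if "\<And>s. f (s + real d) = f s" for f :: "real \<Rightarrow> real"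
    using that by (simp add: periodic_def F_shift)
  \<comment> \<open>With \<epsilon> of this form the weights cancel, and \<open>F (G y) = y\<close>
    reduces \<open>S\<close> to a plain sum of \<open>f\<close> over integer shifts. Invariance of
    \<open>f\<close> under \<open>d\<close> makes \<open>f \<circ> F\<close> periodic.\<close>
  have from_lift: "on_circle (\<lambda>t. deriv F t / \<rho> t * f (F t)) \<in> Ck_circle (k - 1) \<and>
      S (\<lambda>t. on_circle (\<lambda>t. deriv F t / \<rho> t * f (F t)) (circ t) * (\<rho> t / deriv F t)) x = (\<Sum>j<d. f (x + real j))"
    if "f \<in> Ck (Suc m)" "\<And>s. f (s + real d) = f s" for f x
  proof -
    have per: "periodic (\<lambda>t. deriv F t / \<rho> t * f (F t))"
      using lift_per[of f, OF that(2)] F'_periodic \<rho>(2) by (simp add: periodic_def)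
    have "(\<lambda>t. deriv F t / \<rho> t * f (F t)) \<in> Ck (Suc m)"
      by (rule Ck_mult[OF Ck_divide[OF F'm \<rho>(1) \<rho>nz] Ck_compose[OF that(1) Fm(2)]])
    then have "on_circle (\<lambda>t. deriv F t / \<rho> t * f (F t)) \<in> Ck_circle (k - 1)"
      using on_circle_Ck[OF per] k by simp
    moreover have "(\<lambda>t. on_circle (\<lambda>t. deriv F t / \<rho> t * f (F t)) (circ t) * (\<rho> t / deriv F t)) = (\<lambda>t. f (F t))"
      unfolding on_circle_circ[OF per] using F'_neq_0 \<rho>nz by simp
    ultimately show ?thesis by (simp add: S_def)
  qed
  \<comment> \<open>The \<open>d\<close> shifts of \<Gamma> coincide, which explains the division by
    \<open>d\<close>.\<close>
  define \<epsilon>0 where "\<epsilon>0 = on_circle (\<lambda>t. deriv F t / \<rho> t * (\<Gamma> (F t) / real d))"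
  have \<epsilon>0: "\<epsilon>0 \<in> A"
  proof -
    have "\<Gamma> (x + real j) = \<Gamma> x" for x j by (rule periodic_of_nat[OF \<Gamma>_per])
    then show ?thesis
      using from_lift[of "\<lambda>s. \<Gamma> s / real d"] d_pos Ck_divide[OF \<Gamma>_C Ck_const, of "real d"]
      by (simp add: A_def \<epsilon>0_def)
  qed
  \<comment> \<open>Powers of the 1-periodic cosine factor out of the sum over shifts, so each
    \<open>v n\<close> solves the homogeneous equation; a linear relation between them becomes a
    polynomial relation for the cosine.\<close>
  define v where "v n = on_circle (\<lambda>t. deriv F t / \<rho> t * (null_wave d (F t) * cos (2 * pi * F t) ^ n))" for n
  have cos_shift: "cos (2 * pi * (s + real j)) = cos (2 * pi * s)" for s j
    using periodic_of_nat[of "\<lambda>s. cos (2 * pi * s)" s j] by (simp add: periodic_def distrib_left)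
  have wave: "(\<lambda>s. null_wave d s * cos (2 * pi * s) ^ n) \<in> Ck (Suc m)" for n
    by (intro Ck_mult Ck_power null_wave_Ck Ck_compose[OF Ck_sin_cos(2)] Ck_const Ck_id)
  have v: "v n \<in> Ck_circle (k - 1)" "S (\<lambda>t. v n (circ t) * (\<rho> t / deriv F t)) x = 0" for n x
  proof -
    have sh: "null_wave d (s + real d) * cos (2 * pi * (s + real d)) ^ n = null_wave d s * cos (2 * pi * s) ^ n" for s
      using d_pos by (simp only: cos_shift null_wave_shift)
    note fl = from_lift[OF wave[of n] sh, of x, folded v_def]
    show "v n \<in> Ck_circle (k - 1)" using fl by blast
    have "(\<Sum>j<d. null_wave d (x + real j) * cos (2 * pi * (x + real j)) ^ n) =
        (\<Sum>j<d. null_wave d (x + real j)) * cos (2 * pi * x) ^ n"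
      by (simp only: cos_shift sum_distrib_right)
    then show "S (\<lambda>t. v n (circ t) * (\<rho> t / deriv F t)) x = 0"
      using fl null_wave_sum[OF d_pos, of x] by simp
  qed
  have "infinite_dim_affine A"
  proof (rule infinite_dim_affineI[where v=v, OF _ \<epsilon>0])
    show "affine A"
      unfolding affine_def
    proof (intro ballI allI impI)
      fix f h and \<alpha> \<beta> :: real assume fh: "f \<in> A" "h \<in> A" "\<alpha> + \<beta> = 1"
      have eq: "(\<alpha> *\<^sub>R f + \<beta> *\<^sub>R h) y = \<alpha> * f y + \<beta> * h y" for y
        by (simp add: plus_fun_def scaleR_fun_def)
      have "\<alpha> *\<^sub>R f + \<beta> *\<^sub>R h \<in> Ck_circle (k - 1)"
        unfolding Ck_circle_def mem_Collect_eq eq using fh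
        by (intro Ck_add Ck_mult Ck_const) (auto simp: A_def Ck_circle_def)
      moreover have "S (\<lambda>t. (\<alpha> *\<^sub>R f + \<beta> *\<^sub>R h) (circ t) * (\<rho> t / deriv F t)) x = \<Gamma> x" for x
      proof -
        have "S (\<lambda>t. (\<alpha> *\<^sub>R f + \<beta> *\<^sub>R h) (circ t) * (\<rho> t / deriv F t)) x =
            S (\<lambda>t. \<alpha> * (f (circ t) * (\<rho> t / deriv F t)) + \<beta> * (h (circ t) * (\<rho> t / deriv F t))) x"
          unfolding eq by (simp only: distrib_right mult.assoc)
        also have "\<dots> = \<alpha> * \<Gamma> x + \<beta> * \<Gamma> x" using fh by (simp only: S_lin) (simp add: A_def)
        also have "\<dots> = \<Gamma> x" using fh(3) by (simp flip: distrib_right)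
        finally show ?thesis .
      qed
      ultimately show "\<alpha> *\<^sub>R f + \<beta> *\<^sub>R h \<in> A" by (simp add: A_def)
    qed
    show "\<epsilon>0 + v n \<in> A" for n
    proof -
      have eq: "(\<epsilon>0 + v n) y = \<epsilon>0 y + v n y" for y by (simp add: plus_fun_def)
      have "\<epsilon>0 + v n \<in> Ck_circle (k - 1)"
        unfolding Ck_circle_def mem_Collect_eq eq using \<epsilon>0 v(1)[of n]
        by (intro Ck_add) (auto simp: A_def Ck_circle_def)
      moreover have "S (\<lambda>t. (\<epsilon>0 + v n) (circ t) * (\<rho> t / deriv F t)) x = \<Gamma> x" for x
        using S_lin[of 1 "\<lambda>t. \<epsilon>0 (circ t) * (\<rho> t / deriv F t)" 1 "\<lambda>t. v n (circ t) * (\<rho> t / deriv F t)" x]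
          \<epsilon>0 v(2)[of n x] unfolding eq distrib_right by (simp add: A_def)
      ultimately show ?thesis by (simp add: A_def)
    qed
    fix N :: "nat set" and c :: "nat \<Rightarrow> real"
    assume N: "finite N" and zero: "(\<Sum>n\<in>N. c n *\<^sub>R v n) = 0"
    define q where "q = (\<Sum>n\<in>N. monom (c n) n)"
    have "poly q (cos (2 * pi * s)) = 0" if s: "null_wave d s \<noteq> 0" for s
    proof -
      \<comment> \<open>Evaluating at \<open>G s\<close> turns \<open>F t\<close> into
        \<open>s\<close>.\<close>
      have vs: "v n (circ (G s)) = deriv F (G s) / \<rho> (G s) * null_wave d s * cos (2 * pi * s) ^ n" for n
      proof -
        have "periodic (\<lambda>t. deriv F t / \<rho> t * (null_wave d (F t) * cos (2 * pi * F t) ^ n))"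
          using F'_periodic \<rho>(2) null_wave_shift[OF d_pos] cos_shift[of _ d] by (simp add: periodic_def F_shift)
        from on_circle_circ[OF this, of "G s"] show ?thesis by (simp add: v_def)
      qed
      have "(\<Sum>n\<in>N. c n *\<^sub>R v n) (circ (G s)) = 0" unfolding zero by (simp add: zero_fun_def)
      then have "deriv F (G s) / \<rho> (G s) * null_wave d s * (\<Sum>n\<in>N. c n * cos (2 * pi * s) ^ n) = 0"
        by (simp add: sum_fun_apply scaleR_fun_def vs sum_distrib_left mult_ac)
      then have "(\<Sum>n\<in>N. c n * cos (2 * pi * s) ^ n) = 0" using s F'_neq_0 \<rho>nz by simp
      then show ?thesis by (simp add: q_def poly_sum poly_monom)
    qed
    then have "(\<lambda>s. cos (2 * pi * s)) ` {s. null_wave d s \<noteq> 0} \<subseteq> {x. poly q x = 0}" by blast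
    then have "infinite {x. poly q x = 0}"
      using null_wave_cos_values_infinite[OF d] finite_subset by blast
    then have "q = 0" using poly_roots_finite by blast
    show "\<forall>n\<in>N. c n = 0"
    proof
      fix n assume "n \<in> N"
      then have "coeff q n = c n" using N by (simp add: q_def coeff_sum if_distrib sum.delta cong: if_cong)
      then show "c n = 0" using \<open>q = 0\<close> by simp
    qed
  qed
  moreover have "A \<subseteq> Ck_circle (k - 1)" by (auto simp: A_def)
  ultimately show ?thesis using A_realises \<epsilon>0 by blast
qed

end
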